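(* Let $L$ be a lattice of signature $(2,n)$ with $n\ge3$, let $\Gamma$ be a finite-index subgroup of $\mathrm O^+(L)$, let $J\subset L$ be a primitive isotropic sublattice of rank $2$, let $\lambda=(\lambda_1\ge\cdots\ge\lambda_n\ge0)$ be a partition with ${}^t\lambda_1+{}^t\lambda_2\le n$ and $\lambda\neq\det$, let $k\in\mathbb Z$ and let $m>0$ be an integer. There exists an injective (linear) map $$J_{\lambda,k,m}(\Gamma(J)_{\mathbb Z})\hookrightarrow\bigoplus_{r=-\lambda_1}^{\lambda_1}J_{k+r,m}(\Gamma(J)_{\mathbb Z})^{\oplus\alpha(r)},$$ where $\alpha(r)$ is the rank of $\mathrm{Gr}^r\mathcal E_\lambda$, the level $r$ graded quotient of the $J$-filtration on $\mathcal E_\lambda$.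
   Context: Basic setting. A lattice is a free $\mathbb Z$-module of finite rank with a nondegenerate symmetric bilinear form with values in $\mathbb Z$; $L_F=L\otimes_{\mathbb Z}F$. $\mathcal D$ is a fixed connected component of $\{[\omega]\in\mathbb P(L_{\mathbb C}) : (\omega,\omega)=0,\ (\omega,\bar\omega)>0\}$; $\mathrm O^+(L)$ is the subgroup of $\mathrm O(L)$ preserving $\mathcal D$. Over $\mathcal D$: $\mathcal L\subset L_{\mathbb C}\otimes\mathcal O_{\mathcal D}$ is the tautological line bundle (fiber $\mathbb C\omega$) and $\mathcal E=\mathcal L^\perp/\mathcal L$ with its induced quadratic form. For a partition $\lambda$ as in the claim, $d=|\lambda|$ and an $n$-dimensional complex quadratic space $V$, $V^{[d]}\subset V^{\otimes d}$ is the intersection of the kernels of all contractions and $V_\lambda=c_\lambda\cdot V^{[d]}$ with $c_\lambda=b_\lambda a_\lambda$ the Young symmetrizer of the column canonical tableau ($a_\lambda$ the sum over the row subgroup, $b_\lambda$ the signed sum over the column subgroup). $\det$ corresponds to $(1^n)$. Applied fiberwise to $\mathcal E$ this gives $\mathcal E_\lambda\subset\mathcal E^{\otimes d}$; $\mathcal E_{\lambda,k}=\mathcal E_\lambda\otimes\mathcal L^{\otimes k}$. $J$-filtration. Let $\mathcal E_J\subset\mathcal E$ be the sub line bundle whose fiber at $[\omega]$ is the image of $\omega^\perp\cap J_{\mathbb C}$ in $\omega^\perp/\mathbb C\omega$. Put $F^1\mathcal E=\mathcal E_J$, $F^0\mathcal E=\mathcal E_J^\perp$, $F^{-1}\mathcal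 E=\mathcal E$, $F^r\mathcal E^{\otimes d}=\sum_{i_1+\cdots+i_d=r}F^{i_1}\mathcal E\otimes\cdots\otimes F^{i_d}\mathcal E$ ($i_j\in\{-1,0,1\}$), $F^r\mathcal E_\lambda=\mathcal E_\lambda\cap F^r\mathcal E^{\otimes d}$, $\mathrm{Gr}^r\mathcal E_\lambda=F^r\mathcal E_\lambda/F^{r+1}\mathcal E_\lambda$. $I$-trivialization and tube domain. For a primitive isotropic $I\subset L$ of rank $1$, put $V(I)=(I^\perp/I)_{\mathbb C}$. The pairing with $I_{\mathbb C}$ gives $\mathcal L\simeq I_{\mathbb C}^\vee\otimes\mathcal O_{\mathcal D}$, and $I_{\mathbb C}^\perp/I_{\mathbb C}\leftarrow I_{\mathbb C}^\perp\cap\omega^\perp\to\omega^\perp/\mathbb C\omega$ give $\mathcal E\simeq V(I)\otimes\mathcal O_{\mathcal D}$; hence $\mathcal E_{\lambda,k}\simeq V(I)_{\lambda,k}\otimes\mathcal O_{\mathcal D}$, $V(I)_{\lambda,k}=V(I)_\lambda\otimes(I_{\mathbb C}^\vee)^{\otimes k}$. Let $U(I)_F=(I^\perp/I)_F\otimes I_F$ (generators of $I$ given norm $1$). Choose a rank $1$ isotropic $I'\subset L$ with $(I,I')\ne0$; with $e$ a generator of $I$, $e'\in I'_{\mathbb Q}$, $(e,e')=1$ and $V(I)=(I\oplus I')_{\mathbb C}^\perp$, the map $z\otimes e\mapsto[e'+z-\frac12(z,z)e]$ identifies $\{Z\in U(I)_{\mathbb C}:\mathrm{Im}(Z)\in\mathcal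 C_I\}$ with $\mathcal D$, for one component $\mathcal C_I$ of $\{v\in U(I)_{\mathbb R}:(v,v)>0\}$. The $J$-cusp. For $F=\mathbb Q,\mathbb R$, $\Gamma(J)_F$ is the group of isometries of $L_F$ preserving $J_F$ and acting trivially on $\wedge^2J_F$ and $(J^\perp/J)_F$; $U(J)_F\subset\Gamma(J)_F$ is the subgroup acting trivially on $J_F^\perp$ ($\simeq\wedge^2J_F$, central). $\Gamma(J)_{\mathbb Z}=\Gamma(J)_{\mathbb Q}\cap\Gamma$, $U(J)_{\mathbb Z}=U(J)_{\mathbb Q}\cap\Gamma\simeq\mathbb Z$, $\overline{\Gamma(J)}_{\mathbb Z}=\Gamma(J)_{\mathbb Z}/U(J)_{\mathbb Z}$. The projection $\mathbb PL_{\mathbb C}\dashrightarrow\mathbb P(L/J)_{\mathbb C}$ restricts to $\mathcal D\to\mathcal V_J$ (onto its image), a bundle of upper half planes on whose fibers $U(J)_{\mathbb R}$ acts by real translations. $\mathcal X(J)=\mathcal D/U(J)_{\mathbb Z}$ is a punctured disc bundle over $\mathcal V_J$; $\overline{\mathcal X(J)}$ is the disc bundle obtained by filling in the origins, $\Delta_J\simeq\mathcal V_J$ its boundary divisor and $\Theta_J$ the conormal bundle of $\Delta_J$. For $I\subset J$ the $I$-trivialization descends to $\mathcal X(J)$ and $\mathcal E_{\lambda,k}$ is extended over $\overline{\mathcal X(J)}$ so that it becomes $V(I)_{\lambda,k}\otimes\mathcal O_{\overline{\mathcal X(J)}}$ (independent of $I\subset J$); $\overline{\Gamma(J)}_{\mathbb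 Z}$ acts on it and on $\Theta_J$. Jacobi forms. Let $I\subset J$ be primitive of rank $1$. Then $U(J)_F=(J/I)_F\otimes I_F$ is an isotropic line in $U(I)_F$ and $\mathcal D\to\mathcal V_J$ is the restriction of $U(I)_{\mathbb C}\to U(I)_{\mathbb C}/U(J)_{\mathbb C}$, so $\Delta_J\subset U(I)_{\mathbb C}/U(J)_{\mathbb C}$. Let $v_{J,\Gamma}$ be the generator of $U(J)_{\mathbb Z}$ lying in $\overline{\mathcal C_I}$ and choose an isotropic $l_{J,\Gamma}\in U(I)_{\mathbb Q}$ with $(v_{J,\Gamma},l_{J,\Gamma})=1$. The function $\omega_J=\exp(2\pi i(l_{J,\Gamma},Z))$ descends to $\mathcal X(J)$ and extends to a generator of the ideal sheaf of $\Delta_J$; together with the $I$-trivialization it gives $\mathcal E_{\lambda,k}|_{\Delta_J}\otimes\Theta_J^{\otimes m}\simeq V(I)_{\lambda,k}\otimes\mathcal O_{\Delta_J}$. A $\overline{\Gamma(J)}_{\mathbb Z}$-invariant holomorphic section $\phi$ of $\mathcal E_{\lambda,k}|_{\Delta_J}\otimes\Theta_J^{\otimes m}$ over $\Delta_J$ then has a Fourier expansion $\sum_l a(l)\exp(2\pi i(l,Z))$ with $l$ in a full lattice of $U(J)_{\mathbb Q}^\perp\subset U(I)_{\mathbb Q}$; it is holomorphic at the $I$-cusp if $a(l)\ne0$ only when $(ml_{J,\Gamma}+l,ml_{J,\Gamma}+l)\ge0$ (independent of $I',l_{J,\Gamma}$). $J_{\lambda,k,m}(\Gamma(J)_{\mathbb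 Z})$ is the space of such $\phi$ that are holomorphic at every cusp $I\subset J$, and $J_{k,m}(\Gamma(J)_{\mathbb Z})=J_{(0),k,m}(\Gamma(J)_{\mathbb Z})$. *)

theory Defs
  imports
    "HOL-Analysis.Analysis"
    "HOL-Library.Function_Algebras"
    "HOL-Combinatorics.Permutations"
    "HOL-Algebra.Coset"
begin

section \<open>Lattices, the domain and its arithmetic groups\<close>

text \<open>
  A lattice of rank \<open>CARD('n)\<close> is written in a basis: it is given by its Gram matrix
  \<open>Q :: int^'n^'n\<close>, and \<open>L\<close>, \<open>L_Q\<close>, \<open>L_C\<close> are the integral vectors, the rational vectors and
  all vectors of \<open>complex^'n\<close>.
\<close>

definition bform :: "int^'n^'n \<Rightarrow> 'a::comm_ring_1^'n \<Rightarrow> 'a^'n \<Rightarrow> 'a" where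
  "bform Q x y = (\<Sum>i\<in>UNIV. \<Sum>j\<in>UNIV. of_int (Q $ i $ j) * x $ i * y $ j)"

definition is_lattice :: "int^'n^'n \<Rightarrow> bool" where
  "is_lattice Q \<longleftrightarrow> transpose Q = Q \<and> det Q \<noteq> 0"

definition has_signature :: "int^'n^'n \<Rightarrow> nat \<Rightarrow> nat \<Rightarrow> bool" where
  "has_signature Q p q \<longleftrightarrow> p + q = CARD('n) \<and>
     (\<exists>P N :: (real^'n) set. subspace P \<and> subspace N \<and> dim P = p \<and> dim N = q \<and>
        (\<forall>x\<in>P. \<forall>y\<in>N. bform Q x y = 0) \<and>
        (\<forall>x\<in>P. x \<noteq> 0 \<longrightarrow> bform Q x x > 0) \<and>
        (\<forall>y\<in>N. y \<noteq> 0 \<longrightarrow> bform Q y y < 0))"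

definition lat :: "(complex^'n) set" where
  "lat = {x. \<forall>i. x $ i \<in> \<int>}"

definition latQ :: "(complex^'n) set" where
  "latQ = {x. \<forall>i. x $ i \<in> \<rat>}"

definition cnj_vec :: "complex^'n \<Rightarrow> complex^'n" where
  "cnj_vec x = (\<chi> i. cnj (x $ i))"

definition Im_vec :: "complex^'n \<Rightarrow> complex^'n" where
  "Im_vec x = (\<chi> i. complex_of_real (Im (x $ i)))"

definition perp :: "int^'n^'n \<Rightarrow> (complex^'n) set \<Rightarrow> (complex^'n) set" where
  "perp Q S = {x. \<forall>y\<in>S. bform Q x y = 0}"

definition line :: "complex^'n \<Rightarrow> (complex^'n) set" where
  "line x = vec.span {x}"

text \<open>Projective space: its points are the complex lines, with the quotient topology.\<close>

definition proj_topology :: "(complex^'n) set topology" where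
  "proj_topology = topology (\<lambda>U. U \<subseteq> line ` (- {0}) \<and> open {x. x \<noteq> 0 \<and> line x \<in> U})"

lemma openin_proj_topology:
  fixes U :: "(complex^'n) set set"
  shows "openin proj_topology U \<longleftrightarrow> U \<subseteq> line ` (- {0}) \<and> open {x. x \<noteq> 0 \<and> line x \<in> U}"
proof -
  have "istopology (\<lambda>U. U \<subseteq> line ` (- {0}) \<and> open {x :: complex^'n. x \<noteq> 0 \<and> line x \<in> U})"
    unfolding istopology_def
  proof (intro conjI allI impI)
    fix S T :: "(complex^'n) set set"
    assume S: "S \<subseteq> line ` (- {0}) \<and> open {x. x \<noteq> 0 \<and> line x \<in> S}"
      and T: "T \<subseteq> line ` (- {0}) \<and> open {x. x \<noteq> 0 \<and> line x \<in> T}"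
    show "S \<inter> T \<subseteq> line ` (- {0})" using S by blast
    have "{x. x \<noteq> 0 \<and> line x \<in> S \<inter> T} = {x. x \<noteq> 0 \<and> line x \<in> S} \<inter> {x. x \<noteq> 0 \<and> line x \<in> T}"
      by blast
    then show "open {x. x \<noteq> 0 \<and> line x \<in> S \<inter> T}" using S T by (simp only:) (intro open_Int; blast)
  next
    fix K :: "(complex^'n) set set set"
    assume K: "\<forall>S\<in>K. S \<subseteq> line ` (- {0}) \<and> open {x. x \<noteq> 0 \<and> line x \<in> S}"
    show "\<Union>K \<subseteq> line ` (- {0})" using K by blast
    have "{x. x \<noteq> 0 \<and> line x \<in> \<Union>K} = (\<Union>S\<in>K. {x. x \<noteq> 0 \<and> line x \<in> S})" by blast
    then show "open {x. x \<noteq> 0 \<and> line x \<in> \<Union>K}" using K by (simp only:) (intro open_UN; blast)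
  qed
  then show ?thesis
    unfolding proj_topology_def by (simp add: topology_inverse')
qed

definition period_domains :: "int^'n^'n \<Rightarrow> (complex^'n) set set set" where
  "period_domains Q = connected_components_of (subtopology proj_topology
     {line w | w. bform Q w w = 0 \<and> Re (bform Q w (cnj_vec w)) > 0})"

definition isometries :: "int^'n^'n \<Rightarrow> complex set \<Rightarrow> (complex^'n^'n) set" where
  "isometries Q F = {g. (\<forall>i j. g $ i $ j \<in> F) \<and>
     (\<forall>x y. bform Q (g *v x) (g *v y) = bform Q x y)}"

text \<open>An integral isometry of a nondegenerate form has determinant \<open>1\<close> or \<open>-1\<close>, so
  \<^term>\<open>isometries Q \<int>\<close> is \<open>O(L)\<close>.\<close>

definition O_plus :: "int^'n^'n \<Rightarrow> (complex^'n) set set \<Rightarrow> (complex^'n^'n) monoid" where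
  "O_plus Q D = \<lparr> carrier = {g \<in> isometries Q \<int>. (\<lambda>p. (*v) g ` p) ` D = D},
     monoid.mult = (**), one = mat 1 \<rparr>"

definition rat_span :: "(complex^'n) set \<Rightarrow> (complex^'n) set" where
  "rat_span S = {x. \<exists>c::nat. c > 0 \<and> of_nat c *s x \<in> S}"

definition add_subgroup :: "(complex^'n) set \<Rightarrow> bool" where
  "add_subgroup S \<longleftrightarrow> 0 \<in> S \<and> (\<forall>x\<in>S. \<forall>y\<in>S. x - y \<in> S)"

definition primitive_isotropic :: "int^'n^'n \<Rightarrow> nat \<Rightarrow> (complex^'n) set \<Rightarrow> bool" where
  "primitive_isotropic Q r S \<longleftrightarrow> add_subgroup S \<and> S \<subseteq> lat \<and> rat_span S \<inter> lat = S \<and>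
     vec.dim S = r \<and> (\<forall>x\<in>S. \<forall>y\<in>S. bform Q x y = 0)"

definition int_multiples :: "complex^'n \<Rightarrow> (complex^'n) set" where
  "int_multiples e = range (\<lambda>c::int. of_int c *s e)"

section \<open>Orthogonal Schur functors\<close>

text \<open>
  The tensor power \<open>L_C^{\<otimes>d}\<close> consists of the functions on index lists of length \<open>d\<close>,
  extended by \<open>0\<close> to all lists.
\<close>

type_synonym 'n tensor = "'n list \<Rightarrow> complex"

definition tscale :: "complex \<Rightarrow> 'n tensor \<Rightarrow> 'n tensor" where
  "tscale c T = (\<lambda>i. c * T i)"

global_interpretation tens: vector_space tscale
  by unfold_locales (auto simp: tscale_def fun_eq_iff algebra_simps)

definition elem_tensor :: "(complex^'n) list \<Rightarrow> 'n tensor" where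
  "elem_tensor xs = (\<lambda>i. if length i = length xs then (\<Prod>j<length xs. (xs ! j) $ (i ! j)) else 0)"

definition tensor_map :: "(complex^'n \<Rightarrow> complex^'n) \<Rightarrow> 'n tensor \<Rightarrow> 'n tensor" where
  "tensor_map A T = (\<lambda>i. \<Sum>h | length h = length i.
     (\<Prod>j<length i. matrix A $ (i ! j) $ (h ! j)) * T h)"

definition insert_at :: "nat \<Rightarrow> 'a \<Rightarrow> 'a list \<Rightarrow> 'a list" where
  "insert_at a x xs = take a xs @ x # drop a xs"

text \<open>Contraction of the factors in positions \<open>a < b\<close>.\<close>

definition contraction :: "int^'n^'n \<Rightarrow> nat \<Rightarrow> nat \<Rightarrow> 'n tensor \<Rightarrow> 'n tensor" where
  "contraction Q a b T = (\<lambda>i. \<Sum>x\<in>UNIV. \<Sum>y\<in>UNIV.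
     of_int (Q $ x $ y) * T (insert_at b y (insert_at a x i)))"

text \<open>
  The quadratic spaces that occur (\<open>V(I)\<close>, and the fibers \<open>\<omega>^\<bottom>/\<complex>\<omega>\<close> of \<open>\<E>\<close>)
  are of the form \<open>W / (W \<inter> W^\<bottom>)\<close> for a subspace \<open>W\<close> of \<open>L_C\<close>. A subspace of
  \<open>(W / (W \<inter> W^\<bottom>))^{\<otimes>d}\<close> is represented by its preimage in \<open>W^{\<otimes>d}\<close>;
  \<open>rad_tensors Q W d\<close> is the kernel of \<open>W^{\<otimes>d} \<rightarrow> (W / (W \<inter> W^\<bottom>))^{\<otimes>d}\<close>.
\<close>

definition tensors :: "(complex^'n) set \<Rightarrow> nat \<Rightarrow> 'n tensor set" where
  "tensors W d = tens.span {elem_tensor xs | xs. length xs = d \<and> set xs \<subseteq> W}"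

definition rad_tensors :: "int^'n^'n \<Rightarrow> (complex^'n) set \<Rightarrow> nat \<Rightarrow> 'n tensor set" where
  "rad_tensors Q W d = tens.span {elem_tensor xs | xs.
     length xs = d \<and> set xs \<subseteq> W \<and> set xs \<inter> perp Q W \<noteq> {}}"

definition traceless :: "int^'n^'n \<Rightarrow> (complex^'n) set \<Rightarrow> nat \<Rightarrow> 'n tensor set" where
  "traceless Q W d = {T \<in> tensors W d.
     \<forall>a b. a < b \<and> b < d \<longrightarrow> contraction Q a b T \<in> rad_tensors Q W (d - 2)}"

text \<open>
  A partition is the list \<open>[\<lambda>_1, \<dots>, \<lambda>_n]\<close>; rows, columns and boxes are counted from \<open>0\<close>.
  The column canonical tableau numbers the boxes down the columns, from left to right.
\<close>

definition is_partition :: "nat \<Rightarrow> nat list \<Rightarrow> bool" where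
  "is_partition n lam \<longleftrightarrow> length lam = n \<and> sorted_wrt (\<ge>) lam"

definition col_len :: "nat list \<Rightarrow> nat \<Rightarrow> nat" where
  "col_len lam c = card {r. r < length lam \<and> c < lam ! r}"

definition col_tableau :: "nat list \<Rightarrow> nat \<Rightarrow> nat \<Rightarrow> nat" where
  "col_tableau lam r c = (\<Sum>c'<c. col_len lam c') + r"

definition row_subgroup :: "nat list \<Rightarrow> (nat \<Rightarrow> nat) set" where
  "row_subgroup lam = {s. s permutes {..<sum_list lam} \<and>
     (\<forall>r<length lam. s ` {col_tableau lam r c | c. c < lam ! r} = {col_tableau lam r c | c. c < lam ! r})}"

definition column_subgroup :: "nat list \<Rightarrow> (nat \<Rightarrow> nat) set" where
  "column_subgroup lam = {s. s permutes {..<sum_list lam} \<and>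
     (\<forall>c. s ` {col_tableau lam r c | r. r < col_len lam c} = {col_tableau lam r c | r. r < col_len lam c})}"

text \<open>The left action of the symmetric group: \<open>s\<close> moves the factor in position \<open>j\<close> to position
  \<open>s j\<close>.\<close>

definition perm_action :: "(nat \<Rightarrow> nat) \<Rightarrow> 'n tensor \<Rightarrow> 'n tensor" where
  "perm_action s T = (\<lambda>i. T (permute_list s i))"

definition young_symmetrizer :: "nat list \<Rightarrow> 'n tensor \<Rightarrow> 'n tensor" where
  "young_symmetrizer lam T =
     (\<Sum>t\<in>column_subgroup lam. tscale (of_int (sign t))
        (perm_action t (\<Sum>s\<in>row_subgroup lam. perm_action s T)))"

definition schur :: "int^'n^'n \<Rightarrow> (complex^'n) set \<Rightarrow> nat list \<Rightarrow> 'n tensor set" where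
  "schur Q W lam = {young_symmetrizer lam T + S | T S.
     T \<in> traceless Q W (sum_list lam) \<and> S \<in> rad_tensors Q W (sum_list lam)}"

section \<open>The filtration attached to \<open>J\<close>\<close>

text \<open>The fiber of \<open>\<E>\<close> at the point \<open>p\<close> (a complex line) of the domain is \<open>p^\<bottom>/p\<close>; all
  subspaces are represented by preimages as above. Only the levels \<open>1, 0, -1\<close> of \<open>E_filtration\<close>
  are used.\<close>

definition E_J :: "int^'n^'n \<Rightarrow> (complex^'n) set \<Rightarrow> (complex^'n) set \<Rightarrow> (complex^'n) set" where
  "E_J Q J p = vec.span ((perp Q p \<inter> vec.span J) \<union> p)"

definition E_filtration ::
  "int^'n^'n \<Rightarrow> (complex^'n) set \<Rightarrow> (complex^'n) set \<Rightarrow> int \<Rightarrow> (complex^'n) set" where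
  "E_filtration Q J p i =
     (if i = 1 then E_J Q J p
      else if i = 0 then perp Q p \<inter> perp Q (E_J Q J p)
      else perp Q p)"

definition tensor_filtration ::
  "int^'n^'n \<Rightarrow> (complex^'n) set \<Rightarrow> (complex^'n) set \<Rightarrow> nat \<Rightarrow> int \<Rightarrow> 'n tensor set" where
  "tensor_filtration Q J p d r = tens.span
     ({elem_tensor xs | xs. length xs = d \<and>
         (\<exists>is. length is = d \<and> set is \<subseteq> {-1, 0, 1} \<and> sum_list is = r \<and>
            (\<forall>j<d. xs ! j \<in> E_filtration Q J p (is ! j)))}
      \<union> rad_tensors Q (perp Q p) d)"

definition schur_filtration ::
  "int^'n^'n \<Rightarrow> (complex^'n) set \<Rightarrow> nat list \<Rightarrow> (complex^'n) set \<Rightarrow> int \<Rightarrow> 'n tensor set" where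
  "schur_filtration Q J lam p r =
     schur Q (perp Q p) lam \<inter> tensor_filtration Q J p (sum_list lam) r"

text \<open>The dimension of the fiber at \<open>p\<close> of \<open>Gr^r\<close>, that is, of the quotient of level \<open>r\<close> by level
  \<open>r + 1\<close>; the radical contained in both preimages cancels.\<close>

definition gr_rank ::
  "int^'n^'n \<Rightarrow> (complex^'n) set \<Rightarrow> nat list \<Rightarrow> (complex^'n) set \<Rightarrow> int \<Rightarrow> nat" where
  "gr_rank Q J lam p r =
     tens.dim (schur_filtration Q J lam p r) - tens.dim (schur_filtration Q J lam p (r + 1))"

section \<open>The cusp \<open>J\<close>\<close>

definition Gamma_J_Q :: "int^'n^'n \<Rightarrow> (complex^'n) set \<Rightarrow> (complex^'n^'n) set" where
  "Gamma_J_Q Q J = {g \<in> isometries Q \<rat>.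
     (*v) g ` rat_span J = rat_span J \<and>
     \<comment> \<open>trivial on \<open>\<and>\<^sup>2 J\<close>, realised as antisymmetric tensors\<close>
     (\<forall>x\<in>rat_span J. \<forall>y\<in>rat_span J. \<forall>i j.
        (g *v x) $ i * (g *v y) $ j - (g *v x) $ j * (g *v y) $ i = x $ i * y $ j - x $ j * y $ i) \<and>
     (\<forall>x\<in>latQ \<inter> perp Q J. g *v x - x \<in> rat_span J)}"

definition U_J_Q :: "int^'n^'n \<Rightarrow> (complex^'n) set \<Rightarrow> (complex^'n^'n) set" where
  "U_J_Q Q J = {g \<in> Gamma_J_Q Q J. \<forall>x\<in>latQ \<inter> perp Q J. g *v x = x}"

text \<open>A point of \<open>P((L/J)_C)\<close>, a line in \<open>L_C/J_C\<close>, is represented by its preimage in \<open>L_C\<close>.\<close>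

definition proj_J :: "(complex^'n) set \<Rightarrow> (complex^'n) set \<Rightarrow> (complex^'n) set" where
  "proj_J J p = vec.span (p \<union> J)"

definition V_J :: "(complex^'n) set set \<Rightarrow> (complex^'n) set \<Rightarrow> (complex^'n) set set" where
  "V_J D J = proj_J J ` D"

section \<open>Tube domains and trivializations at the cusps \<open>I \<subseteq> J\<close>\<close>

text \<open>
  In the following \<open>e\<close> generates \<open>I\<close> and \<open>e'\<close> is the rational isotropic vector with
  \<open>(e, e') = 1\<close>. Then \<open>V(I)\<close> is the subspace \<open>VI Q e e'\<close>, and \<open>U(I)_C\<close> is identified with it by
  \<open>z \<otimes> e \<mapsto> z\<close>.
\<close>

definition VI :: "int^'n^'n \<Rightarrow> complex^'n \<Rightarrow> complex^'n \<Rightarrow> (complex^'n) set" where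
  "VI Q e e' = perp Q {e, e'}"

definition proj_VI :: "int^'n^'n \<Rightarrow> complex^'n \<Rightarrow> complex^'n \<Rightarrow> complex^'n \<Rightarrow> complex^'n" where
  "proj_VI Q e e' x = x - bform Q x e' *s e - bform Q x e *s e'"

definition chart :: "int^'n^'n \<Rightarrow> complex^'n \<Rightarrow> complex^'n \<Rightarrow> complex^'n \<Rightarrow> complex^'n" where
  "chart Q e e' Z = e' + Z - (bform Q Z Z / 2) *s e"

definition tube :: "int^'n^'n \<Rightarrow> (complex^'n) set set \<Rightarrow> complex^'n \<Rightarrow> complex^'n \<Rightarrow> (complex^'n) set" where
  "tube Q D e e' = {Z \<in> VI Q e e'. line (chart Q e e' Z) \<in> D}"

text \<open>The inverse of \<open>chart\<close>, as a function of a nonzero vector \<open>w\<close> on the line.\<close>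

definition tube_coord :: "int^'n^'n \<Rightarrow> complex^'n \<Rightarrow> complex^'n \<Rightarrow> complex^'n \<Rightarrow> complex^'n" where
  "tube_coord Q e e' w = proj_VI Q e e' ((1 / bform Q w e) *s w)"

text \<open>The cone \<open>\<C>_I\<close>: since the tube domain over it is the whole of \<open>D\<close>, it is the set of
  imaginary parts of tube domain coordinates.\<close>

definition cone :: "int^'n^'n \<Rightarrow> (complex^'n) set set \<Rightarrow> complex^'n \<Rightarrow> complex^'n \<Rightarrow> (complex^'n) set" where
  "cone Q D e e' = Im_vec ` tube Q D e e'"

text \<open>The isomorphism \<open>\<omega>^\<bottom>/\<complex>\<omega> \<rightarrow> V(I)\<close> at the line of \<open>w\<close>: correct a representative \<open>x\<close> by
  a multiple of \<open>w\<close> so that it lies in \<open>I^\<bottom>\<close>, then pass to \<open>I^\<bottom>/I\<close>. The inverse lifts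
  \<open>V(I)\<close> to \<open>I^\<bottom> \<inter> \<omega>^\<bottom>\<close>.\<close>

definition triv :: "int^'n^'n \<Rightarrow> complex^'n \<Rightarrow> complex^'n \<Rightarrow> complex^'n \<Rightarrow> complex^'n \<Rightarrow> complex^'n" where
  "triv Q e e' w x = proj_VI Q e e' (x - (bform Q x e / bform Q w e) *s w)"

definition triv_inv :: "int^'n^'n \<Rightarrow> complex^'n \<Rightarrow> complex^'n \<Rightarrow> complex^'n \<Rightarrow> complex^'n" where
  "triv_inv Q e w x = x - (bform Q x w / bform Q e w) *s e"

text \<open>
  The data used to trivialize at a cusp \<open>I \<subseteq> J\<close>: a generator \<open>e\<close> of \<open>I\<close>, the vector \<open>e'\<close>, the
  generator \<open>v\<close> of \<open>U(J)_Z\<close> and the vector \<open>l\<close>, written \<open>v_{J,\<Gamma>}\<close> and \<open>l_{J,\<Gamma>}\<close> in the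
  literature. An element \<open>g\<close> of \<open>U(J)_Z\<close> translates the tube domain by \<open>g e' - e'\<close>; this
  identifies \<open>U(J)_Z\<close> with a subgroup of \<open>U(I)_Q\<close>.
\<close>

datatype 'n frame = Frame (fr_e: "complex^'n") (fr_e': "complex^'n") (fr_v: "complex^'n") (fr_l: "complex^'n")

definition is_frame ::
  "int^'n^'n \<Rightarrow> (complex^'n) set set \<Rightarrow> (complex^'n^'n) set \<Rightarrow> (complex^'n) set \<Rightarrow> 'n frame \<Rightarrow> bool" where
  "is_frame Q D \<Gamma> J f \<longleftrightarrow> (case f of Frame e e' v l \<Rightarrow>
     e \<in> J \<and> primitive_isotropic Q 1 (int_multiples e) \<and>
     e' \<in> latQ \<and> bform Q e' e' = 0 \<and> bform Q e e' = 1 \<and>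
     v \<in> closure (cone Q D e e') \<and>
     {g *v e' - e' | g. g \<in> U_J_Q Q J \<inter> \<Gamma>} = int_multiples v \<and>
     l \<in> latQ \<inter> VI Q e e' \<and> bform Q l l = 0 \<and> bform Q v l = 1)"

definition omega_J :: "int^'n^'n \<Rightarrow> 'n frame \<Rightarrow> complex^'n \<Rightarrow> complex" where
  "omega_J Q f w = exp (2 * pi * \<i> * bform Q (fr_l f) (tube_coord Q (fr_e f) (fr_e' f) w))"

text \<open>
  The isomorphism of \<open>\<E>^{\<otimes>d} \<otimes> \<L>^{\<otimes>k} \<otimes> (\<omega>_J)^m\<close> from the fiber at \<open>w\<close>, trivialized
  by \<open>f1\<close>, to the fiber at \<open>g w\<close>, trivialized by \<open>f2\<close>, that is induced by \<open>g\<close>. Since \<open>g\<close> carries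
  a function to its pullback by the inverse of \<open>g\<close>, the generator \<open>omega_J Q f1\<close> is carried to
  \<open>omega_J Q f1 w / omega_J Q f2 (g w)\<close> times \<open>omega_J Q f2\<close>. All factors depend only on the line
  of \<open>w\<close>.
\<close>

definition transport ::
  "int^'n^'n \<Rightarrow> int \<Rightarrow> nat \<Rightarrow> complex^'n^'n \<Rightarrow> 'n frame \<Rightarrow> 'n frame \<Rightarrow> complex^'n \<Rightarrow> 'n tensor \<Rightarrow> 'n tensor" where
  "transport Q k m g f1 f2 w T =
     tscale ((bform Q (g *v w) (fr_e f2) / bform Q w (fr_e f1)) powi k *
             (omega_J Q f1 w / omega_J Q f2 (g *v w)) ^ m)
       (tensor_map (\<lambda>x. triv Q (fr_e f2) (fr_e' f2) (g *v w) (g *v triv_inv Q (fr_e f1) w x)) T)"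

section \<open>Jacobi forms\<close>

text \<open>Holomorphic functions on a relatively open subset of a complex subspace.\<close>

definition holomorphic_in :: "(complex^'n \<Rightarrow> complex) \<Rightarrow> (complex^'n) set \<Rightarrow> bool" where
  "holomorphic_in h S \<longleftrightarrow> (\<forall>z\<in>S. \<exists>h'. (\<forall>c x. h' (c *s x) = c * h' x) \<and>
     (h has_derivative h') (at z within S))"

definition full_lattice :: "(complex^'n) set \<Rightarrow> (complex^'n) set \<Rightarrow> bool" where
  "full_lattice M W \<longleftrightarrow> rat_span M = W \<and>
     (\<exists>B. finite B \<and> vec.independent B \<and> M = range (\<lambda>c :: _ \<Rightarrow> int. \<Sum>b\<in>B. of_int (c b) *s b))"

text \<open>
  A section of \<open>\<E>_{\<lambda>,k} \<otimes> \<Theta>_J^{\<otimes>m}\<close> over the boundary divisor \<open>\<Delta>_J = V_J\<close> is represented by the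
  family, indexed by all frames, of the functions on \<open>V_J\<close> with values in \<open>V(I)_\<lambda>\<close> that it becomes
  under the trivializations; it is put to \<open>0\<close> outside the domain of definition.
\<close>

type_synonym 'n jsection = "'n frame \<Rightarrow> (complex^'n) set \<Rightarrow> 'n tensor"

definition pullback :: "int^'n^'n \<Rightarrow> (complex^'n) set \<Rightarrow> 'n jsection \<Rightarrow> 'n frame \<Rightarrow> complex^'n \<Rightarrow> 'n tensor" where
  "pullback Q J \<phi> f Z = \<phi> f (proj_J J (line (chart Q (fr_e f) (fr_e' f) Z)))"

definition section_values ::
  "int^'n^'n \<Rightarrow> (complex^'n) set set \<Rightarrow> (complex^'n^'n) set \<Rightarrow> (complex^'n) set \<Rightarrow> nat list \<Rightarrow> 'n jsection \<Rightarrow> bool" where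
  "section_values Q D \<Gamma> J lam \<phi> \<longleftrightarrow> (\<forall>f P.
     if is_frame Q D \<Gamma> J f \<and> P \<in> V_J D J then \<phi> f P \<in> schur Q (VI Q (fr_e f) (fr_e' f)) lam
     else \<phi> f P = 0)"

definition holomorphic_section ::
  "int^'n^'n \<Rightarrow> (complex^'n) set set \<Rightarrow> (complex^'n^'n) set \<Rightarrow> (complex^'n) set \<Rightarrow> 'n jsection \<Rightarrow> bool" where
  "holomorphic_section Q D \<Gamma> J \<phi> \<longleftrightarrow> (\<forall>f. is_frame Q D \<Gamma> J f \<longrightarrow>
     (\<forall>i. holomorphic_in (\<lambda>Z. pullback Q J \<phi> f Z i) (tube Q D (fr_e f) (fr_e' f))))"

text \<open>
  The bundle and the group action over \<open>\<Delta>_J\<close> are the extensions by continuity from the partial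
  compactification. The boundary point below the point \<open>Z\<close> of the tube domain is the limit of
  \<open>Z + i t v\<close> as \<open>t \<rightarrow> \<infinity>\<close>, where \<open>omega_J\<close> tends to \<open>0\<close>. For \<open>g = 1\<close> the condition says that
  the members of the family \<open>\<phi>\<close> are trivializations of one and the same section; for general \<open>g\<close>
  it is the invariance of this section.
\<close>

definition invariant_section ::
  "int^'n^'n \<Rightarrow> (complex^'n) set set \<Rightarrow> (complex^'n^'n) set \<Rightarrow> (complex^'n) set \<Rightarrow> int \<Rightarrow> nat \<Rightarrow> 'n jsection \<Rightarrow> bool" where
  "invariant_section Q D \<Gamma> J k m \<phi> \<longleftrightarrow>
     (\<forall>f1 f2 g Z. is_frame Q D \<Gamma> J f1 \<and> is_frame Q D \<Gamma> J f2 \<and> g \<in> Gamma_J_Q Q J \<inter> \<Gamma> \<and>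
        Z \<in> tube Q D (fr_e f1) (fr_e' f1) \<longrightarrow>
        (\<forall>i. ((\<lambda>t::real. transport Q k m g f1 f2
                 (chart Q (fr_e f1) (fr_e' f1) (Z + (\<i> * of_real t) *s fr_v f1))
                 (pullback Q J \<phi> f1 Z) i)
           \<longlongrightarrow> \<phi> f2 ((*v) g ` proj_J J (line (chart Q (fr_e f1) (fr_e' f1) Z))) i) at_top))"

definition holomorphic_at_cusp ::
  "int^'n^'n \<Rightarrow> (complex^'n) set set \<Rightarrow> (complex^'n) set \<Rightarrow> nat list \<Rightarrow> nat \<Rightarrow> 'n jsection \<Rightarrow> 'n frame \<Rightarrow> bool" where
  "holomorphic_at_cusp Q D J lam m \<phi> f \<longleftrightarrow>
     (\<exists>M a. full_lattice M (latQ \<inter> VI Q (fr_e f) (fr_e' f) \<inter> perp Q J) \<and>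
        (\<forall>l\<in>M. a l \<in> schur Q (VI Q (fr_e f) (fr_e' f)) lam) \<and>
        (\<forall>Z\<in>tube Q D (fr_e f) (fr_e' f). \<forall>i.
           ((\<lambda>l. a l i * exp (2 * pi * \<i> * bform Q l Z)) has_sum pullback Q J \<phi> f Z i) M) \<and>
        (\<forall>l\<in>M. a l \<noteq> 0 \<longrightarrow>
           Re (bform Q (of_nat m *s fr_l f + l) (of_nat m *s fr_l f + l)) \<ge> 0))"

definition jacobi_forms ::
  "int^'n^'n \<Rightarrow> (complex^'n) set set \<Rightarrow> (complex^'n^'n) set \<Rightarrow> (complex^'n) set \<Rightarrow> nat list \<Rightarrow> int \<Rightarrow> nat \<Rightarrow> 'n jsection set" where
  "jacobi_forms Q D \<Gamma> J lam k m = {\<phi>.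
     section_values Q D \<Gamma> J lam \<phi> \<and> holomorphic_section Q D \<Gamma> J \<phi> \<and>
     invariant_section Q D \<Gamma> J k m \<phi> \<and>
     (\<forall>f. is_frame Q D \<Gamma> J f \<longrightarrow> holomorphic_at_cusp Q D J lam m \<phi> f)}"

definition section_scale :: "complex \<Rightarrow> 'n jsection \<Rightarrow> 'n jsection" where
  "section_scale c \<phi> = (\<lambda>f P. tscale c (\<phi> f P))"

text \<open>The finite direct sum of the spaces \<open>S r\<close>, taken \<open>\<alpha> r\<close> times each, over \<open>a \<le> r \<le> b\<close>.\<close>

definition direct_sum ::
  "int \<Rightarrow> int \<Rightarrow> (int \<Rightarrow> nat) \<Rightarrow> (int \<Rightarrow> 'b::zero set) \<Rightarrow> (int \<Rightarrow> nat \<Rightarrow> 'b) set" where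
  "direct_sum a b \<alpha> S = {x. \<forall>r i.
     if a \<le> r \<and> r \<le> b \<and> i < \<alpha> r then x r i \<in> S r else x r i = 0}"

end

theory Submission
  imports Defs
begin

text \<open>
  The reason for the embedding is the equivariant structure of the graded pieces of the
  \<open>J\<close>-filtration. At a point \<open>\<omega>\<close> of the domain, contraction of a generator of \<open>\<and>\<^sup>2J\<close> with \<open>\<omega>\<close> gives
  a generator of the line \<open>\<omega>\<^sup>\<bottom> \<inter> J\<close>. So \<open>\<E>\<^sub>J\<close> is isomorphic to \<open>\<L>\<close>, dually \<open>\<E>/\<E>\<^sub>J\<^sup>\<bottom>\<close> is
  isomorphic to \<open>\<L>\<^sup>-\<^sup>1\<close>, and \<open>\<E>\<^sub>J\<^sup>\<bottom>/\<E>\<^sub>J\<close> is the constant bundle \<open>J\<^sup>\<bottom>/J\<close>. Since \<open>\<Gamma>(J)\<close> acts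
  trivially on \<open>\<and>\<^sup>2J\<close> and on \<open>J\<^sup>\<bottom>/J\<close>, it acts on the graded piece of level \<open>r\<close> of \<open>\<E>\<^sub>\<lambda>\<close> only through the
  \<open>r\<close>-th power of the factor of automorphy of \<open>\<L>\<close>. Hence for a Jacobi form of weight \<open>k\<close> with values in
  level \<open>r\<close>, the coordinates of its class in the graded piece are \<open>\<alpha>(r)\<close> scalar Jacobi forms of weight
  \<open>k + r\<close>, and they vanish together exactly if the values lie in level \<open>r + 1\<close>.

  To obtain a map on all Jacobi forms, one composes these coordinates with linear projections onto
  the subspaces of forms with values in level \<open>r\<close>. A form in the kernel then climbs from level
  \<open>-\<lambda>\<^sub>1\<close> to level \<open>\<lambda>\<^sub>1 + 1\<close>, which is zero (\<open>graded_embedding\<close>). That only the levels between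
  \<open>-\<lambda>\<^sub>1\<close> and \<open>\<lambda>\<^sub>1\<close> occur is a matter of symmetry: the tableau has \<open>\<lambda>\<^sub>1\<close> columns, and a tensor that is
  antisymmetric along the columns contains an isotropic vector at most once per column
  (\<open>schur_lowest_level\<close>, \<open>schur_highest_level\<close>).

  The trivialization at a cusp \<open>I \<subseteq> J\<close> and the fiber at a point are compared through hyperbolic
  quadruples \<open>(e, e', v, l)\<close> with \<open>e\<close> and \<open>v\<close> spanning \<open>J\<close>, called adapted frames; for a cusp, \<open>e\<close>
  spans \<open>I\<close>, and for a point, \<open>e'\<close> spans the line \<open>\<omega>\<close>. Normalizing all of them by the same generator
  \<open>e \<and> v\<close> of \<open>\<and>\<^sup>2J\<close> turns the description of the graded pieces into linear algebra: the action of an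
  element of \<open>\<Gamma>(J)\<close>, carried over to a fixed fiber, is block triangular with the powers of the factor of
  automorphy on the diagonal (\<open>conjugate_line\<close>, \<open>conjugate_middle\<close>, \<open>conjugate_top\<close>), and
  \<open>filtration_shift\<close> extends this to tensor powers. The remaining conditions on Jacobi
  forms (holomorphy, invariance in the limit at the boundary, Fourier expansions) are stable under
  finite linear combinations of coordinates (\<open>scalar_section_jacobi\<close>).
\<close>


section \<open>Bilinear forms and frames adapted to an isotropic plane\<close>

abbreviation clinear :: "('a::field^'n \<Rightarrow> 'a^'n) \<Rightarrow> bool" where
  "clinear A \<equiv> Vector_Spaces.linear (*s) (*s) A"

lemma clinearI:
  assumes "\<And>x y. A (x + y) = A x + A y" and "\<And>c x. A (c *s x) = c *s A x"
  shows "clinear A"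
  using assms by unfold_locales auto

lemma clinear_simps:
  assumes "clinear A"
  shows "A (x + y) = A x + A y" and "A (c *s x) = c *s A x" and "A (x - y) = A x - A y"
    and "A 0 = 0" and "A (- x) = - A x" and "A (sum f S) = (\<Sum>i\<in>S. A (f i))"
proof -
  interpret Vector_Spaces.linear "(*s)" "(*s)" A by fact
  show "A (x + y) = A x + A y" "A (c *s x) = c *s A x" "A (x - y) = A x - A y"
    "A 0 = 0" "A (- x) = - A x" "A (sum f S) = (\<Sum>i\<in>S. A (f i))"
    by (simp_all add: add scale diff zero neg sum)
qed

lemma bform_add_left: "bform Q (x + y) z = bform Q x z + bform Q y z"
  and bform_add_right: "bform Q z (x + y) = bform Q z x + bform Q z y"
  and bform_scale_left: "bform Q (c *s x) y = c * bform Q x y"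
  and bform_scale_right: "bform Q x (c *s y) = c * bform Q x y"
  and bform_zero_left: "bform Q 0 x = 0"
  and bform_zero_right: "bform Q x 0 = 0"
  by (simp_all add: bform_def algebra_simps sum.distrib sum_distrib_left)

lemma bform_diff_left: "bform Q (x - y) z = bform Q x z - bform Q y z"
  and bform_diff_right: "bform Q z (x - y) = bform Q z x - bform Q z y"
  by (simp_all add: bform_def algebra_simps sum_subtractf)

lemma bform_minus_left: "bform Q (- x) z = - bform Q x z"
  and bform_minus_right: "bform Q z (- x) = - bform Q z x"
  by (simp_all add: bform_def sum_negf)

lemmas bform_linear = bform_add_left bform_add_right bform_scale_left bform_scale_right
  bform_zero_left bform_zero_right bform_diff_left bform_diff_right bform_minus_left bform_minus_right

lemma bform_commute:
  assumes "transpose Q = Q"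
  shows "bform Q x y = bform Q y x"
proof -
  have Q: "Q $ i $ j = Q $ j $ i" for i j
    using assms by (metis transpose_def vec_lambda_beta)
  have "bform Q x y = (\<Sum>i\<in>UNIV. \<Sum>j\<in>UNIV. of_int (Q $ j $ i) * x $ i * y $ j)"
    unfolding bform_def by (intro sum.cong refl) (metis Q)
  also have "\<dots> = bform Q y x"
    unfolding bform_def by (subst sum.swap) (simp add: ac_simps)
  finally show ?thesis .
qed

lemma bform_dual_vector:
  fixes Q :: "int^'n^'n"
  assumes "det Q \<noteq> 0"
  obtains q :: "complex^'n" where "\<And>x. bform Q x q = x $ i"
proof -
  define M :: "complex^'n^'n" where "M = (\<chi> i j. of_int (Q $ i $ j))"
  have "det M = of_int (det Q)"
    by (simp add: det_def M_def)
  then have "invertible M"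
    using assms by (simp add: invertible_det_nz)
  then obtain N where "M ** N = mat 1"
    unfolding invertible_def by blast
  then have "M *v (N *v axis i 1) = axis i 1"
    by (simp add: matrix_vector_mul_assoc)
  moreover have "bform Q x q = (\<Sum>j\<in>UNIV. x $ j * (M *v q) $ j)" for x q
    by (simp add: bform_def M_def matrix_vector_mult_def sum_distrib_left ac_simps)
  ultimately have "bform Q x (N *v axis i 1) = x $ i" for x
    by (simp add: axis_def if_distrib cong: if_cong)
  then show ?thesis using that by blast
qed

lemma bform_nondegenerate:
  fixes x :: "complex^'n"
  assumes "det Q \<noteq> 0" and "\<And>y. bform Q x y = 0"
  shows "x = 0"
  unfolding vec_eq_iff using bform_dual_vector[OF assms(1)] assms(2) by (metis zero_index)

lemma bform_expand: "bform Q x y = (\<Sum>i\<in>UNIV. y $ i * bform Q x (axis i 1))"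
proof -
  have "bform Q x (axis i 1) = (\<Sum>j\<in>UNIV. of_int (Q $ j $ i) * x $ j)" for i
    by (simp add: bform_def axis_def if_distrib cong: if_cong)
  then show ?thesis
    unfolding bform_def by (subst sum.swap) (simp add: sum_distrib_left ac_simps)
qed

lemma bform_Rats: "x \<in> latQ \<Longrightarrow> y \<in> latQ \<Longrightarrow> bform Q x y \<in> \<rat>"
  unfolding bform_def latQ_def by (auto intro!: Rats_sum Rats_mult)

lemma latQ_diff: "x \<in> latQ \<Longrightarrow> y \<in> latQ \<Longrightarrow> x - y \<in> latQ"
  and latQ_scale: "c \<in> \<rat> \<Longrightarrow> x \<in> latQ \<Longrightarrow> c *s x \<in> latQ"
  and latQ_axis: "axis i 1 \<in> latQ"
  by (auto simp: latQ_def axis_def Rats_diff)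

lemma lat_subset_latQ: "lat \<subseteq> latQ"
  unfolding lat_def latQ_def using Ints_subset_Rats by auto

lemma proj_VI_clinear: "clinear (proj_VI Q e e')"
  by (rule clinearI) (simp_all add: proj_VI_def bform_linear vec_eq_iff algebra_simps)

lemma span_pair_iff: "x \<in> vec.span {a, b} \<longleftrightarrow> (\<exists>c d. x = c *s a + d *s b)"
proof
  assume "x \<in> vec.span {a, b}"
  then obtain c where "x - c *s a \<in> vec.span {b}"
    by (auto simp: vec.span_breakdown_eq)
  then obtain d where "x - c *s a = d *s b"
    by (auto simp: vec.span_singleton)
  then have "x = c *s a + d *s b" by (simp add: algebra_simps)
  then show "\<exists>c d. x = c *s a + d *s b" by blast
qed (auto intro: vec.span_add vec.span_scale vec.span_base)

text \<open>
  For an isotropic plane spanned by \<open>a\<close> and \<open>b\<close>, this is the infinitesimal isometry attached to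
  \<open>a \<and> b\<close>. It depends on the generator \<open>a \<and> b\<close> of the exterior square of the plane only, and it
  is the reason why the groups acting trivially on this exterior square act compatibly on the
  frames introduced below.
\<close>

definition wedge :: "int^'n^'n \<Rightarrow> complex^'n \<Rightarrow> complex^'n \<Rightarrow> complex^'n \<Rightarrow> complex^'n" where
  "wedge Q a b x = bform Q x a *s b - bform Q x b *s a"

text \<open>
  Hyperbolic quadruples \<open>(e, e', v, l)\<close> whose first and third vector span the plane of \<open>a\<close> and
  \<open>b\<close>, normalized by \<open>e \<and> v = a \<and> b\<close>. Both a cusp \<open>I \<subseteq> J\<close> (with \<open>e\<close> a generator of \<open>I\<close>) and a
  point \<open>\<omega>\<close> of the domain (with \<open>e' = \<omega>\<close>) give rise to such quadruples, which makes it possible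
  to compare the corresponding trivializations with the fiber at \<open>\<omega>\<close>.
\<close>

definition adapted :: "int^'n^'n \<Rightarrow> complex^'n \<Rightarrow> complex^'n \<Rightarrow> 'n frame \<Rightarrow> bool" where
  "adapted Q a b A \<longleftrightarrow> fr_e A \<in> vec.span {a, b} \<and> bform Q (fr_e A) (fr_e' A) = 1 \<and>
     bform Q (fr_e' A) (fr_e' A) = 0 \<and> fr_v A = wedge Q a b (fr_e' A) \<and>
     fr_l A \<in> VI Q (fr_e A) (fr_e' A) \<and> bform Q (fr_l A) (fr_l A) = 0 \<and>
     bform Q (fr_v A) (fr_l A) = 1"

text \<open>The projection to the orthogonal complement of the hyperbolic quadruple, a model of
  \<open>J\<^sup>\<bottom>/J\<close>.\<close>

definition core :: "int^'n^'n \<Rightarrow> 'n frame \<Rightarrow> complex^'n \<Rightarrow> complex^'n" where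
  "core Q A x = x - bform Q x (fr_e' A) *s fr_e A - bform Q x (fr_e A) *s fr_e' A
     - bform Q x (fr_l A) *s fr_v A - bform Q x (fr_v A) *s fr_l A"

text \<open>
  The comparison between the spaces \<open>\<langle>e, e'\<rangle>\<^sup>\<bottom>\<close> of two adapted frames: it matches \<open>v\<close> with \<open>v\<close>, \<open>l\<close>
  with \<open>l\<close> and identifies the complements through \<open>J\<^sup>\<bottom>/J\<close>.
\<close>

definition comparison :: "int^'n^'n \<Rightarrow> 'n frame \<Rightarrow> 'n frame \<Rightarrow> complex^'n \<Rightarrow> complex^'n" where
  "comparison Q A B x =
     bform Q x (fr_l A) *s fr_v B + bform Q x (fr_v A) *s fr_l B + core Q B (core Q A x)"

lemma core_clinear: "clinear (core Q A)"
  by (rule clinearI) (simp_all add: core_def bform_linear vec_eq_iff algebra_simps)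

lemma comparison_clinear: "clinear (comparison Q A B)"
  by (rule clinearI)
    (simp_all add: comparison_def clinear_simps[OF core_clinear] bform_linear vec_eq_iff algebra_simps)

locale isotropic_plane =
  fixes Q :: "int^'n^'n" and a b :: "complex^'n"
  assumes lattice: "is_lattice Q"
    and independent: "vec.independent {a, b}" "a \<noteq> b"
    and isotropic: "bform Q a a = 0" "bform Q a b = 0" "bform Q b b = 0"
begin

definition plane :: "(complex^'n) set" where
  "plane = vec.span {a, b}"

lemma commute: "bform Q x y = bform Q y (x :: complex^'n)"
  using bform_commute lattice unfolding is_lattice_def by blast

lemma nondegenerate: "(\<And>y. bform Q (x::complex^'n) y = 0) \<Longrightarrow> x = 0"
  using bform_nondegenerate lattice unfolding is_lattice_def by blast

lemma subspace_plane: "vec.subspace plane"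
  unfolding plane_def by (rule vec.subspace_span)

lemmas plane_closed = vec.subspace_add[OF subspace_plane] vec.subspace_diff[OF subspace_plane]
  vec.subspace_scale[OF subspace_plane] vec.subspace_0[OF subspace_plane]
  vec.subspace_neg[OF subspace_plane]

lemma plane_iff: "x \<in> plane \<longleftrightarrow> (\<exists>c d. x = c *s a + d *s b)"
  unfolding plane_def by (rule span_pair_iff)

lemma generators_in_plane: "a \<in> plane" "b \<in> plane"
  unfolding plane_def by (auto intro: vec.span_base)

lemma perp_plane_iff: "x \<in> perp Q plane \<longleftrightarrow> bform Q x a = 0 \<and> bform Q x b = 0"
  unfolding perp_def using generators_in_plane by (auto simp: plane_iff bform_linear)

lemma subspace_perp_plane: "vec.subspace (perp Q plane)"
  by (rule vec.subspaceI) (auto simp: perp_plane_iff bform_linear)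

lemma plane_isotropic: "plane \<subseteq> perp Q plane"
  using isotropic commute[of b a] by (auto simp: perp_plane_iff plane_iff bform_linear)

lemma bform_plane: "x \<in> plane \<Longrightarrow> y \<in> plane \<Longrightarrow> bform Q x y = 0"
  using plane_isotropic unfolding perp_def by blast

lemma wedge_in_plane: "wedge Q a b x \<in> plane"
  unfolding wedge_def by (intro plane_closed generators_in_plane)

lemma bform_wedge_self: "bform Q (wedge Q a b x) x = 0"
  by (simp add: wedge_def bform_linear commute[of _ x])

lemma wedge_eq_0D:
  assumes "wedge Q a b x = 0"
  shows "bform Q x a = 0 \<and> bform Q x b = 0"
proof -
  have eq: "bform Q x a *s b = bform Q x b *s a"
    using assms by (simp add: wedge_def)
  have "bform Q x a = 0"
  proof (rule ccontr)
    assume nz: "bform Q x a \<noteq> 0"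
    have "b = (1 / bform Q x a) *s (bform Q x a *s b)"
      using nz by simp
    then have "b = (bform Q x b / bform Q x a) *s a"
      unfolding eq by simp
    then have "b \<in> vec.span {a}"
      by (metis vec.span_base vec.span_scale singletonI)
    moreover have "{a, b} - {b} = {a}"
      using independent(2) by auto
    ultimately show False
      using independent(1) unfolding vec.dependent_def by fastforce
  qed
  moreover have "a \<noteq> 0"
    using independent(1) vec.dependent_zero by blast
  ultimately show ?thesis using eq by simp
qed

text \<open>
  The vector \<open>e'\<close> determines \<open>v\<close>, and nondegeneracy provides a vector pairing nontrivially with \<open>v\<close>,
  which a multiple of \<open>v\<close> makes isotropic. All choices can be made rationally.
\<close>

lemma adapted_frame_exists:
  assumes e: "e \<in> plane" and ee': "bform Q e e' = 1" and e': "bform Q e' e' = 0"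
  obtains A where "adapted Q a b A" "fr_e A = e" "fr_e' A = e'"
    "e \<in> latQ \<Longrightarrow> e' \<in> latQ \<Longrightarrow> a \<in> latQ \<Longrightarrow> b \<in> latQ \<Longrightarrow> fr_l A \<in> latQ"
proof -
  define v where "v = wedge Q a b e'"
  have "v \<noteq> 0"
  proof
    assume "v = 0"
    then have "e' \<in> perp Q plane"
      using wedge_eq_0D perp_plane_iff unfolding v_def by blast
    then show False
      using e ee' unfolding perp_def by (auto simp: commute[of e])
  qed
  have "\<exists>i. bform Q v (axis i 1) \<noteq> 0"
  proof (rule ccontr)
    assume "\<not> ?thesis"
    then have "bform Q v y = 0" for y
      by (subst bform_expand) simp
    then show False using nondegenerate \<open>v \<noteq> 0\<close> by blast
  qed
  then obtain i where i: "bform Q v (axis i 1) \<noteq> 0" by blast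
  have v: "v \<in> plane" "bform Q v e' = 0" "bform Q v e = 0" "bform Q v v = 0" "bform Q e e = 0"
    unfolding v_def using wedge_in_plane bform_wedge_self bform_plane e by auto
  define z where "z = (1 / bform Q v (axis i 1)) *s proj_VI Q e e' (axis i 1)"
  define l where "l = z - (bform Q z z / 2) *s v"
  have z: "bform Q z e = 0" "bform Q z e' = 0" "bform Q v z = 1"
    using i v ee' e' commute[of e' e] by (simp_all add: z_def proj_VI_def bform_linear)
  have l: "bform Q l e = 0" "bform Q l e' = 0" "bform Q v l = 1" "bform Q l l = 0"
    using z v commute[of z v] by (simp_all add: l_def bform_linear field_simps)
  have "l \<in> latQ" if "e \<in> latQ" "e' \<in> latQ" "a \<in> latQ" "b \<in> latQ"
  proof -
    have vQ: "v \<in> latQ"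
      unfolding v_def wedge_def by (intro latQ_diff latQ_scale bform_Rats that)
    have zQ: "z \<in> latQ"
      unfolding z_def proj_VI_def
      by (intro latQ_diff latQ_scale bform_Rats that Rats_divide Rats_1 latQ_axis vQ)
    show ?thesis
      unfolding l_def by (intro latQ_diff latQ_scale bform_Rats zQ vQ Rats_divide Rats_number_of)
  qed
  moreover have "adapted Q a b (Frame e e' v l)"
    using e ee' e' l unfolding adapted_def plane_def by (simp add: VI_def perp_def v_def)
  ultimately show ?thesis using that[of "Frame e e' v l"] by simp
qed

context
  fixes A :: "'n frame"
  assumes A: "adapted Q a b A"
begin

lemma adapted_in_plane: "fr_e A \<in> plane" "fr_v A \<in> plane"
  using A wedge_in_plane unfolding adapted_def plane_def by auto

lemma adapted_gram:
  "bform Q (fr_e A) (fr_e A) = 0" "bform Q (fr_e A) (fr_v A) = 0" "bform Q (fr_v A) (fr_e A) = 0"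
  "bform Q (fr_v A) (fr_v A) = 0" "bform Q (fr_e A) (fr_e' A) = 1" "bform Q (fr_e' A) (fr_e A) = 1"
  "bform Q (fr_e' A) (fr_e' A) = 0" "bform Q (fr_v A) (fr_e' A) = 0" "bform Q (fr_e' A) (fr_v A) = 0"
  "bform Q (fr_v A) (fr_l A) = 1" "bform Q (fr_l A) (fr_v A) = 1" "bform Q (fr_l A) (fr_l A) = 0"
  "bform Q (fr_e A) (fr_l A) = 0" "bform Q (fr_l A) (fr_e A) = 0"
  "bform Q (fr_e' A) (fr_l A) = 0" "bform Q (fr_l A) (fr_e' A) = 0"
proof -
  show "bform Q (fr_e A) (fr_e A) = 0" "bform Q (fr_e A) (fr_v A) = 0" "bform Q (fr_v A) (fr_e A) = 0"
    "bform Q (fr_v A) (fr_v A) = 0"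
    using adapted_in_plane bform_plane by auto
  have "bform Q (fr_v A) (fr_e' A) = 0"
    using A bform_wedge_self unfolding adapted_def by metis
  then show "bform Q (fr_v A) (fr_e' A) = 0" "bform Q (fr_e' A) (fr_v A) = 0"
    using commute by auto
  show "bform Q (fr_e A) (fr_e' A) = 1" "bform Q (fr_e' A) (fr_e A) = 1"
    "bform Q (fr_e' A) (fr_e' A) = 0" "bform Q (fr_l A) (fr_l A) = 0"
    "bform Q (fr_v A) (fr_l A) = 1" "bform Q (fr_l A) (fr_v A) = 1"
    using A commute unfolding adapted_def by metis+
  show "bform Q (fr_l A) (fr_e A) = 0" "bform Q (fr_l A) (fr_e' A) = 0"
    using A unfolding adapted_def VI_def perp_def by auto
  then show "bform Q (fr_e A) (fr_l A) = 0" "bform Q (fr_e' A) (fr_l A) = 0"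
    using commute by auto
qed

text \<open>The generators \<open>e \<and> v\<close> and \<open>a \<and> b\<close> of the exterior square of the plane agree.\<close>

lemma wedge_adapted: "wedge Q a b x = bform Q x (fr_e A) *s fr_v A - bform Q x (fr_v A) *s fr_e A"
  and plane_adapted: "y \<in> plane \<Longrightarrow> y = bform Q y (fr_e' A) *s fr_e A + bform Q y (fr_l A) *s fr_v A"
proof -
  obtain c d where e: "fr_e A = c *s a + d *s b"
    using adapted_in_plane plane_iff by blast
  define s t where "s = bform Q (fr_e' A) a" and "t = bform Q (fr_e' A) b"
  have v: "fr_v A = s *s b - t *s a"
    using A unfolding adapted_def wedge_def s_def t_def by auto
  have one: "c * s + d * t = 1"
    using adapted_gram(6) unfolding e s_def t_def by (simp add: bform_linear)
  have "bform Q x (fr_e A) *s fr_v A - bform Q x (fr_v A) *s fr_e A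
      = (c * s + d * t) *s wedge Q a b x"
    unfolding e v wedge_def by (simp add: bform_linear vec_eq_iff algebra_simps)
  then show "wedge Q a b x = bform Q x (fr_e A) *s fr_v A - bform Q x (fr_v A) *s fr_e A"
    using one by simp
  have "s *s fr_e A - d *s fr_v A = (c * s + d * t) *s a"
    "t *s fr_e A + c *s fr_v A = (c * s + d * t) *s b"
    unfolding e v by (simp_all add: vec_eq_iff algebra_simps)
  then have ab: "a = s *s fr_e A - d *s fr_v A" "b = t *s fr_e A + c *s fr_v A"
    using one by simp_all
  assume "y \<in> plane"
  then obtain p q where y: "y = p *s a + q *s b"
    using plane_iff by blast
  define p' q' where "p' = p * s + q * t" and "q' = q * c - p * d"
  have y': "y = p' *s fr_e A + q' *s fr_v A"
  proof -
    have "y = p *s (s *s fr_e A - d *s fr_v A) + q *s (t *s fr_e A + c *s fr_v A)"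
      unfolding y by (simp only: ab[symmetric])
    then show ?thesis
      by (simp add: p'_def q'_def vec_eq_iff algebra_simps)
  qed
  show "y = bform Q y (fr_e' A) *s fr_e A + bform Q y (fr_l A) *s fr_v A"
    unfolding y' by (simp add: bform_linear adapted_gram)
qed

lemma perp_plane_adapted: "x \<in> perp Q plane \<longleftrightarrow> bform Q x (fr_e A) = 0 \<and> bform Q x (fr_v A) = 0"
proof
  assume "bform Q x (fr_e A) = 0 \<and> bform Q x (fr_v A) = 0"
  then have "bform Q x y = 0" if "y \<in> plane" for y
    by (subst plane_adapted[OF that]) (simp add: bform_linear)
  then show "x \<in> perp Q plane" unfolding perp_def by simp
qed (use adapted_in_plane in \<open>auto simp: perp_def\<close>)

lemma bform_core:
  "bform Q (core Q A x) (fr_e A) = 0" "bform Q (core Q A x) (fr_e' A) = 0"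
  "bform Q (core Q A x) (fr_v A) = 0" "bform Q (core Q A x) (fr_l A) = 0"
  "bform Q (fr_e A) (core Q A x) = 0" "bform Q (fr_e' A) (core Q A x) = 0"
  "bform Q (fr_v A) (core Q A x) = 0" "bform Q (fr_l A) (core Q A x) = 0"
  using commute[of "fr_e A" x] commute[of "fr_e' A" x] commute[of "fr_v A" x] commute[of "fr_l A" x]
  by (simp_all add: core_def bform_linear adapted_gram)

lemma core_perp_plane: "core Q A x \<in> perp Q plane"
  by (simp add: perp_plane_adapted bform_core)

lemma core_frame: "core Q A (fr_e' A) = 0" "core Q A (fr_l A) = 0"
  by (simp_all add: core_def adapted_gram)

lemma core_plane:
  assumes "x \<in> plane" shows "core Q A x = 0"
  by (subst plane_adapted[OF assms]) (simp add: core_def bform_linear adapted_gram)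

lemma core_cong: "x - y \<in> plane \<Longrightarrow> core Q A x = core Q A y"
  using core_plane[of "x - y"] by (simp add: clinear_simps[OF core_clinear])

lemma core_diff_plane:
  assumes "x \<in> perp Q plane" shows "core Q A x - x \<in> plane"
proof -
  have "core Q A x - x = - (bform Q x (fr_e' A) *s fr_e A + bform Q x (fr_l A) *s fr_v A)"
    using assms by (simp add: core_def perp_plane_adapted)
  then show ?thesis
    using adapted_in_plane by (simp only:) (intro plane_closed)
qed

lemma core_core: "core Q A (core Q A x) = core Q A x"
  by (subst core_def) (simp add: bform_core)

lemma adapted_expand:
  "x = bform Q x (fr_e' A) *s fr_e A + bform Q x (fr_e A) *s fr_e' A
     + bform Q x (fr_l A) *s fr_v A + bform Q x (fr_v A) *s fr_l A + core Q A x"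
  by (simp add: core_def)

text \<open>On \<open>J\<^sup>\<bottom>\<close>, the projection changes vectors only by elements of \<open>J\<close>.\<close>

lemma bform_core_core:
  assumes "x \<in> perp Q plane" "y \<in> perp Q plane"
  shows "bform Q (core Q A x) (core Q A y) = bform Q x y"
proof -
  have "bform Q (core Q A x - x) (core Q A y) = 0" "bform Q x (core Q A y - y) = 0"
    using core_diff_plane core_perp_plane assms commute[of "core Q A x - x"]
    unfolding perp_def by auto
  then show ?thesis by (simp add: bform_linear)
qed

lemma VI_adapted: "x \<in> VI Q (fr_e A) (fr_e' A) \<longleftrightarrow> bform Q x (fr_e A) = 0 \<and> bform Q x (fr_e' A) = 0"
  by (auto simp: VI_def perp_def)

lemma proj_VI_in: "proj_VI Q (fr_e A) (fr_e' A) x \<in> VI Q (fr_e A) (fr_e' A)"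
  by (simp add: VI_adapted proj_VI_def bform_linear adapted_gram)

text \<open>The form identifies the component of a vector in the complement of the quadruple with a
  functional on \<open>J\<^sup>\<bottom>\<close>.\<close>

lemma perp_double_plane:
  assumes "\<And>y. y \<in> perp Q plane \<Longrightarrow> bform Q x y = 0"
  shows "x \<in> plane"
proof -
  have "core Q A x = 0"
  proof (rule nondegenerate)
    fix y
    have "bform Q (core Q A x) y = bform Q (core Q A x) (core Q A y)"
      unfolding core_def[of Q A y] by (simp add: bform_linear bform_core)
    also have "\<dots> = bform Q x (core Q A y)"
      unfolding core_def[of Q A x]
      by (simp add: bform_linear bform_core)
    finally show "bform Q (core Q A x) y = 0"
      using assms core_perp_plane by simp
  qed
  moreover have "bform Q x (fr_e A) = 0" "bform Q x (fr_v A) = 0"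
    using assms adapted_in_plane plane_isotropic by auto
  ultimately have "x = bform Q x (fr_e' A) *s fr_e A + bform Q x (fr_l A) *s fr_v A"
    using adapted_expand[of x] by simp
  then show ?thesis
    using adapted_in_plane plane_closed by metis
qed

end

context
  fixes A B :: "'n frame"
  assumes A: "adapted Q a b A" and B: "adapted Q a b B"
begin

lemma comparison_frame: "comparison Q A B (fr_v A) = fr_v B" "comparison Q A B (fr_e A) = 0"
  "comparison Q A B (fr_e' A) = 0"
  using adapted_in_plane[OF A] by (simp_all add: comparison_def adapted_gram[OF A]
      core_plane[OF A] core_frame[OF A] clinear_simps(4)[OF core_clinear])

lemma bform_comparison:
  "bform Q (comparison Q A B x) (fr_v B) = bform Q x (fr_v A)"
  "bform Q (comparison Q A B x) (fr_l B) = bform Q x (fr_l A)"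
  "bform Q (comparison Q A B x) (fr_e B) = 0"
  "bform Q (comparison Q A B x) (fr_e' B) = 0"
  by (simp_all add: comparison_def bform_linear bform_core[OF B] adapted_gram[OF B])

lemma comparison_in_VI: "comparison Q A B x \<in> VI Q (fr_e B) (fr_e' B)"
  by (simp add: VI_adapted[OF B] bform_comparison)

lemma core_comparison: "core Q B (comparison Q A B x) = core Q B (core Q A x)"
  using adapted_in_plane[OF B] by (simp add: comparison_def clinear_simps[OF core_clinear]
      core_plane[OF B] core_frame[OF B] core_core[OF B])

text \<open>Two projections differ on \<open>J\<^sup>\<bottom>\<close> by vectors of \<open>J\<close>, and each projection annihilates \<open>J\<close>.\<close>

lemma comparison_inverse: "comparison Q B A (comparison Q A B x) = proj_VI Q (fr_e A) (fr_e' A) x"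
proof -
  have "core Q A (core Q B (core Q A x)) = core Q A (core Q A x)"
    by (intro core_cong[OF A] core_diff_plane[OF B] core_perp_plane[OF A])
  then have "comparison Q B A (comparison Q A B x) =
      bform Q x (fr_l A) *s fr_v A + bform Q x (fr_v A) *s fr_l A + core Q A x"
    unfolding comparison_def[of Q B A] by (simp add: bform_comparison core_comparison core_core[OF A])
  then show ?thesis
    by (simp add: core_def proj_VI_def)
qed

lemma comparison_isometry:
  assumes x: "x \<in> VI Q (fr_e A) (fr_e' A)" and y: "y \<in> VI Q (fr_e A) (fr_e' A)"
  shows "bform Q (comparison Q A B x) (comparison Q A B y) = bform Q x y"
proof -
  let ?x = "bform Q x (fr_l A) *s fr_v A + bform Q x (fr_v A) *s fr_l A + core Q A x"
  let ?y = "bform Q y (fr_l A) *s fr_v A + bform Q y (fr_v A) *s fr_l A + core Q A y"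
  have xy: "?x = x" "?y = y"
    using x y unfolding VI_adapted[OF A] core_def by simp_all
  have "bform Q (comparison Q A B x) (comparison Q A B y) =
      bform Q x (fr_l A) * bform Q y (fr_v A) + bform Q x (fr_v A) * bform Q y (fr_l A)
      + bform Q (core Q A x) (core Q A y)"
    by (simp add: comparison_def bform_linear adapted_gram[OF B] bform_core[OF B]
        bform_core_core[OF B] core_perp_plane[OF A])
  also have "\<dots> = bform Q ?x ?y"
    by (simp add: bform_linear adapted_gram[OF A] bform_core[OF A])
  also have "\<dots> = bform Q x y"
    using xy by simp
  finally show ?thesis .
qed

end

end

section \<open>The action of the parabolic group between two trivializations\<close>

text \<open>
  The properties of the elements of \<open>\<Gamma>(J)\<close> that matter: they are isometries that fix the generator
  \<open>a \<and> b\<close> of the exterior square of the plane \<open>J\<close>, that is, commute with its infinitesimal isometry,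
  and they act trivially on \<open>J\<^sup>\<bottom>/J\<close>.
\<close>

definition plane_unimodular :: "int^'n^'n \<Rightarrow> complex^'n \<Rightarrow> complex^'n \<Rightarrow> complex^'n^'n \<Rightarrow> bool" where
  "plane_unimodular Q a b g \<longleftrightarrow> (\<forall>x y. bform Q (g *v x) (g *v y) = bform Q x y) \<and>
     (\<forall>x. g *v wedge Q a b x = wedge Q a b (g *v x)) \<and>
     (\<forall>x\<in>perp Q (vec.span {a, b}). g *v x - x \<in> vec.span {a, b})"

definition transition ::
  "int^'n^'n \<Rightarrow> complex^'n^'n \<Rightarrow> 'n frame \<Rightarrow> 'n frame \<Rightarrow> complex^'n \<Rightarrow> complex^'n \<Rightarrow> complex^'n" where
  "transition Q g A B w x = triv Q (fr_e B) (fr_e' B) (g *v w) (g *v triv_inv Q (fr_e A) w x)"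

definition automorphy :: "int^'n^'n \<Rightarrow> complex^'n^'n \<Rightarrow> 'n frame \<Rightarrow> 'n frame \<Rightarrow> complex^'n \<Rightarrow> complex" where
  "automorphy Q g A B w = bform Q (g *v w) (fr_e B) / bform Q w (fr_e A)"

lemma triv_inv_clinear: "clinear (triv_inv Q e w)"
  by (rule clinearI) (simp_all add: triv_inv_def bform_linear vec_eq_iff add_divide_distrib algebra_simps)

lemma triv_clinear:
  fixes Q :: "int^'n^'n"
  shows "clinear (triv Q e e' w)"
proof (rule clinearI)
  fix x y :: "complex^'n" and c :: complex
  have "x + y - (bform Q (x + y) e / bform Q w e) *s w
      = (x - (bform Q x e / bform Q w e) *s w) + (y - (bform Q y e / bform Q w e) *s w)"
    by (simp add: bform_linear vec_eq_iff add_divide_distrib algebra_simps)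
  then show "triv Q e e' w (x + y) = triv Q e e' w x + triv Q e e' w y"
    unfolding triv_def by (simp only: clinear_simps(1)[OF proj_VI_clinear])
  have "c *s x - (bform Q (c *s x) e / bform Q w e) *s w = c *s (x - (bform Q x e / bform Q w e) *s w)"
    by (simp add: bform_linear vec_eq_iff algebra_simps)
  then show "triv Q e e' w (c *s x) = c *s triv Q e e' w x"
    unfolding triv_def by (simp only: clinear_simps(2)[OF proj_VI_clinear])
qed

lemma transition_clinear: "clinear (transition Q g A B w)"
  by (rule clinearI)
    (simp_all add: transition_def clinear_simps[OF triv_inv_clinear] clinear_simps[OF triv_clinear]
      matrix_vector_right_distrib vec.scale)

context isotropic_plane
begin

context
  fixes g :: "complex^'n^'n" and A B :: "'n frame" and w :: "complex^'n"
  assumes g: "plane_unimodular Q a b g"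
    and A: "adapted Q a b A" and B: "adapted Q a b B"
    and isotropic_w: "bform Q w w = 0"
    and w_e: "bform Q w (fr_e A) \<noteq> 0" and gw_e: "bform Q (g *v w) (fr_e B) \<noteq> 0"
begin

private lemma g_isometry: "bform Q (g *v x) (g *v y) = bform Q x y"
  and g_wedge: "g *v wedge Q a b x = wedge Q a b (g *v x)"
  and g_perp: "x \<in> perp Q plane \<Longrightarrow> g *v x - x \<in> plane"
  using g unfolding plane_unimodular_def plane_def by blast+

lemma automorphy_nonzero: "automorphy Q g A B w \<noteq> 0"
  using w_e gw_e by (simp add: automorphy_def)

lemma transition_in_VI: "transition Q g A B w x \<in> VI Q (fr_e B) (fr_e' B)"
  unfolding transition_def triv_def by (rule proj_VI_in[OF B])

text \<open>
  At \<open>\<omega>\<close>, the line of \<open>J\<close> orthogonal to \<open>\<omega>\<close> is spanned by the contraction of \<open>a \<and> b\<close> with \<open>\<omega>\<close>,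
  and this construction is equivariant. Hence the only difference between the two trivializations
  of this line is the factor of automorphy of \<open>\<L>\<close>.
\<close>

lemma transition_v: "transition Q g A B w (fr_v A) = automorphy Q g A B w *s fr_v B"
proof -
  let ?j = "bform Q w (fr_e A)"
  have "triv_inv Q (fr_e A) w (fr_v A) = (1 / ?j) *s wedge Q a b w"
    using w_e by (simp add: triv_inv_def wedge_adapted[OF A] vec_eq_iff field_simps
        commute[of "fr_v A" w] commute[of "fr_e A" w])
  then have "g *v triv_inv Q (fr_e A) w (fr_v A) = (1 / ?j) *s wedge Q a b (g *v w)"
    by (simp add: vec.scale g_wedge)
  also have "\<dots> = (bform Q (g *v w) (fr_e B) / ?j) *s fr_v B - (bform Q (g *v w) (fr_v B) / ?j) *s fr_e B"
    by (simp add: wedge_adapted[OF B] vec_eq_iff diff_divide_distrib algebra_simps)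
  finally have lift: "g *v triv_inv Q (fr_e A) w (fr_v A) = \<dots>" .
  show ?thesis
    unfolding transition_def triv_def lift
    by (simp add: bform_linear adapted_gram[OF B] proj_VI_def automorphy_def)
qed

lemma transition_isometry:
  assumes x: "x \<in> VI Q (fr_e A) (fr_e' A)" and y: "y \<in> VI Q (fr_e A) (fr_e' A)"
  shows "bform Q (transition Q g A B w x) (transition Q g A B w y) = bform Q x y"
proof -
  \<comment> \<open>Corrections of vectors of \<open>e\<^sup>\<bottom> \<inter> \<omega>\<^sup>\<bottom>\<close> by multiples of the isotropic vector \<open>\<omega>\<close> or \<open>e\<close> do
    not change their products.\<close>
  have lift: "bform Q (triv_inv Q (fr_e A) w x) w = 0"
    "bform Q (triv_inv Q (fr_e A) w x) (triv_inv Q (fr_e A) w y) = bform Q x y"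
    if "x \<in> VI Q (fr_e A) (fr_e' A)" "y \<in> VI Q (fr_e A) (fr_e' A)" for x y
    using that w_e unfolding VI_adapted[OF A] triv_inv_def
    by (simp_all add: bform_linear adapted_gram[OF A] commute[of "fr_e A" w] commute[of "fr_e A" y])
  have proj: "bform Q (triv Q (fr_e B) (fr_e' B) (g *v w) p) (triv Q (fr_e B) (fr_e' B) (g *v w) q)
      = bform Q p q"
    if "bform Q p (g *v w) = 0" "bform Q q (g *v w) = 0" for p q
  proof -
    define p' where "p' = p - (bform Q p (fr_e B) / bform Q (g *v w) (fr_e B)) *s (g *v w)"
    define q' where "q' = q - (bform Q q (fr_e B) / bform Q (g *v w) (fr_e B)) *s (g *v w)"
    have e: "bform Q p' (fr_e B) = 0" "bform Q (fr_e B) q' = 0" "bform Q q' (fr_e B) = 0"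
      using gw_e commute[of "fr_e B" q'] by (simp_all add: p'_def q'_def bform_linear)
    have "bform Q (triv Q (fr_e B) (fr_e' B) (g *v w) p) (triv Q (fr_e B) (fr_e' B) (g *v w) q)
        = bform Q (proj_VI Q (fr_e B) (fr_e' B) p') (proj_VI Q (fr_e B) (fr_e' B) q')"
      by (simp add: triv_def p'_def q'_def)
    also have "\<dots> = bform Q p' q'"
      by (simp add: proj_VI_def bform_linear e adapted_gram[OF B])
    also have "\<dots> = bform Q p q"
      using that commute[of "g *v w" q] isotropic_w
      by (simp add: p'_def q'_def bform_linear g_isometry)
    finally show ?thesis .
  qed
  show ?thesis
    unfolding transition_def using x y by (simp add: proj g_isometry lift)
qed

text \<open>Dual to the action on the line of \<open>v\<close>, because the transition is an isometry.\<close>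

lemma bform_transition_v:
  assumes "x \<in> VI Q (fr_e A) (fr_e' A)"
  shows "bform Q (transition Q g A B w x) (fr_v B) = bform Q x (fr_v A) / automorphy Q g A B w"
proof -
  have "fr_v A \<in> VI Q (fr_e A) (fr_e' A)"
    by (simp add: VI_adapted[OF A] adapted_gram[OF A])
  from transition_isometry[OF assms this] show ?thesis
    using automorphy_nonzero by (simp add: transition_v bform_linear field_simps)
qed

text \<open>All corrections in the two trivializations of a vector of \<open>J\<^sup>\<bottom>\<close> are by vectors of \<open>J\<close>, and \<open>g\<close>
  acts trivially modulo \<open>J\<close>.\<close>

lemma transition_diff_plane:
  assumes x: "x \<in> VI Q (fr_e A) (fr_e' A)" and xv: "bform Q x (fr_v A) = 0"
  shows "transition Q g A B w x - x \<in> plane"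
proof -
  define y where "y = triv_inv Q (fr_e A) w x"
  have "x \<in> perp Q plane"
    using x xv unfolding VI_adapted[OF A] perp_plane_adapted[OF A] by simp
  moreover have yx: "y - x \<in> plane"
    unfolding y_def triv_inv_def using adapted_in_plane[OF A]
    by (simp add: plane_closed)
  ultimately have y: "y \<in> perp Q plane"
    using plane_isotropic vec.subspace_add[OF subspace_perp_plane, of x "y - x"] by auto
  then have gy: "g *v y - y \<in> plane"
    by (rule g_perp)
  then have "g *v y \<in> perp Q plane"
    using y plane_isotropic vec.subspace_add[OF subspace_perp_plane, of y "g *v y - y"] by auto
  then have "bform Q (g *v y) (fr_e B) = 0"
    by (simp add: perp_plane_adapted[OF B])
  then have "transition Q g A B w x = g *v y - bform Q (g *v y) (fr_e' B) *s fr_e B"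
    by (simp add: transition_def y_def[symmetric] triv_def proj_VI_def)
  then have "transition Q g A B w x - x =
      (g *v y - y) + (y - x) - bform Q (g *v y) (fr_e' B) *s fr_e B"
    by simp
  then show ?thesis
    using gy yx adapted_in_plane(1)[OF B] by (metis plane_closed(1-3))
qed

text \<open>
  Transported to the fiber at the point \<open>fr_e' P\<close>, the action becomes block triangular with respect
  to the \<open>J\<close>-filtration, with the powers of the factor of automorphy on the diagonal.
\<close>

context
  fixes P :: "'n frame"
  assumes P: "adapted Q a b P"
begin

definition conjugate :: "complex^'n \<Rightarrow> complex^'n" where
  "conjugate x = comparison Q B P (transition Q g A B w (comparison Q P A x))"

lemma conjugate_line:
  "conjugate (c *s fr_v P + d *s fr_e' P) - automorphy Q g A B w *s (c *s fr_v P + d *s fr_e' P)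
     = - (automorphy Q g A B w * d) *s fr_e' P"
proof -
  have "conjugate (c *s fr_v P + d *s fr_e' P) = (c * automorphy Q g A B w) *s fr_v P"
    by (simp add: conjugate_def clinear_simps[OF comparison_clinear] clinear_simps[OF transition_clinear]
        comparison_frame[OF P A] comparison_frame[OF B P] transition_v)
  then show ?thesis by (simp add: vec_eq_iff algebra_simps)
qed

lemma conjugate_middle:
  assumes x: "bform Q x (fr_e' P) = 0" "bform Q x (fr_v P) = 0"
  obtains c d where "conjugate x - x = c *s fr_v P + d *s fr_e' P"
proof -
  define y where "y = comparison Q P A x"
  define z where "z = transition Q g A B w y"
  have y: "y \<in> VI Q (fr_e A) (fr_e' A)" "bform Q y (fr_v A) = 0"
    using x by (simp_all add: y_def comparison_in_VI[OF P A] bform_comparison[OF P A])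
  have zy: "z - y \<in> plane"
    unfolding z_def by (rule transition_diff_plane[OF y])
  have zv: "bform Q z (fr_v B) = 0" "bform Q z (fr_e B) = 0"
    using bform_transition_v[OF y(1)] y(2) transition_in_VI[of y]
    unfolding z_def VI_adapted[OF B] by simp_all
  then have z: "z \<in> perp Q plane"
    by (simp add: perp_plane_adapted[OF B])
  \<comment> \<open>Modulo \<open>J\<close>, all of \<open>core x\<close>, \<open>y\<close> and \<open>z\<close> agree.\<close>
  have "y - core Q P x = bform Q x (fr_l P) *s fr_v A + (core Q A (core Q P x) - core Q P x)"
    using x by (simp add: y_def comparison_def)
  then have yx: "y - core Q P x \<in> plane"
    using adapted_in_plane(2)[OF A] core_diff_plane[OF A core_perp_plane[OF P, of x]]
    by (metis plane_closed(1,3))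
  have "core Q P (core Q B z) = core Q P (core Q P x)"
  proof (rule core_cong[OF P])
    have "core Q B z - core Q P x = (core Q B z - z) + (z - y) + (y - core Q P x)"
      by simp
    then show "core Q B z - core Q P x \<in> plane"
      using core_diff_plane[OF B z] zy yx plane_closed by metis
  qed
  then have "conjugate x = bform Q z (fr_l B) *s fr_v P + core Q P x"
    using zv by (simp add: conjugate_def y_def[symmetric] z_def[symmetric] comparison_def[of Q B P]
        core_core[OF P])
  then have "conjugate x - x
      = (bform Q z (fr_l B) - bform Q x (fr_l P)) *s fr_v P + (- bform Q x (fr_e P)) *s fr_e' P"
    using x by (simp add: core_def vec_eq_iff algebra_simps)
  then show ?thesis using that by blast
qed

lemma conjugate_top:
  assumes x: "bform Q x (fr_e' P) = 0"
  shows "bform Q (conjugate x - (1 / automorphy Q g A B w) *s x) (fr_e' P) = 0"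
    and "bform Q (conjugate x - (1 / automorphy Q g A B w) *s x) (fr_v P) = 0"
proof -
  show "bform Q (conjugate x - (1 / automorphy Q g A B w) *s x) (fr_e' P) = 0"
    using x by (simp add: conjugate_def bform_linear bform_comparison[OF B P])
  show "bform Q (conjugate x - (1 / automorphy Q g A B w) *s x) (fr_v P) = 0"
    by (simp add: conjugate_def bform_linear bform_comparison[OF B P]
        bform_transition_v[OF comparison_in_VI[OF P A]] bform_comparison[OF P A])
qed

end

end

end

section \<open>Multilinear algebra of index tensors\<close>

abbreviation tlinear :: "('n tensor \<Rightarrow> 'n tensor) \<Rightarrow> bool" where
  "tlinear F \<equiv> Vector_Spaces.linear tscale tscale F"

abbreviation tfunctional :: "('n tensor \<Rightarrow> complex) \<Rightarrow> bool" where
  "tfunctional F \<equiv> Vector_Spaces.linear tscale (*) F"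

lemma tlinearI:
  assumes "\<And>x y. A (x + y) = A x + A y" and "\<And>c x. A (tscale c x) = tscale c (A x)"
  shows "tlinear A"
  using assms by unfold_locales auto

lemma tfunctionalI:
  assumes "\<And>x y. A (x + y) = A x + A y" and "\<And>c x. A (tscale c x) = c * (A x)"
  shows "tfunctional A"
  using assms by unfold_locales (auto simp: algebra_simps)

lemma tlinear_simps:
  assumes "tlinear A"
  shows "A (x + y) = A x + A y" and "A (tscale c x) = tscale c (A x)" and "A (x - y) = A x - A y"
    and "A 0 = 0" and "A (sum f S) = (\<Sum>i\<in>S. A (f i))"
proof -
  interpret Vector_Spaces.linear tscale tscale A by fact
  show "A (x + y) = A x + A y" "A (tscale c x) = tscale c (A x)" "A (x - y) = A x - A y"
    "A 0 = 0" "A (sum f S) = (\<Sum>i\<in>S. A (f i))"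
    by (simp_all add: add scale diff sum)
qed

lemma tfunctional_simps:
  assumes "tfunctional A"
  shows "A (x + y) = A x + A y" and "A (tscale c x) = c * (A x)" and "A (x - y) = A x - A y"
    and "A 0 = 0" and "A (sum f S) = (\<Sum>i\<in>S. A (f i))"
proof -
  interpret Vector_Spaces.linear tscale "(*)" A by fact
  show "A (x + y) = A x + A y" "A (tscale c x) = c * (A x)" "A (x - y) = A x - A y"
    "A 0 = 0" "A (sum f S) = (\<Sum>i\<in>S. A (f i))"
    by (simp_all add: add scale diff sum)
qed

lemma tlinear_compose:
  assumes F: "tlinear F" and G: "tlinear G"
  shows "tlinear (\<lambda>T. F (G T))"
  by (rule tlinearI) (simp_all add: tlinear_simps[OF F] tlinear_simps[OF G])

lemma tlinear_diff:
  assumes F: "tlinear F" and G: "tlinear G"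
  shows "tlinear (\<lambda>T. F T - G T)"
  by (rule tlinearI)
    (simp_all add: tlinear_simps[OF F] tlinear_simps[OF G] tens.scale_right_diff_distrib)

lemma tlinear_scale:
  assumes F: "tlinear F"
  shows "tlinear (\<lambda>T. tscale c (F T))"
  by (rule tlinearI) (simp_all add: tlinear_simps[OF F] tens.scale_right_distrib mult.commute)

lemma tlinear_id: "tlinear (\<lambda>T. T)"
  by (rule tlinearI) simp_all

lemma tlinear_sum:
  assumes F: "\<And>i. tlinear (F i)"
  shows "tlinear (\<lambda>T. \<Sum>i\<in>S. F i T)"
  by (rule tlinearI) (simp_all add: tlinear_simps[OF F] sum.distrib tens.scale_sum_right)

lemma subspace_vimage_tlinear:
  assumes F: "tlinear F" and R: "tens.subspace R"
  shows "tens.subspace {T. F T \<in> R}"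
  using R by (auto simp: tens.subspace_def tlinear_simps[OF F])

lemma subspace_kernel_tfunctional:
  assumes F: "tfunctional F"
  shows "tens.subspace {T. F T = 0}"
  by (auto simp: tens.subspace_def tfunctional_simps[OF F])

lemma tens_span_subset: "T \<in> tens.span S \<Longrightarrow> S \<subseteq> R \<Longrightarrow> tens.subspace R \<Longrightarrow> T \<in> R"
  using tens.span_minimal by blast

lemma tlinear_span_cong:
  assumes "tlinear F" "tlinear G" "\<And>T. T \<in> S \<Longrightarrow> F T = G T" "T \<in> tens.span S"
  shows "F T = G T"
proof -
  have "tens.subspace {T. F T - G T \<in> {0}}"
    by (intro subspace_vimage_tlinear tlinear_diff assms tens.subspace_single_0)
  then have "T \<in> {T. F T - G T \<in> {0}}"
    by (rule tens_span_subset[OF assms(4), rotated]) (use assms(3) in auto)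
  then show ?thesis by simp
qed

lemma tlinear_span_image:
  assumes "tlinear F" "\<And>T. T \<in> S \<Longrightarrow> F T \<in> R" "tens.subspace R" "T \<in> tens.span S"
  shows "F T \<in> R"
proof -
  have "T \<in> {T. F T \<in> R}"
    using assms(4) by (rule tens_span_subset)
      (use assms in \<open>auto intro!: subspace_vimage_tlinear\<close>)
  then show ?thesis by simp
qed

subsection \<open>Elementary tensors\<close>

lemma elem_tensor_Nil: "elem_tensor [] i = (if i = [] then 1 else 0)"
  by (simp add: elem_tensor_def)

lemma elem_tensor_Cons: "elem_tensor (x # xs) (i # is) = x $ i * elem_tensor xs is"
  by (simp add: elem_tensor_def prod.lessThan_Suc_shift del: prod.lessThan_Suc)

lemma elem_tensor_length: "length i \<noteq> length xs \<Longrightarrow> elem_tensor xs i = 0"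
  by (simp add: elem_tensor_def)

lemma elem_tensor_append:
  "length i = length xs \<Longrightarrow> elem_tensor (xs @ ys) (i @ j) = elem_tensor xs i * elem_tensor ys j"
proof (induction xs arbitrary: i)
  case (Cons x xs)
  then obtain k i' where "i = k # i'" by (cases i) auto
  with Cons show ?case by (simp add: elem_tensor_Cons)
qed (simp add: elem_tensor_Nil)

lemma elem_tensor_update:
  assumes "k < length xs"
  shows "elem_tensor (xs[k := x + y]) = elem_tensor (xs[k := x]) + elem_tensor (xs[k := y])"
    and "elem_tensor (xs[k := c *s x]) = tscale c (elem_tensor (xs[k := x]))"
proof -
  have eq: "elem_tensor (xs[k := z]) i
      = (if length i = length xs then z $ (i ! k) * (\<Prod>j\<in>{..<length xs} - {k}. (xs ! j) $ (i ! j)) else 0)"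
    for z i
    using assms by (simp add: elem_tensor_def prod.remove[of "{..<length xs}" k])
  show "elem_tensor (xs[k := x + y]) = elem_tensor (xs[k := x]) + elem_tensor (xs[k := y])"
    "elem_tensor (xs[k := c *s x]) = tscale c (elem_tensor (xs[k := x]))"
    by (auto simp: fun_eq_iff eq tscale_def algebra_simps)
qed

lemma elem_tensor_zero: "0 \<in> set xs \<Longrightarrow> elem_tensor xs = 0"
proof
  fix i assume "0 \<in> set xs"
  then obtain j where "j < length xs" "xs ! j = 0"
    by (auto simp: in_set_conv_nth)
  then have "(\<Prod>j<length xs. (xs ! j) $ (i ! j)) = 0"
    by (intro prod_zero bexI[of _ j]) auto
  then show "elem_tensor xs i = 0 i"
    by (simp add: elem_tensor_def)
qed

lemma elem_tensor_scale:
  "length cs = length xs \<Longrightarrow>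
     elem_tensor (map2 (*s) cs xs) = tscale (\<Prod>j<length xs. cs ! j) (elem_tensor xs)"
  by (auto simp: elem_tensor_def fun_eq_iff tscale_def prod.distrib)

text \<open>By multilinearity, the factors can be extended from spanning sets to their spans one position
  at a time.\<close>

lemma elem_tensor_span:
  assumes R: "tens.subspace R"
    and S: "\<And>xs. length xs = d \<Longrightarrow> (\<forall>j<d. xs ! j \<in> S j) \<Longrightarrow> elem_tensor xs \<in> R"
    and xs: "length xs = d" "\<forall>j<d. xs ! j \<in> vec.span (S j)"
  shows "elem_tensor xs \<in> R"
proof -
  have "\<forall>xs. length xs = d \<and> (\<forall>j<d. xs ! j \<in> (if j < k then vec.span (S j) else S j)) \<longrightarrow> elem_tensor xs \<in> R"
    if "k \<le> d" for k
    using that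
  proof (induction k)
    case (Suc k)
    show ?case
    proof (intro allI impI)
      fix xs :: "(complex^'a) list"
      assume xs: "length xs = d \<and> (\<forall>j<d. xs ! j \<in> (if j < Suc k then vec.span (S j) else S j))"
      have sub: "vec.subspace {x. elem_tensor (xs[k := x]) \<in> R}"
      proof (rule vec.subspaceI)
        have "elem_tensor (xs[k := 0]) = 0"
          using xs Suc.prems by (intro elem_tensor_zero set_update_memI) simp
        then show "0 \<in> {x. elem_tensor (xs[k := x]) \<in> R}"
          using R by (simp add: tens.subspace_0)
      qed (use xs Suc.prems R in \<open>auto simp: elem_tensor_update tens.subspace_add tens.subspace_scale\<close>)
      have "S k \<subseteq> {x. elem_tensor (xs[k := x]) \<in> R}"
      proof
        fix x assume "x \<in> S k"
        then have "length (xs[k := x]) = d"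
          "\<forall>j<d. xs[k := x] ! j \<in> (if j < k then vec.span (S j) else S j)"
          using xs by (auto simp: nth_list_update less_Suc_eq split: if_splits)
        then show "x \<in> {x. elem_tensor (xs[k := x]) \<in> R}"
          using Suc by auto
      qed
      then have "vec.span (S k) \<subseteq> {x. elem_tensor (xs[k := x]) \<in> R}"
        using sub by (rule vec.span_minimal)
      moreover have "xs ! k \<in> (if k < Suc k then vec.span (S k) else S k)"
        using xs Suc.prems Suc_le_lessD by blast
      ultimately show "elem_tensor xs \<in> R" by auto
    qed
  qed (use S in auto)
  from this[of d] show ?thesis using xs by simp
qed

text \<open>A telescoping sum over the positions of the factors.\<close>

lemma elem_tensor_replace:
  assumes R: "tens.subspace R" and len: "length ys = d" "length zs = d"
    and step: "\<And>k. k < d \<Longrightarrow>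
      elem_tensor (take k ys @ (ys ! k - zs ! k) # drop (Suc k) zs) \<in> R"
  shows "elem_tensor ys - elem_tensor zs \<in> R"
proof -
  have "elem_tensor (take k ys @ drop k zs) - elem_tensor zs \<in> R" if "k \<le> d" for k
    using that
  proof (induction k)
    case 0
    then show ?case
      using tens.subspace_0[OF R] by (simp only: take_0 drop_0 append_Nil diff_self)
  next
    case (Suc k)
    let ?u = "take k ys @ drop k zs"
    have k: "k < length ?u" "k < d" and lenk: "length (take k ys) = k" using Suc.prems len by auto
    have dr: "drop k zs = zs ! k # drop (Suc k) zs"
      using Suc.prems len by (simp add: Cons_nth_drop_Suc)
    have upd: "?u[k := x] = take k ys @ x # drop (Suc k) zs" for x
      unfolding dr using lenk by (simp add: list_update_append)
    have "take (Suc k) ys = take k ys @ [ys ! k]"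
      using k(2) len by (simp add: take_Suc_conv_app_nth)
    then have "elem_tensor (take (Suc k) ys @ drop (Suc k) zs) = elem_tensor (?u[k := (ys ! k - zs ! k) + zs ! k])"
      by (simp add: upd)
    also have "\<dots> = elem_tensor (?u[k := ys ! k - zs ! k]) + elem_tensor (?u[k := zs ! k])"
      by (rule elem_tensor_update(1)[OF k(1)])
    also have "?u[k := zs ! k] = ?u"
      unfolding upd by (simp add: dr)
    finally have "elem_tensor (take (Suc k) ys @ drop (Suc k) zs) - elem_tensor zs
        = elem_tensor (?u[k := ys ! k - zs ! k]) + (elem_tensor ?u - elem_tensor zs)"
      by (metis add_diff_eq)
    moreover have "elem_tensor (?u[k := ys ! k - zs ! k]) \<in> R"
      using step[OF k(2)] by (simp only: upd)
    ultimately show ?case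
      using Suc tens.subspace_add[OF R] by (metis Suc_leD)
  qed
  from this[of d] len show ?thesis by simp
qed

subsection \<open>Tensor powers of linear maps, permutations and contractions\<close>

lemma sum_lists_prod:
  fixes f :: "nat \<Rightarrow> 'n::finite \<Rightarrow> complex"
  shows "(\<Sum>h | length h = d. \<Prod>j<d. f j (h ! j)) = (\<Prod>j<d. \<Sum>y\<in>UNIV. f j y)"
proof (induction d arbitrary: f)
  case (Suc d)
  have "{h :: 'n list. length h = Suc d} = (\<lambda>(y, h). y # h) ` (UNIV \<times> {h. length h = d})"
    by (auto simp: length_Suc_conv image_iff)
  moreover have "inj_on (\<lambda>(y, h). y # h) (UNIV \<times> {h :: 'n list. length h = d})"
    by (auto simp: inj_on_def)
  ultimately have "(\<Sum>h | length h = Suc d. \<Prod>j<Suc d. f j (h ! j))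
      = (\<Sum>(y, h)\<in>UNIV \<times> {h. length h = d}. f 0 y * (\<Prod>j<d. f (Suc j) (h ! j)))"
    by (simp add: sum.reindex prod.lessThan_Suc_shift case_prod_unfold del: prod.lessThan_Suc)
  also have "\<dots> = (\<Sum>y\<in>UNIV. f 0 y) * (\<Prod>j<d. \<Sum>y\<in>UNIV. f (Suc j) y)"
    by (simp add: sum.cartesian_product[symmetric] sum_product[symmetric] Suc[of "\<lambda>j. f (Suc j)"])
  finally show ?case by (simp add: prod.lessThan_Suc_shift del: prod.lessThan_Suc)
qed simp

lemma finite_lists_of_length: "finite {h :: 'n::finite list. length h = d}"
  using finite_lists_length_eq[of "UNIV :: 'n set" d] by simp

lemma tensor_map_tlinear: "tlinear (tensor_map A)"
  by (rule tlinearI)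
    (simp_all add: tensor_map_def fun_eq_iff tscale_def algebra_simps sum.distrib sum_distrib_left)

lemma tensor_map_elem:
  assumes "clinear A"
  shows "tensor_map A (elem_tensor xs) = elem_tensor (map A xs)"
proof
  fix i :: "'a list"
  have A: "(\<Sum>y\<in>UNIV. matrix A $ r $ y * x $ y) = A x $ r" for r x
    using matrix_works[OF assms, of x] by (simp add: matrix_vector_mult_def vec_eq_iff)
  show "tensor_map A (elem_tensor xs) i = elem_tensor (map A xs) i"
  proof (cases "length i = length xs")
    case True
    have "tensor_map A (elem_tensor xs) i
        = (\<Sum>h | length h = length xs. \<Prod>j<length xs. matrix A $ (i ! j) $ (h ! j) * (xs ! j) $ (h ! j))"
      using True by (auto simp: tensor_map_def elem_tensor_def prod.distrib intro!: sum.cong)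
    also have "\<dots> = (\<Prod>j<length xs. A (xs ! j) $ (i ! j))"
      by (subst sum_lists_prod) (simp add: A)
    finally show ?thesis using True by (simp add: elem_tensor_def)
  qed (simp add: tensor_map_def elem_tensor_def)
qed

lemma tensors_closed: "tens.subspace (tensors W d)" "tens.subspace (rad_tensors Q W d)"
  unfolding tensors_def rad_tensors_def by (rule tens.subspace_span)+

lemma elem_in_tensors: "length xs = d \<Longrightarrow> set xs \<subseteq> W \<Longrightarrow> elem_tensor xs \<in> tensors W d"
  unfolding tensors_def by (auto intro: tens.span_base)

lemma rad_subset_tensors: "rad_tensors Q W d \<subseteq> tensors W d"
  unfolding rad_tensors_def tensors_def by (intro tens.span_mono) auto

lemma tensors_eqI:
  assumes "tlinear F" "tlinear G" and "T \<in> tensors W d"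
    and "\<And>xs. length xs = d \<Longrightarrow> set xs \<subseteq> W \<Longrightarrow> F (elem_tensor xs) = G (elem_tensor xs)"
  shows "F T = G T"
  using tlinear_span_cong[OF assms(1,2) _ assms(3)[unfolded tensors_def]] assms(4) by blast

lemma tensors_imageI:
  assumes "tlinear F" "tens.subspace R" and "T \<in> tensors W d"
    and "\<And>xs. length xs = d \<Longrightarrow> set xs \<subseteq> W \<Longrightarrow> F (elem_tensor xs) \<in> R"
  shows "F T \<in> R"
  using tlinear_span_image[OF assms(1) _ assms(2) assms(3)[unfolded tensors_def]] assms(4) by blast

lemma tensors_support:
  assumes "T \<in> tensors W d" "length i \<noteq> d" shows "T i = 0"
proof -
  have "T \<in> {T. T i = 0}"
    using assms(1) unfolding tensors_def
    by (rule tens_span_subset)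
      (use assms(2) in \<open>auto simp: tens.subspace_def tscale_def elem_tensor_length\<close>)
  then show ?thesis by simp
qed

lemma tensor_map_tensors:
  assumes A: "clinear A" "A ` W \<subseteq> W'" and T: "T \<in> tensors W d"
  shows "tensor_map A T \<in> tensors W' d"
proof (rule tensors_imageI[OF tensor_map_tlinear tensors_closed(1) T])
  fix xs assume "length xs = d" "set xs \<subseteq> W"
  then have "length (map A xs) = d" "set (map A xs) \<subseteq> W'"
    using A(2) by auto
  then show "tensor_map A (elem_tensor xs) \<in> tensors W' d"
    unfolding tensor_map_elem[OF A(1)] by (rule elem_in_tensors)
qed

lemma tensor_map_cong:
  assumes A: "clinear A" and B: "clinear B" and AB: "\<And>x. x \<in> W \<Longrightarrow> A x = B x" and T: "T \<in> tensors W d"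
  shows "tensor_map A T = tensor_map B T"
proof (rule tensors_eqI[OF tensor_map_tlinear tensor_map_tlinear T])
  fix xs assume "length xs = d" "set xs \<subseteq> W"
  then have "map A xs = map B xs"
    using AB by auto
  then show "tensor_map A (elem_tensor xs) = tensor_map B (elem_tensor xs)"
    unfolding tensor_map_elem[OF A] tensor_map_elem[OF B] by (rule arg_cong)
qed

lemma tensor_map_compose:
  assumes A: "clinear A" and B: "clinear B" and T: "T \<in> tensors W d"
  shows "tensor_map A (tensor_map B T) = tensor_map (\<lambda>x. A (B x)) T"
proof (rule tensors_eqI[OF tlinear_compose[OF tensor_map_tlinear tensor_map_tlinear] tensor_map_tlinear T])
  have "clinear (\<lambda>x. A (B x))"
    by (intro clinearI) (simp_all add: clinear_simps[OF A] clinear_simps[OF B])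
  then show "tensor_map A (tensor_map B (elem_tensor xs)) = tensor_map (\<lambda>x. A (B x)) (elem_tensor xs)" for xs
    by (simp add: tensor_map_elem[OF A] tensor_map_elem[OF B] tensor_map_elem o_def)
qed

lemma tensor_map_id:
  assumes T: "T \<in> tensors W d"
  shows "tensor_map (\<lambda>x. x) T = T"
proof (rule tensors_eqI[OF tensor_map_tlinear tlinear_id T])
  have "clinear (\<lambda>x. x :: complex^'a)"
    by (rule clinearI) simp_all
  then show "tensor_map (\<lambda>x. x) (elem_tensor xs) = elem_tensor xs" for xs :: "(complex^'a) list"
    by (simp add: tensor_map_elem)
qed

lemma perm_action_tlinear: "tlinear (perm_action s)"
  by (rule tlinearI) (simp_all add: perm_action_def fun_eq_iff tscale_def)

lemma perm_action_elem:
  assumes s: "s permutes {..<d}" and "length xs = d"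
  shows "perm_action s (elem_tensor xs) = elem_tensor (permute_list (inv_into UNIV s) xs)"
proof
  fix i
  show "perm_action s (elem_tensor xs) i = elem_tensor (permute_list (inv_into UNIV s) xs) i"
  proof (cases "length i = d")
    case True
    have "(\<Prod>j<d. (xs ! inv_into UNIV s j) $ (i ! j)) = (\<Prod>j<d. (xs ! j) $ (i ! s j))"
      by (subst prod.permute[OF s]) (simp add: o_def permutes_inverses[OF s])
    then show ?thesis
      using True assms permutes_inv[OF s]
      by (auto simp: perm_action_def elem_tensor_def permute_list_nth)
  qed (use assms in \<open>simp add: perm_action_def elem_tensor_def\<close>)
qed

lemma perm_action_tensors:
  assumes s: "s permutes {..<d}" and T: "T \<in> tensors W d"
  shows "perm_action s T \<in> tensors W d"
proof (rule tensors_imageI[OF perm_action_tlinear tensors_closed(1) T])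
  fix xs assume xs: "length xs = d" "set xs \<subseteq> W"
  then show "perm_action s (elem_tensor xs) \<in> tensors W d"
    using permutes_inv[OF s] unfolding perm_action_elem[OF s xs(1)]
    by (intro elem_in_tensors) simp_all
qed

lemma elem_in_rad_tensors:
  "length xs = d \<Longrightarrow> set xs \<subseteq> W \<Longrightarrow> x \<in> set xs \<Longrightarrow> x \<in> perp Q W \<Longrightarrow> elem_tensor xs \<in> rad_tensors Q W d"
  unfolding rad_tensors_def by (rule tens.span_base) blast

lemma perm_action_rad_tensors:
  assumes s: "s permutes {..<d}" and T: "T \<in> rad_tensors Q W d"
  shows "perm_action s T \<in> rad_tensors Q W d"
proof (rule tlinear_span_image[OF perm_action_tlinear _ tensors_closed(2)])
  show "T \<in> tens.span {elem_tensor xs |xs. length xs = d \<and> set xs \<subseteq> W \<and> set xs \<inter> perp Q W \<noteq> {}}"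
    using T by (simp add: rad_tensors_def)
  fix T assume "T \<in> {elem_tensor xs |xs. length xs = d \<and> set xs \<subseteq> W \<and> set xs \<inter> perp Q W \<noteq> {}}"
  then obtain xs x where "T = elem_tensor xs" "length xs = d" "set xs \<subseteq> W" "x \<in> set xs" "x \<in> perp Q W"
    by blast
  then show "perm_action s T \<in> rad_tensors Q W d"
    using permutes_inv[OF s]
    by (auto simp: perm_action_elem[OF s] set_permute_list intro!: elem_in_rad_tensors)
qed

lemma perm_action_compose:
  assumes s: "s permutes {..<d}" and t: "t permutes {..<d}" and T: "T \<in> tensors W d"
  shows "perm_action s (perm_action t T) = perm_action (s \<circ> t) T"
proof
  fix i show "perm_action s (perm_action t T) i = perm_action (s \<circ> t) T i"
  proof (cases "length i = d")
    case True
    then show ?thesis using t by (simp add: perm_action_def permute_list_compose)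
  next
    case False
    then show ?thesis using tensors_support[OF T] by (simp add: perm_action_def)
  qed
qed

lemma tensor_map_perm_action:
  assumes A: "clinear A" and s: "s permutes {..<d}" and T: "T \<in> tensors W d"
  shows "tensor_map A (perm_action s T) = perm_action s (tensor_map A T)"
proof (rule tensors_eqI[OF tlinear_compose[OF tensor_map_tlinear perm_action_tlinear]
        tlinear_compose[OF perm_action_tlinear tensor_map_tlinear] T])
  fix xs assume "length xs = d" "set xs \<subseteq> W"
  then show "tensor_map A (perm_action s (elem_tensor xs)) = perm_action s (tensor_map A (elem_tensor xs))"
    using permutes_inv[OF s]
    by (simp add: tensor_map_elem[OF A] perm_action_elem[OF s] permute_list_map)
qed

lemma contraction_tlinear: "tlinear (contraction Q a b)"
  by (rule tlinearI) (simp_all add: contraction_def fun_eq_iff tscale_def algebra_simps sum.distrib sum_distrib_left)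

lemma contraction_elem:
  assumes xs: "xs = us @ [x] @ ms @ [y] @ zs" and a: "length us = a" and b: "b = Suc (a + length ms)"
  shows "contraction Q a b (elem_tensor xs) = tscale (bform Q x y) (elem_tensor (us @ ms @ zs))"
proof
  fix i
  show "contraction Q a b (elem_tensor xs) i = tscale (bform Q x y) (elem_tensor (us @ ms @ zs)) i"
  proof (cases "length i = length us + length ms + length zs")
    case True
    define i1 i2 i3 where "i1 = take a i" and "i2 = take (length ms) (drop a i)"
      and "i3 = drop (length ms) (drop a i)"
    have i: "i = i1 @ i2 @ i3" and len: "length i1 = length us" "length i2 = length ms"
      using True a append_take_drop_id[of a i] append_take_drop_id[of "length ms" "drop a i"]
      by (simp_all del: append_take_drop_id add: i1_def i2_def i3_def)
    have ins: "insert_at b q (insert_at a p i) = i1 @ [p] @ i2 @ [q] @ i3" for p q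
      using len a b unfolding i by (simp add: insert_at_def)
    have "elem_tensor xs (insert_at b q (insert_at a p i)) = elem_tensor (us @ ms @ zs) i * (x $ p * y $ q)" for p q
      unfolding ins xs using len
      by (simp only: i elem_tensor_append) (simp add: elem_tensor_Cons elem_tensor_append)
    then show ?thesis
      by (simp add: contraction_def tscale_def bform_def sum_distrib_left sum_distrib_right ac_simps)
  next
    case False
    have "length (insert_at c q j) = Suc (length j)" for c q and j :: "'a list"
      by (auto simp: insert_at_def min_def)
    then have "length (insert_at b q (insert_at a p i)) = Suc (Suc (length i))" for p q
      by simp
    then show ?thesis
      using False xs by (simp add: contraction_def elem_tensor_def tscale_def)
  qed
qed

lemma tensor_map_contraction:
  assumes A: "clinear A" and isometry: "\<And>x y. x \<in> W \<Longrightarrow> y \<in> W \<Longrightarrow> bform Q (A x) (A y) = bform Q x y"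
    and ab: "a < b" "b < d" and T: "T \<in> tensors W d"
  shows "contraction Q a b (tensor_map A T) = tensor_map A (contraction Q a b T)"
proof (rule tensors_eqI[OF tlinear_compose[OF contraction_tlinear tensor_map_tlinear]
      tlinear_compose[OF tensor_map_tlinear contraction_tlinear] T])
  fix xs assume xs: "length xs = d" "set xs \<subseteq> W"
  define us ms zs where "us = take a xs" and "ms = take (b - Suc a) (drop (Suc a) xs)"
    and "zs = drop (Suc b) xs"
  have "xs = us @ xs ! a # drop (Suc a) xs"
    unfolding us_def using ab xs by (simp add: id_take_nth_drop)
  also have "drop (Suc a) xs = ms @ drop (b - Suc a) (drop (Suc a) xs)"
    unfolding ms_def by (rule append_take_drop_id[symmetric])
  also have "drop (b - Suc a) (drop (Suc a) xs) = drop b xs"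
    using ab by simp
  also have "\<dots> = xs ! b # zs"
    unfolding zs_def using ab xs by (simp add: Cons_nth_drop_Suc)
  finally have split: "xs = us @ [xs ! a] @ ms @ [xs ! b] @ zs" by simp
  have len: "length us = a" "b = Suc (a + length ms)"
    using ab xs by (simp_all add: us_def ms_def)
  have "map A xs = map A us @ [A (xs ! a)] @ map A ms @ [A (xs ! b)] @ map A zs"
    by (subst split) simp
  then have "contraction Q a b (tensor_map A (elem_tensor xs))
      = tscale (bform Q (A (xs ! a)) (A (xs ! b))) (elem_tensor (map A (us @ ms @ zs)))"
    using len by (simp add: tensor_map_elem[OF A] contraction_elem)
  also have "bform Q (A (xs ! a)) (A (xs ! b)) = bform Q (xs ! a) (xs ! b)"
    using xs ab by (intro isometry) (auto intro: subsetD[OF xs(2)])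
  finally show "contraction Q a b (tensor_map A (elem_tensor xs)) = tensor_map A (contraction Q a b (elem_tensor xs))"
    using contraction_elem[OF split len]
    by (simp add: tlinear_simps[OF tensor_map_tlinear] tensor_map_elem[OF A])
qed

section \<open>Symmetrizers and orthogonal Schur functors\<close>

definition col_antisymmetrize :: "nat list \<Rightarrow> 'n tensor \<Rightarrow> 'n tensor" where
  "col_antisymmetrize lam T =
     (\<Sum>t\<in>column_subgroup lam. tscale (of_int (sign t)) (perm_action t T))"

definition row_symmetrize :: "nat list \<Rightarrow> 'n tensor \<Rightarrow> 'n tensor" where
  "row_symmetrize lam T = (\<Sum>s\<in>row_subgroup lam. perm_action s T)"

lemma young_symmetrizer_eq: "young_symmetrizer lam T = col_antisymmetrize lam (row_symmetrize lam T)"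
  by (simp add: young_symmetrizer_def col_antisymmetrize_def row_symmetrize_def)

lemma col_antisymmetrize_tlinear: "tlinear (col_antisymmetrize lam)"
  unfolding col_antisymmetrize_def by (intro tlinear_sum tlinear_scale perm_action_tlinear)

lemma row_symmetrize_tlinear: "tlinear (row_symmetrize lam)"
  unfolding row_symmetrize_def by (intro tlinear_sum perm_action_tlinear)

lemma young_symmetrizer_tlinear: "tlinear (young_symmetrizer lam)"
  unfolding young_symmetrizer_eq
  by (rule tlinear_compose[OF col_antisymmetrize_tlinear row_symmetrize_tlinear])

lemma column_permutes: "t \<in> column_subgroup lam \<Longrightarrow> t permutes {..<sum_list lam}"
  and row_permutes: "s \<in> row_subgroup lam \<Longrightarrow> s permutes {..<sum_list lam}"
  by (simp_all add: column_subgroup_def row_subgroup_def)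

lemma col_antisymmetrize_closed:
  assumes R: "tens.subspace R"
    and perm: "\<And>t T. t permutes {..<sum_list lam} \<Longrightarrow> T \<in> R \<Longrightarrow> perm_action t T \<in> R" and T: "T \<in> R"
  shows "col_antisymmetrize lam T \<in> R"
  unfolding col_antisymmetrize_def
  using perm column_permutes T by (intro tens.subspace_sum[OF R] tens.subspace_scale[OF R]) blast

lemma row_symmetrize_closed:
  assumes R: "tens.subspace R"
    and perm: "\<And>t T. t permutes {..<sum_list lam} \<Longrightarrow> T \<in> R \<Longrightarrow> perm_action t T \<in> R" and T: "T \<in> R"
  shows "row_symmetrize lam T \<in> R"
  unfolding row_symmetrize_def using perm row_permutes T by (intro tens.subspace_sum[OF R]) blast

lemma col_antisymmetrize_tensors:
  "T \<in> tensors W (sum_list lam) \<Longrightarrow> col_antisymmetrize lam T \<in> tensors W (sum_list lam)"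
  by (rule col_antisymmetrize_closed[OF tensors_closed(1)]) (auto intro: perm_action_tensors)

lemma row_symmetrize_tensors:
  "T \<in> tensors W (sum_list lam) \<Longrightarrow> row_symmetrize lam T \<in> tensors W (sum_list lam)"
  by (rule row_symmetrize_closed[OF tensors_closed(1)]) (auto intro: perm_action_tensors)

lemma tensor_map_young_symmetrizer:
  assumes A: "clinear A" and T: "T \<in> tensors W (sum_list lam)"
  shows "tensor_map A (young_symmetrizer lam T) = young_symmetrizer lam (tensor_map A T)"
proof -
  have row: "tensor_map A (row_symmetrize lam T) = row_symmetrize lam (tensor_map A T)"
    unfolding row_symmetrize_def tlinear_simps(5)[OF tensor_map_tlinear]
    using tensor_map_perm_action[OF A row_permutes T] by (intro sum.cong) auto
  have "tensor_map A (col_antisymmetrize lam U) = col_antisymmetrize lam (tensor_map A U)"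
    if "U \<in> tensors W (sum_list lam)" for U
    unfolding col_antisymmetrize_def tlinear_simps(5)[OF tensor_map_tlinear]
      tlinear_simps(2)[OF tensor_map_tlinear]
    using tensor_map_perm_action[OF A column_permutes that] by (intro sum.cong) auto
  then show ?thesis
    unfolding young_symmetrizer_eq using row row_symmetrize_tensors[OF T] by simp
qed

lemma traceless_subspace: "tens.subspace (traceless Q W d)"
proof -
  have "tens.subspace {T. contraction Q a b T \<in> rad_tensors Q W (d - 2)}" for a b
    by (intro subspace_vimage_tlinear contraction_tlinear tensors_closed)
  moreover have "traceless Q W d = tensors W d \<inter>
      (\<Inter>(a, b) \<in> {(a, b). a < b \<and> b < d}. {T. contraction Q a b T \<in> rad_tensors Q W (d - 2)})"
    unfolding traceless_def by auto
  ultimately show ?thesis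
    using tensors_closed(1) by (auto intro!: tens.subspace_inter tens.subspace_Inter)
qed

lemma schur_subspace: "tens.subspace (schur Q W lam)"
proof (rule tens.subspaceI)
  let ?d = "sum_list lam"
  note tr = tens.subspace_0[OF traceless_subspace[of Q W ?d]] tens.subspace_add[OF traceless_subspace[of Q W ?d]]
    tens.subspace_scale[OF traceless_subspace[of Q W ?d]]
  note rad = tens.subspace_0[OF tensors_closed(2)[of Q W ?d]] tens.subspace_add[OF tensors_closed(2)[of Q W ?d]]
    tens.subspace_scale[OF tensors_closed(2)[of Q W ?d]]
  note Y = tlinear_simps[OF young_symmetrizer_tlinear[of lam]]
  have "young_symmetrizer lam 0 + 0 \<in> schur Q W lam"
    unfolding schur_def using tr(1) rad(1) by blast
  then show "0 \<in> schur Q W lam" by (metis Y(4) add.right_neutral)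
  fix x y assume "x \<in> schur Q W lam" "y \<in> schur Q W lam"
  then obtain T T' S S' where *: "x = young_symmetrizer lam T + S" "y = young_symmetrizer lam T' + S'"
    "T \<in> traceless Q W ?d" "T' \<in> traceless Q W ?d" "S \<in> rad_tensors Q W ?d" "S' \<in> rad_tensors Q W ?d"
    unfolding schur_def by blast
  have "x + y = young_symmetrizer lam (T + T') + (S + S')"
    unfolding * Y(1) by (simp only: add.assoc add.left_commute)
  then show "x + y \<in> schur Q W lam"
    unfolding schur_def using tr(2)[OF *(3,4)] rad(2)[OF *(5,6)] by blast
next
  let ?d = "sum_list lam"
  fix c x assume "x \<in> schur Q W lam"
  then obtain T S where *: "x = young_symmetrizer lam T + S" "T \<in> traceless Q W ?d" "S \<in> rad_tensors Q W ?d"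
    unfolding schur_def by blast
  have "tscale c x = young_symmetrizer lam (tscale c T) + tscale c S"
    unfolding * tlinear_simps(2)[OF young_symmetrizer_tlinear] by (rule tens.scale_right_distrib)
  then show "tscale c x \<in> schur Q W lam"
    unfolding schur_def using tens.subspace_scale[OF traceless_subspace *(2)]
      tens.subspace_scale[OF tensors_closed(2) *(3)] by blast
qed

lemma schur_cases:
  assumes "T \<in> schur Q W lam"
  obtains U S where "T = col_antisymmetrize lam U + S" "U \<in> tensors W (sum_list lam)"
    "S \<in> rad_tensors Q W (sum_list lam)"
  using assms row_symmetrize_tensors unfolding schur_def young_symmetrizer_eq traceless_def by blast

lemma schur_subset_tensors: "schur Q W lam \<subseteq> tensors W (sum_list lam)"
proof
  fix T assume "T \<in> schur Q W lam"
  then obtain U S where "T = col_antisymmetrize lam U + S" "U \<in> tensors W (sum_list lam)"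
    "S \<in> rad_tensors Q W (sum_list lam)"
    by (rule schur_cases)
  then show "T \<in> tensors W (sum_list lam)"
    using col_antisymmetrize_tensors rad_subset_tensors tens.subspace_add[OF tensors_closed(1)] by blast
qed

lemma rad_tensors_nondegenerate:
  assumes "\<And>x. x \<in> W \<Longrightarrow> x \<in> perp Q W \<Longrightarrow> x = 0"
  shows "rad_tensors Q W d = {0}"
proof -
  have "{elem_tensor xs | xs. length xs = d \<and> set xs \<subseteq> W \<and> set xs \<inter> perp Q W \<noteq> {}} \<subseteq> {0}"
    using assms by (auto intro!: elem_tensor_zero)
  then have "rad_tensors Q W d \<subseteq> {0}"
    unfolding rad_tensors_def by (intro tens.span_minimal tens.subspace_single_0)
  then show ?thesis
    using tens.subspace_0[OF tensors_closed(2)] by blast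
qed

text \<open>
  Since \<open>W\<close> is nondegenerate, the contractions of a traceless tensor over \<open>W\<close> vanish, and so do those
  of its image, because contractions commute with isometries.
\<close>

lemma tensor_map_schur:
  assumes A: "clinear A" "A ` W \<subseteq> W'"
    and isometry: "\<And>x y. x \<in> W \<Longrightarrow> y \<in> W \<Longrightarrow> bform Q (A x) (A y) = bform Q x y"
    and W: "\<And>x. x \<in> W \<Longrightarrow> x \<in> perp Q W \<Longrightarrow> x = 0" and T: "T \<in> schur Q W lam"
  shows "tensor_map A T \<in> schur Q W' lam"
proof -
  obtain U where U: "T = young_symmetrizer lam U" "U \<in> traceless Q W (sum_list lam)"
    using T rad_tensors_nondegenerate[OF W] unfolding schur_def by auto
  have "contraction Q a b (tensor_map A U) \<in> rad_tensors Q W' (sum_list lam - 2)"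
    if ab: "a < b" "b < sum_list lam" for a b
  proof -
    have "contraction Q a b U = 0"
      using U(2) ab rad_tensors_nondegenerate[OF W] unfolding traceless_def by blast
    then have "contraction Q a b (tensor_map A U) = 0"
      using tensor_map_contraction[where T = U and W = W, OF A(1) isometry ab] U(2)
      unfolding traceless_def by (simp add: tlinear_simps(4)[OF tensor_map_tlinear])
    then show ?thesis
      using tens.subspace_0[OF tensors_closed(2)] by metis
  qed
  then have "tensor_map A U \<in> traceless Q W' (sum_list lam)"
    using U(2) tensor_map_tensors[OF A] unfolding traceless_def by blast
  moreover have "tensor_map A T = young_symmetrizer lam (tensor_map A U) + 0"
    using U tensor_map_young_symmetrizer[OF A(1)] unfolding traceless_def by auto
  ultimately show ?thesis
    unfolding schur_def using tens.subspace_0[OF tensors_closed(2)] by blast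
qed

subsection \<open>The columns of the tableau\<close>

definition tableau_column :: "nat list \<Rightarrow> nat \<Rightarrow> nat set" where
  "tableau_column lam c = {col_tableau lam r c | r. r < col_len lam c}"

lemma tableau_column_eq: "tableau_column lam c = {sum (col_len lam) {..<c}..<sum (col_len lam) {..<Suc c}}"
proof -
  have "tableau_column lam c = (\<lambda>r. sum (col_len lam) {..<c} + r) ` {..<col_len lam c}"
    unfolding tableau_column_def col_tableau_def by auto
  then show ?thesis
    by (simp add: lessThan_atLeast0 add.commute)
qed

lemma columns_disjoint:
  assumes "i \<in> tableau_column lam c" "i \<in> tableau_column lam c'"
  shows "c = c'"
proof -
  have mono: "sum (col_len lam) {..<Suc c} \<le> sum (col_len lam) {..<c'}" if "c < c'" for c c'
    using that by (intro sum_mono2) auto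
  show ?thesis
    using assms mono[of c c'] mono[of c' c] unfolding tableau_column_eq
    by (cases c c' rule: linorder_cases) auto
qed

lemma sum_col_len:
  assumes "is_partition n lam" "n > 0"
  shows "sum (col_len lam) {..<lam ! 0} = sum_list lam"
proof -
  have le: "lam ! r \<le> lam ! 0" if "r < length lam" for r
    using assms that unfolding is_partition_def
    by (cases "r = 0") (auto simp: sorted_wrt_iff_nth_less)
  have "sum (col_len lam) {..<lam ! 0} = (\<Sum>c<lam ! 0. \<Sum>r<length lam. if c < lam ! r then 1 else 0)"
    by (simp add: col_len_def sum.If_cases Int_def)
  also have "\<dots> = (\<Sum>r<length lam. \<Sum>c<lam ! 0. if c < lam ! r then 1 else 0)"
    by (rule sum.swap)
  also have "\<dots> = (\<Sum>r<length lam. lam ! r)"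
  proof (rule sum.cong[OF refl])
    fix r assume "r \<in> {..<length lam}"
    then have "{..<lam ! 0} \<inter> {c. c < lam ! r} = {..<lam ! r}" using le by force
    then show "(\<Sum>c<lam ! 0. if c < lam ! r then 1 else 0) = lam ! r"
      by (simp add: sum.If_cases)
  qed
  finally show ?thesis by (simp add: sum_list_sum_nth atLeast0LessThan)
qed

lemma box_in_column:
  assumes "is_partition n lam" "n > 0" and "i < sum_list lam"
  obtains c where "c < lam ! 0" "i \<in> tableau_column lam c"
proof -
  have "i < sum (col_len lam) {..<k} \<Longrightarrow> \<exists>c<k. i \<in> tableau_column lam c" for k
  proof (induction k)
    case (Suc k)
    show ?case
    proof (cases "i < sum (col_len lam) {..<k}")
      case True
      then show ?thesis using Suc.IH less_SucI by blast
    next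
      case False
      then show ?thesis using Suc.prems unfolding tableau_column_eq by auto
    qed
  qed simp
  then show ?thesis using that assms sum_col_len[OF assms(1,2)] by metis
qed

text \<open>There are \<open>\<lambda>\<^sub>1\<close> columns, so more than \<open>\<lambda>\<^sub>1\<close> positions cannot lie in different columns. This is
  the source of the bounds on the levels of the filtration.\<close>

lemma boxes_in_common_column:
  assumes lam: "is_partition n lam" "n > 0" and X: "X \<subseteq> {..<sum_list lam}" "card X > lam ! 0"
  obtains a b c where "a \<in> X" "b \<in> X" "a \<noteq> b" "a \<in> tableau_column lam c" "b \<in> tableau_column lam c"
proof -
  have "\<forall>i\<in>X. \<exists>c<lam ! 0. i \<in> tableau_column lam c"
    using box_in_column[OF lam] X(1) by (metis lessThan_iff subsetD)
  then obtain c where c: "\<And>i. i \<in> X \<Longrightarrow> c i < lam ! 0 \<and> i \<in> tableau_column lam (c i)" by metis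
  then have "card (c ` X) \<le> card {..<lam ! 0}"
    by (intro card_mono) auto
  then have "\<not> inj_on c X"
    using X pigeonhole[of c X] by simp
  then obtain a b where "a \<in> X" "b \<in> X" "a \<noteq> b" "c a = c b"
    unfolding inj_on_def by blast
  then show ?thesis using that c by metis
qed

context
  fixes lam :: "nat list" and a b c :: nat
  assumes ab: "a \<noteq> b" "a \<in> tableau_column lam c" "b \<in> tableau_column lam c"
    and bound: "a < sum_list lam" "b < sum_list lam"
begin

lemma transpose_permutes_boxes: "Transposition.transpose a b permutes {..<sum_list lam}"
  using bound by (intro permutes_swap_id) auto

lemma transpose_column: "Transposition.transpose a b ` tableau_column lam c' = tableau_column lam c'"
proof (cases "c' = c")
  case True
  then show ?thesis using ab transpose_image_eq[of a "tableau_column lam c" b] by simp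
next
  case False
  then have "a \<notin> tableau_column lam c'" "b \<notin> tableau_column lam c'"
    using ab columns_disjoint by blast+
  then show ?thesis by (simp add: transpose_image_eq)
qed

lemma column_subgroup_transpose:
  assumes "t \<in> column_subgroup lam"
  shows "t \<circ> Transposition.transpose a b \<in> column_subgroup lam" "Transposition.transpose a b \<circ> t \<in> column_subgroup lam"
  using assms transpose_permutes_boxes transpose_column
  unfolding column_subgroup_def tableau_column_def[symmetric]
  by (simp_all only: mem_Collect_eq image_comp[symmetric]) (simp_all add: permutes_compose)

lemma sign_compose_transpose:
  assumes "t \<in> column_subgroup lam"
  shows "sign (t \<circ> Transposition.transpose a b) = - sign t" "sign (Transposition.transpose a b \<circ> t) = - sign t"
proof -
  have "permutation t"
    using column_permutes[OF assms] finite_lessThan permutation_permutes by blast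
  then show "sign (t \<circ> Transposition.transpose a b) = - sign t" "sign (Transposition.transpose a b \<circ> t) = - sign t"
    using ab(1) by (simp_all add: sign_compose permutation_swap_id sign_swap_id)
qed

text \<open>Multiplication by the transposition is a sign-reversing bijection of the column subgroup.\<close>

lemma col_antisymmetrize_transpose:
  assumes T: "T \<in> tensors W (sum_list lam)"
  shows "col_antisymmetrize lam (perm_action (Transposition.transpose a b) T) = - col_antisymmetrize lam T"
    and "perm_action (Transposition.transpose a b) (col_antisymmetrize lam T) = - col_antisymmetrize lam T"
proof -
  let ?C = "column_subgroup lam" and ?\<tau> = "Transposition.transpose a b"
  note comp = perm_action_compose[OF _ _ T]
  have neg: "tscale (of_int (- k)) U = - tscale (of_int k) U" for k :: int and U :: "'n tensor"
    by (simp add: tens.scale_minus_left)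
  have "col_antisymmetrize lam (perm_action ?\<tau> T)
      = (\<Sum>t\<in>?C. tscale (of_int (sign t)) (perm_action (t \<circ> ?\<tau>) T))"
    unfolding col_antisymmetrize_def
    using comp[OF column_permutes transpose_permutes_boxes] by (intro sum.cong) auto
  also have "\<dots> = (\<Sum>t\<in>?C. tscale (of_int (sign (t \<circ> ?\<tau>))) (perm_action t T))"
    by (rule sum.reindex_bij_witness[of _ "\<lambda>t. t \<circ> ?\<tau>" "\<lambda>t. t \<circ> ?\<tau>"])
      (auto simp: column_subgroup_transpose comp_assoc)
  also have "\<dots> = (\<Sum>t\<in>?C. - tscale (of_int (sign t)) (perm_action t T))"
    by (intro sum.cong refl) (simp only: sign_compose_transpose neg)
  finally show "col_antisymmetrize lam (perm_action ?\<tau> T) = - col_antisymmetrize lam T"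
    unfolding col_antisymmetrize_def sum_negf .
  have "perm_action ?\<tau> (col_antisymmetrize lam T)
      = (\<Sum>t\<in>?C. tscale (of_int (sign t)) (perm_action (?\<tau> \<circ> t) T))"
    unfolding col_antisymmetrize_def tlinear_simps(5)[OF perm_action_tlinear]
      tlinear_simps(2)[OF perm_action_tlinear]
    using comp[OF transpose_permutes_boxes column_permutes] by (intro sum.cong) auto
  also have "\<dots> = (\<Sum>t\<in>?C. tscale (of_int (sign (?\<tau> \<circ> t))) (perm_action t T))"
    by (rule sum.reindex_bij_witness[of _ "\<lambda>t. ?\<tau> \<circ> t" "\<lambda>t. ?\<tau> \<circ> t"])
      (auto simp: column_subgroup_transpose comp_assoc[symmetric])
  also have "\<dots> = (\<Sum>t\<in>?C. - tscale (of_int (sign t)) (perm_action t T))"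
    by (intro sum.cong refl) (simp only: sign_compose_transpose neg)
  finally show "perm_action ?\<tau> (col_antisymmetrize lam T) = - col_antisymmetrize lam T"
    unfolding col_antisymmetrize_def sum_negf .
qed

lemma tensor_eq_minus_self: "(T :: 'n tensor) = - T \<Longrightarrow> T = 0"
  by (simp add: fun_eq_iff)

lemma perm_action_transpose_elem:
  assumes "length xs = sum_list lam" "xs ! a = xs ! b"
  shows "perm_action (Transposition.transpose a b) (elem_tensor xs) = elem_tensor xs"
proof -
  have "permute_list (Transposition.transpose a b) xs = xs"
    using assms bound transpose_permutes_boxes
    by (intro nth_equalityI) (auto simp: permute_list_nth Transposition.transpose_def)
  then show ?thesis
    using perm_action_elem[OF transpose_permutes_boxes assms(1)] by simp
qed

lemma col_antisymmetrize_repeated: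
  assumes "length xs = sum_list lam" "xs ! a = xs ! b"
  shows "col_antisymmetrize lam (elem_tensor xs) = 0"
  using col_antisymmetrize_transpose(1)[OF elem_in_tensors[OF assms(1) subset_UNIV]]
    perm_action_transpose_elem[OF assms] tensor_eq_minus_self by metis

end

section \<open>The filtration of the fiber at a point\<close>

text \<open>The pairing of tensors with lists of vectors through the form will be used to detect tensors
  modulo the radical.\<close>

definition covector :: "int^'n^'n \<Rightarrow> complex^'n \<Rightarrow> complex^'n" where
  "covector Q y = (\<chi> h. bform Q (axis h 1) y)"

definition tensor_pairing :: "int^'n^'n \<Rightarrow> 'n tensor \<Rightarrow> (complex^'n) list \<Rightarrow> complex" where
  "tensor_pairing Q T ys =
     (\<Sum>i | length i = length ys. T i * elem_tensor (map (covector Q) ys) i)"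

lemma covector_clinear: "clinear (covector Q)"
  by (rule clinearI) (simp_all add: covector_def bform_linear vec_eq_iff)

lemma tensor_pairing_tfunctional: "tfunctional (\<lambda>T. tensor_pairing Q T ys)"
  by (rule tfunctionalI)
    (simp_all add: tensor_pairing_def tscale_def algebra_simps sum.distrib sum_distrib_left)

context isotropic_plane
begin

lemma bform_covector: "bform Q x y = (\<Sum>h\<in>UNIV. x $ h * covector Q y $ h)"
  using bform_expand[of Q y x] by (simp add: covector_def commute[of y])

lemma tensor_pairing_elem:
  assumes "length xs = length ys"
  shows "tensor_pairing Q (elem_tensor xs) ys = (\<Prod>j<length ys. bform Q (xs ! j) (ys ! j))"
proof -
  have "tensor_pairing Q (elem_tensor xs) ys
      = (\<Sum>i | length i = length ys. \<Prod>j<length ys. (xs ! j) $ (i ! j) * covector Q (ys ! j) $ (i ! j))"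
    unfolding tensor_pairing_def
    using assms by (intro sum.cong refl) (simp add: elem_tensor_def prod.distrib)
  then show ?thesis by (subst (asm) sum_lists_prod) (simp add: bform_covector)
qed

end

text \<open>A point of the domain is given by an adapted frame whose second vector spans it.\<close>

locale filtered_fiber = isotropic_plane Q a b
  for Q :: "int^'n^'n" and a b :: "complex^'n" +
  fixes J :: "(complex^'n) set" and P :: "'n frame"
  assumes span_J: "vec.span J = vec.span {a, b}" and P: "adapted Q a b P"
begin

definition point :: "(complex^'n) set" where "point = line (fr_e' P)"

text \<open>Up to the radical, the fiber is the sum of its parts of weights \<open>1\<close>, \<open>-1\<close> and \<open>0\<close>, which split
  the filtration and are spanned by \<open>v\<close>, by \<open>l\<close> and by the complement of the quadruple.\<close>

definition weight_vectors :: "(complex^'n) set" where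
  "weight_vectors = insert (fr_v P) (insert (fr_l P) (range (core Q P)))"

lemmas gram = adapted_gram[OF P] bform_core[OF P]

lemma point_iff: "x \<in> point \<longleftrightarrow> (\<exists>c. x = c *s fr_e' P)"
  by (auto simp: point_def line_def vec.span_singleton)

lemma perp_point_iff: "x \<in> perp Q point \<longleftrightarrow> bform Q x (fr_e' P) = 0"
proof -
  have "fr_e' P \<in> point" using point_iff by (metis vec.scale_one)
  then show ?thesis by (auto simp: perp_def point_iff bform_linear)
qed

lemma perp_perp_point_iff: "x \<in> perp Q (perp Q point) \<longleftrightarrow> x \<in> point"
proof
  assume x: "x \<in> perp Q (perp Q point)"
  have "bform Q (x - bform Q x (fr_e P) *s fr_e' P) y = 0" for y
  proof -
    have "y - bform Q y (fr_e' P) *s fr_e P \<in> perp Q point"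
      by (simp add: perp_point_iff bform_linear gram)
    then have "bform Q x (y - bform Q y (fr_e' P) *s fr_e P) = 0"
      using x unfolding perp_def by blast
    then show ?thesis by (simp add: bform_linear commute[of y "fr_e' P"])
  qed
  then have "x = bform Q x (fr_e P) *s fr_e' P"
    using nondegenerate[of "x - bform Q x (fr_e P) *s fr_e' P"] by simp
  then show "x \<in> point" using point_iff by blast
next
  assume "x \<in> point"
  then obtain c where "x = c *s fr_e' P" using point_iff by blast
  then show "x \<in> perp Q (perp Q point)"
    unfolding perp_def[of Q "perp Q point"] using perp_point_iff
    by (simp add: bform_linear commute[of "fr_e' P"])
qed

lemma point_subset_perp: "point \<subseteq> perp Q point"
  unfolding subset_iff point_iff perp_point_iff by (auto simp: bform_linear gram)

abbreviation EF :: "int \<Rightarrow> (complex^'n) set" where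
  "EF \<equiv> E_filtration Q J point"

abbreviation fiber_radical :: "nat \<Rightarrow> 'n tensor set" where
  "fiber_radical \<equiv> rad_tensors Q (perp Q point)"

abbreviation fiber_filtration :: "nat \<Rightarrow> int \<Rightarrow> 'n tensor set" where
  "fiber_filtration \<equiv> tensor_filtration Q J point"

lemma E_filtration_one: "x \<in> EF 1 \<longleftrightarrow> (\<exists>c d. x = c *s fr_v P + d *s fr_e' P)"
proof -
  have "(perp Q point \<inter> vec.span J) \<union> point \<subseteq> vec.span {fr_v P, fr_e' P}"
  proof
    fix x assume "x \<in> (perp Q point \<inter> vec.span J) \<union> point"
    moreover have "x = bform Q x (fr_l P) *s fr_v P" if "x \<in> perp Q point" "x \<in> vec.span J"
      using that plane_adapted[OF P, of x] unfolding plane_def span_J perp_point_iff by simp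
    ultimately have "x \<in> point \<or> x = bform Q x (fr_l P) *s fr_v P"
      by blast
    then show "x \<in> vec.span {fr_v P, fr_e' P}"
      unfolding point_iff by (metis insertCI vec.span_base vec.span_scale)
  qed
  moreover have "fr_v P \<in> perp Q point \<inter> vec.span J"
    using adapted_in_plane[OF P] unfolding plane_def span_J by (simp add: perp_point_iff gram)
  moreover have "fr_e' P \<in> point" using point_iff by (metis vec.scale_one)
  ultimately have "vec.span ((perp Q point \<inter> vec.span J) \<union> point) = vec.span {fr_v P, fr_e' P}"
    by (intro antisym vec.span_minimal vec.span_mono vec.subspace_span) auto
  then show ?thesis
    unfolding E_filtration_def E_J_def by (simp add: span_pair_iff)
qed

lemma E_filtration_zero:
  "x \<in> EF 0 \<longleftrightarrow> bform Q x (fr_e' P) = 0 \<and> bform Q x (fr_v P) = 0"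
proof -
  have one: "E_J Q J point = EF 1" by (simp add: E_filtration_def)
  have "fr_v P = 1 *s fr_v P + 0 *s fr_e' P" by simp
  then have v: "fr_v P \<in> E_J Q J point"
    unfolding one E_filtration_one by blast
  have "bform Q x y = 0" if "y \<in> E_J Q J point" "bform Q x (fr_e' P) = 0" "bform Q x (fr_v P) = 0" for y
    using that unfolding one E_filtration_one by (auto simp: bform_linear)
  then have "x \<in> perp Q point \<inter> perp Q (E_J Q J point) \<longleftrightarrow> bform Q x (fr_e' P) = 0 \<and> bform Q x (fr_v P) = 0"
    using v unfolding perp_def[of Q "E_J Q J point"] perp_point_iff Int_iff by blast
  then show ?thesis by (simp add: E_filtration_def)
qed

lemma E_filtration_minus_one: "EF (- 1) = perp Q point"
  by (simp add: E_filtration_def)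

lemma E_filtration_subset: "EF i \<subseteq> perp Q point"
proof -
  have "x \<in> perp Q point" if "x \<in> EF 1" for x
    using that unfolding E_filtration_one by (auto simp: perp_point_iff bform_linear gram)
  then show ?thesis
    by (cases "i = 1") (auto simp: E_filtration_def)
qed

lemma filtration_subspace: "tens.subspace (fiber_filtration d r)"
  unfolding tensor_filtration_def by (rule tens.subspace_span)

lemma rad_subset_filtration: "fiber_radical d \<subseteq> fiber_filtration d r"
  unfolding tensor_filtration_def by (auto intro: tens.span_base)

lemma elem_in_filtration:
  assumes "length xs = d" "length is = d" "set is \<subseteq> {-1, 0, 1}" "sum_list is = r"
    "\<And>j. j < d \<Longrightarrow> xs ! j \<in> EF (is ! j)"
  shows "elem_tensor xs \<in> fiber_filtration d r"
  unfolding tensor_filtration_def using assms by (intro tens.span_base) blast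

lemma filtration_imageI:
  assumes T: "T \<in> fiber_filtration d r" and F: "tlinear F" and R: "tens.subspace R"
    and rad: "\<And>xs x. length xs = d \<Longrightarrow> set xs \<subseteq> perp Q point \<Longrightarrow> x \<in> set xs \<Longrightarrow> x \<in> point \<Longrightarrow>
      F (elem_tensor xs) \<in> R"
    and elem: "\<And>xs is. length xs = d \<Longrightarrow> length is = d \<Longrightarrow> set is \<subseteq> {-1, 0, 1} \<Longrightarrow> sum_list is = r \<Longrightarrow>
      (\<And>j. j < d \<Longrightarrow> xs ! j \<in> EF (is ! j)) \<Longrightarrow> F (elem_tensor xs) \<in> R"
  shows "F T \<in> R"
proof (rule tlinear_span_image[OF F _ R T[unfolded tensor_filtration_def]])
  have "F S \<in> R" if "S \<in> fiber_radical d" for S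
  proof (rule tlinear_span_image[OF F _ R that[unfolded rad_tensors_def]])
    fix S assume "S \<in> {elem_tensor xs | xs. length xs = d \<and> set xs \<subseteq> perp Q point \<and>
        set xs \<inter> perp Q (perp Q point) \<noteq> {}}"
    then obtain xs x where "S = elem_tensor xs" "length xs = d" "set xs \<subseteq> perp Q point" "x \<in> set xs" "x \<in> point"
      using perp_perp_point_iff by blast
    then show "F S \<in> R" using rad by blast
  qed
  then show "F S \<in> R" if "S \<in> {elem_tensor xs |xs. length xs = d \<and>
         (\<exists>is. length is = d \<and> set is \<subseteq> {-1, 0, 1} \<and> sum_list is = r \<and>
            (\<forall>j<d. xs ! j \<in> EF (is ! j)))} \<union> fiber_radical d" for S
    using that elem by blast
qed

lemma elem_in_fiber_radical:
  "length xs = d \<Longrightarrow> set xs \<subseteq> perp Q point \<Longrightarrow> x \<in> set xs \<Longrightarrow> x \<in> point \<Longrightarrow>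
     elem_tensor xs \<in> fiber_radical d"
  using elem_in_rad_tensors perp_perp_point_iff by blast

lemma sum_list_raise:
  fixes js :: "int list"
  shows "k < length js \<Longrightarrow> sum_list (js[k := js ! k + 1]) = sum_list js + 1"
  by (induction js arbitrary: k) (auto split: nat.split)

text \<open>
  A map of the fiber that is block triangular for the filtration with \<open>c\<^sup>i\<close> in the block of level
  \<open>i\<close> acts on the graded quotient of level \<open>r\<close> of a tensor power as \<open>c\<^sup>r\<close>: exchanging the factors
  one at a time raises the level by one each time.
\<close>

lemma filtration_shift:
  assumes H: "clinear H" and c: "c \<noteq> 0"
    and one: "\<And>x. x \<in> EF 1 \<Longrightarrow> H x - c *s x \<in> point"
    and zero: "\<And>x. x \<in> EF 0 \<Longrightarrow> H x - x \<in> EF 1"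
    and minus_one: "\<And>x. x \<in> perp Q point \<Longrightarrow> H x - (1 / c) *s x \<in> EF 0"
    and T: "T \<in> fiber_filtration d r"
  shows "tensor_map H T - tscale (c powi r) T \<in> fiber_filtration d (r + 1)"
proof (rule filtration_imageI[OF T tlinear_diff[OF tensor_map_tlinear tlinear_scale[OF tlinear_id]] filtration_subspace])
  have subspace: "vec.subspace (perp Q point)"
    by (rule vec.subspaceI) (auto simp: perp_point_iff bform_linear)
  have H_perp: "H x \<in> perp Q point" if "x \<in> perp Q point" for x
  proof -
    have "(H x - (1 / c) *s x) + (1 / c) *s x \<in> perp Q point"
      using minus_one[OF that] E_filtration_subset that
      by (intro vec.subspace_add[OF subspace] vec.subspace_scale[OF subspace]) auto
    then show ?thesis by simp
  qed
  show "tensor_map H (elem_tensor xs) - tscale (c powi r) (elem_tensor xs) \<in> fiber_filtration d (r + 1)"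
    if xs: "length xs = d" "set xs \<subseteq> perp Q point" "x \<in> set xs" "x \<in> point" for xs x
  proof -
    obtain k where k: "x = k *s fr_e' P" using xs(4) point_iff by blast
    have "x \<in> EF 1"
      unfolding E_filtration_one k by (metis add_0 vec.scale_zero_left)
    then have "H x - c *s x \<in> point" by (rule one)
    then obtain k' where "H x - c *s x = k' *s fr_e' P" using point_iff by blast
    then have "H x = (k' + c * k) *s fr_e' P"
      unfolding k by (simp add: vec.scale_left_distrib algebra_simps)
    then have "H x \<in> point" using point_iff by blast
    then have "elem_tensor (map H xs) \<in> fiber_radical d"
      using xs H_perp by (intro elem_in_fiber_radical[of _ _ "H x"]) auto
    moreover have "elem_tensor xs \<in> fiber_radical d"
      using xs by (rule elem_in_fiber_radical)
    ultimately have "tensor_map H (elem_tensor xs) - tscale (c powi r) (elem_tensor xs)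
        \<in> fiber_radical d"
      unfolding tensor_map_elem[OF H]
      by (intro tens.subspace_diff[OF tensors_closed(2)] tens.subspace_scale[OF tensors_closed(2)])
    then show ?thesis using rad_subset_filtration by blast
  qed
  fix xs js
  assume xs: "length xs = d" and js: "length js = d" "set js \<subseteq> {-1, 0, 1}" "sum_list js = r"
    and E: "\<And>j. j < d \<Longrightarrow> xs ! j \<in> EF (js ! j)"
  have E_perp: "xs ! j \<in> perp Q point" if "j < d" for j
    using E[OF that] E_filtration_subset by blast
  have js_j: "js ! j \<in> {-1, 0, 1}" if "j < d" for j
    using js that by (metis nth_mem subsetD)
  have E_scale: "k *s x \<in> EF i" if "x \<in> EF i" "i \<in> {-1, 0, 1}" for k x i
  proof -
    have "\<exists>p q. k *s (s *s fr_v P + t *s fr_e' P) = p *s fr_v P + q *s fr_e' P" for s t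
      by (rule exI[of _ "k * s"], rule exI[of _ "k * t"]) (simp add: vec.scale_right_distrib)
    then show ?thesis
      using that by (auto simp: E_filtration_one E_filtration_zero E_filtration_minus_one
          perp_point_iff bform_linear)
  qed
  define ys where "ys = map H xs"
  define cs where "cs = map (\<lambda>i. c powi i) js"
  define zs where "zs = map2 (*s) cs xs"
  have len: "length ys = d" "length zs = d" "length cs = d"
    by (simp_all add: ys_def zs_def cs_def xs js)
  have zs: "zs ! j = c powi (js ! j) *s xs ! j" and ys: "ys ! j = H (xs ! j)" if "j < d" for j
    using that xs js by (simp_all add: zs_def cs_def ys_def)
  have H_E: "H x \<in> EF i" if x: "x \<in> EF i" and i: "i \<in> {-1, 0, 1}" for x i
  proof -
    consider "i = 1" | "i = 0" | "i = -1" using i by auto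
    then show ?thesis
    proof cases
      case 1
      obtain p q where "x = p *s fr_v P + q *s fr_e' P" using x 1 E_filtration_one by blast
      moreover obtain s where "H x - c *s x = s *s fr_e' P"
        using one x 1 point_iff by blast
      ultimately have "H x = (c * p) *s fr_v P + (c * q + s) *s fr_e' P"
        by (simp add: vec_eq_iff algebra_simps)
      then show ?thesis unfolding 1 E_filtration_one by blast
    next
      case 2
      then obtain p q where "H x - x = p *s fr_v P + q *s fr_e' P"
        using zero x E_filtration_one by blast
      then have "H x = x + p *s fr_v P + q *s fr_e' P" by (simp add: algebra_simps)
      then show ?thesis using x unfolding 2 E_filtration_zero by (simp add: bform_linear gram)
    qed (use x H_perp in \<open>simp add: E_filtration_minus_one\<close>)
  qed
  have "elem_tensor ys - elem_tensor zs \<in> fiber_filtration d (r + 1)"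
  proof (rule elem_tensor_replace[OF filtration_subspace len(1,2)])
    fix k assume k: "k < d"
    define us where "us = take k ys @ (ys ! k - zs ! k) # drop (Suc k) zs"
    have us_len: "length us = d" using k len by (simp add: us_def)
    have us: "us ! j = (if j < k then ys ! j else if j = k then ys ! k - zs ! k else zs ! j)" if "j < d" for j
      using that k len by (auto simp: us_def nth_append nth_Cons' Suc_diff_le)
    have us_E: "us ! j \<in> EF (js ! j)" if "j < d" "j \<noteq> k" for j
      using that H_E[OF E js_j] E_scale[OF E js_j] by (simp add: us ys zs)
    have us_k: "us ! k = H (xs ! k) - c powi (js ! k) *s xs ! k"
      using k by (simp add: us ys zs)
    show "elem_tensor (take k ys @ (ys ! k - zs ! k) # drop (Suc k) zs) \<in> fiber_filtration d (r + 1)"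
      unfolding us_def[symmetric]
    proof (cases "js ! k = 1")
      case True
      then have pt: "us ! k \<in> point" using one E[OF k] us_k by simp
      have "us ! j \<in> perp Q point" if "j < d" for j
        using pt point_subset_perp us_E[OF that] E_filtration_subset by (cases "j = k") auto
      then have "set us \<subseteq> perp Q point" using us_len by (auto simp: in_set_conv_nth)
      moreover have "us ! k \<in> set us" using k us_len by simp
      ultimately have "elem_tensor us \<in> fiber_radical d"
        using us_len pt by (intro elem_in_fiber_radical)
      then show "elem_tensor us \<in> fiber_filtration d (r + 1)"
        using rad_subset_filtration by blast
    next
      case False
      then have ik: "js ! k = 0 \<or> js ! k = -1" using js_j[OF k] by auto
      then have raised: "us ! k \<in> EF (js ! k + 1)"
        using E[OF k] zero minus_one unfolding us_k
        by (auto simp: E_filtration_minus_one power_int_minus divide_inverse)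
      show "elem_tensor us \<in> fiber_filtration d (r + 1)"
      proof (rule elem_in_filtration[of us d "js[k := js ! k + 1]"])
        have "sum_list (js[k := js ! k + 1]) = r + 1"
          using js k by (simp add: sum_list_raise)
        then show "sum_list (js[k := js ! k + 1]) = r + 1" .
        show "set (js[k := js ! k + 1]) \<subseteq> {-1, 0, 1}"
          using ik js by (intro order_trans[OF set_update_subset_insert]) auto
        show "us ! j \<in> EF (js[k := js ! k + 1] ! j)" if "j < d" for j
          using that us_E raised js by (cases "j = k") auto
      qed (use us_len js in auto)
    qed
  qed
  moreover have "elem_tensor zs = tscale (c powi r) (elem_tensor xs)"
  proof -
    have "(\<Prod>j<length xs. cs ! j) = (\<Prod>j<length js. c powi (js ! j))"
      using xs js by (intro prod.cong) (auto simp: cs_def)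
    also have "\<dots> = c powi sum_list js"
    proof -
      have "(\<Prod>j<k. c powi (f j)) = c powi (\<Sum>j<k. f j)" for k and f :: "nat \<Rightarrow> int"
        using c by (induction k) (simp_all add: power_int_add)
      then show ?thesis by (simp add: sum_list_sum_nth atLeast0LessThan)
    qed
    finally show ?thesis
      unfolding zs_def using js(3) elem_tensor_scale[of cs xs] len(3) xs by simp
  qed
  ultimately show "tensor_map H (elem_tensor xs) - tscale (c powi r) (elem_tensor xs) \<in> fiber_filtration d (r + 1)"
    unfolding tensor_map_elem[OF H] ys_def by simp
qed

lemma filtration_decreasing:
  assumes r: "r \<ge> - int d"
  shows "fiber_filtration d (r + 1) \<subseteq> fiber_filtration d r"
proof
  fix T assume T: "T \<in> fiber_filtration d (r + 1)"
  show "T \<in> fiber_filtration d r"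
  proof (rule filtration_imageI[OF T tlinear_id filtration_subspace])
    show "elem_tensor xs \<in> fiber_filtration d r"
      if "length xs = d" "set xs \<subseteq> perp Q point" "x \<in> set xs" "x \<in> point" for xs x
      using elem_in_fiber_radical[OF that] rad_subset_filtration by blast
    fix xs js
    assume xs: "length xs = d" and js: "length js = d" "set js \<subseteq> {-1, 0, 1}" "sum_list js = r + 1"
      and E: "\<And>j. j < d \<Longrightarrow> xs ! j \<in> EF (js ! j)"
    have "\<exists>k<d. js ! k \<noteq> -1"
    proof (rule ccontr)
      assume "\<not> ?thesis"
      then have "js = replicate d (-1)" using js(1) by (intro nth_equalityI) auto
      then have "sum_list js = - int d" by (simp add: sum_list_replicate)
      then show False using js(3) r by simp
    qed
    then obtain k where k: "k < d" "js ! k \<noteq> -1" by blast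
    then have jk: "js ! k = 0 \<or> js ! k = 1" using js by (metis empty_iff insertE nth_mem subsetD)
    let ?js = "js[k := js ! k - 1]"
    have "sum_list (?js[k := ?js ! k + 1]) = sum_list ?js + 1"
      using k js by (intro sum_list_raise) simp
    then have sum: "sum_list ?js = r" using js k by simp
    have zero_sub: "EF 1 \<subseteq> EF 0"
      unfolding subset_iff E_filtration_one E_filtration_zero by (auto simp: bform_linear gram)
    show "elem_tensor xs \<in> fiber_filtration d r"
    proof (rule elem_in_filtration[of xs d ?js])
      show "set ?js \<subseteq> {-1, 0, 1}"
        using jk js by (intro order_trans[OF set_update_subset_insert]) auto
      show "xs ! j \<in> EF (?js ! j)" if "j < d" for j
      proof (cases "j = k")
        case True
        then show ?thesis
          using jk E[OF k(1)] zero_sub E_filtration_subset[of 0] js(1) k(1)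
          by (auto simp: E_filtration_minus_one)
      qed (use E[OF that] in simp)
    qed (use xs js sum in auto)
  qed
qed

subsection \<open>The levels that occur\<close>

lemma weight_expand:
  "bform Q x (fr_e' P) = 0 \<Longrightarrow> bform Q x (fr_e P) *s fr_e' P + bform Q x (fr_l P) *s fr_v P
     + bform Q x (fr_v P) *s fr_l P + core Q P x = x"
  by (simp add: core_def)

lemma perm_action_filtration:
  assumes s: "s permutes {..<d}" and T: "T \<in> fiber_filtration d r"
  shows "perm_action s T \<in> fiber_filtration d r"
proof (rule filtration_imageI[OF T perm_action_tlinear filtration_subspace])
  fix xs x assume "length xs = d" "set xs \<subseteq> perp Q point" "x \<in> set xs" "x \<in> point"
  then show "perm_action s (elem_tensor xs) \<in> fiber_filtration d r"
    using perm_action_rad_tensors[OF s elem_in_fiber_radical] rad_subset_filtration by blast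
next
  fix xs js
  assume xs: "length xs = d" and js: "length js = d" "set js \<subseteq> {-1, 0, 1}" "sum_list js = r"
    and E: "\<And>j. j < d \<Longrightarrow> xs ! j \<in> EF (js ! j)"
  let ?s = "inv_into UNIV s"
  have s': "?s permutes {..<d}" using permutes_inv[OF s] .
  have "sum_list (permute_list ?s js) = r"
    using js s' by (metis mset_permute_list sum_mset_sum_list)
  then show "perm_action s (elem_tensor xs) \<in> fiber_filtration d r"
    unfolding perm_action_elem[OF s xs]
    using s' xs js E permutes_in_image[OF s']
    by (intro elem_in_filtration[of _ _ "permute_list ?s js"]) (auto simp: permute_list_nth)
qed

text \<open>
  A tensor that is antisymmetric along the columns involves at most one factor of negative weight
  from each column.
\<close>

lemma schur_lowest_level:
  assumes lam: "is_partition n lam" "n > 0" and T: "T \<in> schur Q (perp Q point) lam"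
  shows "T \<in> fiber_filtration (sum_list lam) (- int (lam ! 0))"
proof -
  let ?d = "sum_list lam"
  let ?R = "{T. col_antisymmetrize lam T \<in> fiber_filtration ?d (- int (lam ! 0))}"
  let ?G = "insert (fr_e' P) weight_vectors"
  have R: "tens.subspace ?R"
    by (intro subspace_vimage_tlinear col_antisymmetrize_tlinear filtration_subspace)
  have G: "x \<in> perp Q point" "x = fr_l P \<or> x \<in> EF 0" if "x \<in> ?G" for x
    using that unfolding weight_vectors_def perp_point_iff E_filtration_zero by (auto simp: gram)
  have le: "lam ! 0 \<le> ?d"
    using lam member_le_sum_list[of "lam ! 0" lam] by (simp add: is_partition_def)
  have elem_R: "elem_tensor xs \<in> ?R" if len: "length xs = ?d" and xs: "\<forall>j<?d. xs ! j \<in> ?G" for xs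
  proof -
    define X where "X = {j \<in> {..<?d}. xs ! j = fr_l P}"
    show ?thesis
    proof (cases "card X \<le> lam ! 0")
      case True
      obtain Y where Y: "X \<subseteq> Y" "Y \<subseteq> {..<?d}" "card Y = lam ! 0"
        using exists_subset_between[OF True, of "{..<?d}"] le by (auto simp: X_def)
      define js where "js = map (\<lambda>j. if j \<in> Y then -1 else 0 :: int) [0..<?d]"
      have "sum_list js = (\<Sum>j<?d. if j \<in> Y then -1 else 0)"
        by (simp add: js_def interv_sum_list_conv_sum_set_nat atLeast0LessThan)
      also have "\<dots> = - int (lam ! 0)"
        using Y by (simp add: sum.If_cases Int_absorb1)
      finally have sum: "sum_list js = - int (lam ! 0)" .
      have "xs ! j \<in> EF (js ! j)" if "j < ?d" for j
        using G[of "xs ! j"] xs that Y(1) by (auto simp: js_def X_def E_filtration_minus_one)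
      then have "elem_tensor xs \<in> fiber_filtration ?d (- int (lam ! 0))"
        using sum len by (intro elem_in_filtration[of _ _ js]) (auto simp: js_def)
      then have "col_antisymmetrize lam (elem_tensor xs) \<in> fiber_filtration ?d (- int (lam ! 0))"
        by (intro col_antisymmetrize_closed[OF filtration_subspace]) (auto intro: perm_action_filtration)
      then show ?thesis by simp
    next
      case False
      then obtain a b c where "a \<in> X" "b \<in> X" "a \<noteq> b" "a \<in> tableau_column lam c" "b \<in> tableau_column lam c"
        using boxes_in_common_column[OF lam, of X] by (auto simp: X_def)
      then have "col_antisymmetrize lam (elem_tensor xs) = 0"
        using col_antisymmetrize_repeated[of a b lam c xs] len by (auto simp: X_def)
      then show ?thesis
        using tens.subspace_0[OF filtration_subspace] by auto
    qed
  qed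
  obtain U S where T: "T = col_antisymmetrize lam U + S" "U \<in> tensors (perp Q point) ?d"
    "S \<in> fiber_radical ?d"
    using T by (rule schur_cases)
  have "x \<in> vec.span ?G" if "x \<in> perp Q point" for x
    using that unfolding perp_point_iff weight_vectors_def
    by (subst weight_expand[symmetric])
      (auto intro!: vec.span_add vec.span_scale intro: vec.span_base)
  then have "\<forall>j<?d. xs ! j \<in> vec.span ?G" if "length xs = ?d" "set xs \<subseteq> perp Q point" for xs
    using that by (metis nth_mem subsetD)
  then have "elem_tensor xs \<in> ?R" if "length xs = ?d" "set xs \<subseteq> perp Q point" for xs
    using that by (intro elem_tensor_span[where S = "\<lambda>_. ?G", OF R elem_R]) blast+
  then have "U \<in> ?R"
    using tensors_imageI[OF tlinear_id R T(2)] by simp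
  moreover have "S \<in> fiber_filtration ?d (- int (lam ! 0))"
    using T(3) rad_subset_filtration by blast
  ultimately show ?thesis
    unfolding T(1) using tens.subspace_add[OF filtration_subspace] by blast
qed

lemma fiber_radical_pairing:
  assumes "length ys = d" "set ys \<subseteq> weight_vectors" and "length xs = d" "x \<in> set xs" "x \<in> point"
  shows "tensor_pairing Q (elem_tensor xs) ys = 0"
proof -
  obtain j c where j: "j < d" "xs ! j = c *s fr_e' P"
    using assms by (metis in_set_conv_nth point_iff)
  moreover have "ys ! j \<in> weight_vectors" using j assms by auto
  ultimately have "bform Q (xs ! j) (ys ! j) = 0"
    unfolding weight_vectors_def by (auto simp: bform_linear gram)
  then show ?thesis
    using j assms by (simp add: tensor_pairing_elem) (metis lessThan_iff prod_zero finite_lessThan)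
qed

text \<open>Among the weight vectors, only \<open>l\<close> pairs nontrivially with vectors of level \<open>1\<close>, and a tensor
  of level \<open>r\<close> has at least \<open>r\<close> factors of level \<open>1\<close> in each of its terms.\<close>

lemma filtration_pairing:
  assumes T: "T \<in> fiber_filtration d r" and ys: "length ys = d" "set ys \<subseteq> weight_vectors"
    and few: "int (card {j. j < d \<and> ys ! j = fr_l P}) < r"
  shows "tensor_pairing Q T ys = 0"
proof -
  let ?R = "{T. tensor_pairing Q T ys = 0}"
  have "T \<in> ?R"
  proof (rule filtration_imageI[OF T tlinear_id, of ?R])
    show "tens.subspace ?R" by (rule subspace_kernel_tfunctional[OF tensor_pairing_tfunctional])
    show "elem_tensor xs \<in> ?R" if "length xs = d" "set xs \<subseteq> perp Q point" "x \<in> set xs" "x \<in> point" for xs x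
      using fiber_radical_pairing[OF ys that(1,3,4)] by simp
    fix xs js
    assume xs: "length xs = d" and js: "length js = d" "set js \<subseteq> {-1, 0, 1}" "sum_list js = r"
      and E: "\<And>j. j < d \<Longrightarrow> xs ! j \<in> EF (js ! j)"
    have "\<exists>j<d. js ! j = 1 \<and> ys ! j \<noteq> fr_l P"
    proof (rule ccontr)
      assume "\<not> ?thesis"
      then have sub: "{j. j < d \<and> js ! j = 1} \<subseteq> {j. j < d \<and> ys ! j = fr_l P}" by auto
      have "r = (\<Sum>j<d. js ! j)"
        using js by (simp add: sum_list_sum_nth atLeast0LessThan)
      also have "\<dots> \<le> (\<Sum>j<d. if js ! j = 1 then 1 else 0)"
      proof (rule sum_mono)
        fix j assume "j \<in> {..<d}"
        then have "js ! j \<in> {-1, 0, 1}" using js by (metis lessThan_iff nth_mem subsetD)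
        then show "js ! j \<le> (if js ! j = 1 then 1 else 0)" by auto
      qed
      also have "\<dots> = int (card {j. j < d \<and> js ! j = 1})"
        by (simp add: sum.If_cases Int_def)
      also have "\<dots> \<le> int (card {j. j < d \<and> ys ! j = fr_l P})"
        using sub by (simp add: card_mono)
      finally show False using few by simp
    qed
    then obtain j where j: "j < d" "js ! j = 1" "ys ! j \<noteq> fr_l P" by blast
    then obtain c e where "xs ! j = c *s fr_v P + e *s fr_e' P"
      using E E_filtration_one by metis
    moreover have "ys ! j \<in> weight_vectors" using j ys by auto
    ultimately have "bform Q (xs ! j) (ys ! j) = 0"
      using j(3) unfolding weight_vectors_def by (auto simp: bform_linear gram)
    then have "tensor_pairing Q (elem_tensor xs) ys = 0"
      using j xs ys by (simp add: tensor_pairing_elem) (metis lessThan_iff prod_zero finite_lessThan)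
    then show "elem_tensor xs \<in> ?R" by simp
  qed
  then show ?thesis by simp
qed

lemma weight_span: "proj_VI Q (fr_e P) (fr_e' P) x \<in> vec.span weight_vectors"
proof -
  have "proj_VI Q (fr_e P) (fr_e' P) x
      = bform Q x (fr_l P) *s fr_v P + bform Q x (fr_v P) *s fr_l P + core Q P x"
    by (simp add: proj_VI_def core_def)
  then show ?thesis
    unfolding weight_vectors_def
    by (auto intro!: vec.span_add vec.span_scale intro: vec.span_base)
qed

text \<open>The weight vectors span a complement of the radical on which the form is nondegenerate.\<close>

lemma fiber_radical_of_pairing:
  assumes T: "T \<in> tensors (perp Q point) d"
    and pairing: "\<And>ys. length ys = d \<Longrightarrow> set ys \<subseteq> weight_vectors \<Longrightarrow> tensor_pairing Q T ys = 0"
  shows "T \<in> fiber_radical d"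
proof -
  let ?D = "proj_VI Q (fr_e P) (fr_e' P)"
  have "tensor_map ?D T - T \<in> fiber_radical d"
  proof (rule tensors_imageI[OF tlinear_diff[OF tensor_map_tlinear tlinear_id] tensors_closed(2) T])
    fix xs assume xs: "length xs = d" "set xs \<subseteq> perp Q point"
    show "tensor_map ?D (elem_tensor xs) - elem_tensor xs \<in> fiber_radical d"
      unfolding tensor_map_elem[OF proj_VI_clinear]
    proof (rule elem_tensor_replace[OF tensors_closed(2)])
      fix k assume k: "k < d"
      let ?us = "take k (map ?D xs) @ (map ?D xs ! k - xs ! k) # drop (Suc k) xs"
      have "xs ! k \<in> perp Q point" using xs k by (metis nth_mem subsetD)
      then have "?D (xs ! k) - xs ! k = (- bform Q (xs ! k) (fr_e P)) *s fr_e' P"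
        unfolding perp_point_iff by (simp add: proj_VI_def)
      then have "?D (xs ! k) - xs ! k \<in> point"
        using point_iff by blast
      then have pt: "map ?D xs ! k - xs ! k \<in> point"
        using k xs(1) by simp
      have "?D x \<in> perp Q point" for x
        by (simp add: perp_point_iff proj_VI_def bform_linear gram)
      then have "set ?us \<subseteq> perp Q point"
        using xs pt point_subset_perp by (auto dest!: in_set_takeD in_set_dropD)
      then show "elem_tensor ?us \<in> fiber_radical d"
        using pt xs k by (intro elem_in_fiber_radical[of _ _ "map ?D xs ! k - xs ! k"]) auto
    qed (use xs in auto)
  qed
  moreover have "tensor_map ?D T = 0"
  proof
    fix i :: "'n list"
    have "\<exists>q. \<forall>x. bform Q (x :: complex^'n) q = x $ r" for r
      using bform_dual_vector[of Q r] lattice unfolding is_lattice_def by blast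
    then obtain q where q: "\<And>r x. bform Q (x :: complex^'n) (q r) = x $ r"
      by metis
    have self_adjoint: "bform Q (?D x) y = bform Q x (?D y)" for x y
      by (simp add: proj_VI_def bform_linear commute[of "fr_e P" y] commute[of "fr_e' P" y])
    have "matrix ?D $ r $ h = covector Q (?D (q r)) $ h" for r h
      by (simp add: matrix_def covector_def self_adjoint[symmetric] q)
    then have eq: "tensor_map ?D T i
        = (\<Sum>h | length h = length i. T h * elem_tensor (map (\<lambda>r. covector Q (?D (q r))) i) h)"
      unfolding tensor_map_def by (intro sum.cong refl) (simp add: elem_tensor_def)
    show "tensor_map ?D T i = 0 i"
    proof (cases "length i = d")
      case True
      let ?R = "{U. (\<Sum>h | length h = d. T h * U h) = 0}"
      have "elem_tensor (map (\<lambda>r. covector Q (?D (q r))) i) \<in> ?R"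
      proof (rule elem_tensor_span[of _ d "\<lambda>_. covector Q ` weight_vectors"])
        have "tfunctional (\<lambda>U. \<Sum>h | length h = d. T h * U h)"
          by (rule tfunctionalI)
            (simp_all add: tscale_def algebra_simps sum.distrib sum_distrib_left)
        then show "tens.subspace ?R" by (rule subspace_kernel_tfunctional)
        fix cs assume cs: "length cs = d" "\<forall>j<d. cs ! j \<in> covector Q ` weight_vectors"
        then have "set cs \<subseteq> covector Q ` weight_vectors"
          by (auto simp: in_set_conv_nth)
        then have "\<forall>c\<in>set cs. \<exists>y. covector Q y = c \<and> y \<in> weight_vectors"
          by blast
        then obtain pick where pick: "\<And>c. c \<in> set cs \<Longrightarrow> covector Q (pick c) = c \<and> pick c \<in> weight_vectors"
          by metis
        define ys where "ys = map pick cs"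
        have ys: "cs = map (covector Q) ys" "set ys \<subseteq> weight_vectors"
          using pick by (auto simp: ys_def map_idI)
        then show "elem_tensor cs \<in> ?R"
          using pairing[of ys] cs(1) by (simp add: tensor_pairing_def)
      next
        have "vec.subspace {x. covector Q x \<in> vec.span (covector Q ` weight_vectors)}"
          by (rule vec.subspaceI) (auto simp: clinear_simps[OF covector_clinear]
              intro: vec.span_zero vec.span_add vec.span_scale)
        then have "vec.span weight_vectors \<subseteq> {x. covector Q x \<in> vec.span (covector Q ` weight_vectors)}"
          by (intro vec.span_minimal) (auto intro: vec.span_base)
        then show "\<forall>j<d. map (\<lambda>r. covector Q (?D (q r))) i ! j \<in> vec.span (covector Q ` weight_vectors)"
          using weight_span True by auto
      qed (use True in simp)
      then show ?thesis using eq True by simp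
    next
      case False
      have "tensor_map ?D T \<in> tensors UNIV d"
        by (rule tensor_map_tensors[OF proj_VI_clinear _ T]) simp
      then show ?thesis using tensors_support False by fastforce
    qed
  qed
  ultimately have "- T \<in> fiber_radical d"
    by (metis diff_0)
  then show ?thesis
    using tens.subspace_neg[OF tensors_closed(2)] by fastforce
qed

text \<open>
  A product of weight vectors containing \<open>l\<close> at most \<open>\<lambda>\<^sub>1\<close> times is orthogonal to the tensor because
  of its level; if \<open>l\<close> occurs more often, then it occurs twice in one column, and the
  antisymmetry forces the product to be orthogonal to the tensor.
\<close>

lemma schur_highest_level:
  assumes lam: "is_partition n lam" "n > 0" and T: "T \<in> schur Q (perp Q point) lam"
    and level: "T \<in> fiber_filtration (sum_list lam) (int (lam ! 0) + 1)"
  shows "T \<in> fiber_radical (sum_list lam)"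
proof (rule fiber_radical_of_pairing)
  let ?d = "sum_list lam"
  show "T \<in> tensors (perp Q point) ?d"
    using T schur_subset_tensors by blast
  fix ys assume ys: "length ys = ?d" "set ys \<subseteq> weight_vectors"
  define X where "X = {j. j < ?d \<and> ys ! j = fr_l P}"
  show "tensor_pairing Q T ys = 0"
  proof (cases "card X \<le> lam ! 0")
    case True
    then show ?thesis
      using filtration_pairing[OF level ys] by (simp add: X_def)
  next
    case False
    then obtain a b c where ab: "a \<in> X" "b \<in> X" "a \<noteq> b" "a \<in> tableau_column lam c" "b \<in> tableau_column lam c"
      using boxes_in_common_column[OF lam, of X] by (auto simp: X_def)
    obtain U S where T: "T = col_antisymmetrize lam U + S" "U \<in> tensors (perp Q point) ?d"
      "S \<in> fiber_radical ?d"
      using T by (rule schur_cases)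
    let ?\<tau> = "Transposition.transpose a b"
    have bound: "a < ?d" "b < ?d" using ab by (auto simp: X_def)
    note \<tau> = transpose_permutes_boxes[OF ab(3-5) bound]
    have sym: "tensor_pairing Q (perm_action ?\<tau> V) ys = tensor_pairing Q V ys"
      if "V \<in> tensors (perp Q point) ?d" for V
    proof -
      have "V \<in> {V. tensor_pairing Q (perm_action ?\<tau> V) ys - tensor_pairing Q V ys = 0}" (is "_ \<in> ?R")
      proof (rule tensors_imageI[OF tlinear_id _ that])
        have "tfunctional (\<lambda>V. tensor_pairing Q (perm_action ?\<tau> V) ys - tensor_pairing Q V ys)"
          by (rule tfunctionalI) (simp_all add: tfunctional_simps[OF tensor_pairing_tfunctional]
              tlinear_simps[OF perm_action_tlinear] algebra_simps)
        then show "tens.subspace ?R" by (rule subspace_kernel_tfunctional)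
        fix xs :: "(complex^'n) list" assume xs: "length xs = ?d"
        have inv: "inv_into UNIV ?\<tau> = ?\<tau>" by simp
        have "(\<Prod>j<?d. bform Q (xs ! ?\<tau> j) (ys ! j)) = (\<Prod>j<?d. bform Q (xs ! ?\<tau> (?\<tau> j)) (ys ! ?\<tau> j))"
          by (subst prod.permute[OF \<tau>]) (simp add: o_def)
        also have "\<dots> = (\<Prod>j<?d. bform Q (xs ! j) (ys ! j))"
          using ab by (intro prod.cong refl) (auto simp: X_def Transposition.transpose_def)
        finally show "elem_tensor xs \<in> ?R"
          using xs ys(1) \<tau> by (simp add: perm_action_elem[OF \<tau> xs] inv tensor_pairing_elem permute_list_nth)
      qed
      then show ?thesis by simp
    qed
    have "perm_action ?\<tau> (col_antisymmetrize lam U) = - col_antisymmetrize lam U"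
      by (rule col_antisymmetrize_transpose(2)[OF ab(3-5) bound T(2)])
    then have "tensor_pairing Q (- col_antisymmetrize lam U) ys = tensor_pairing Q (col_antisymmetrize lam U) ys"
      using sym[OF col_antisymmetrize_tensors[OF T(2)]] by simp
    then have "tensor_pairing Q (col_antisymmetrize lam U) ys = 0"
      by (simp add: tensor_pairing_def sum_negf)
    moreover have "S \<in> {S. tensor_pairing Q S ys = 0}"
      using T(3) unfolding rad_tensors_def
    proof (rule tens_span_subset)
      show "tens.subspace {S. tensor_pairing Q S ys = 0}"
        by (rule subspace_kernel_tfunctional[OF tensor_pairing_tfunctional])
      show "{elem_tensor xs |xs. length xs = ?d \<and> set xs \<subseteq> perp Q point \<and>
          set xs \<inter> perp Q (perp Q point) \<noteq> {}} \<subseteq> {S. tensor_pairing Q S ys = 0}"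
        using fiber_radical_pairing[OF ys] perp_perp_point_iff by blast
    qed
    ultimately show ?thesis
      unfolding T(1) by (simp add: tfunctional_simps(1)[OF tensor_pairing_tfunctional])
  qed
qed

end

section \<open>Positivity\<close>

definition of_real_vec :: "real^'n \<Rightarrow> complex^'n" where
  "of_real_vec x = (\<chi> i. complex_of_real (x $ i))"

lemma bform_of_real_vec: "bform Q (of_real_vec x) (of_real_vec y) = complex_of_real (bform Q x y)"
  by (simp add: bform_def of_real_vec_def)

text \<open>If \<open>r\<close> were nonzero, the three vectors would span a positive semidefinite space of dimension \<open>3\<close>,
  which meets the negative definite space of codimension \<open>2\<close> nontrivially.\<close>

lemma signature_no_null_vector:
  fixes Q :: "int^'n^'n" and x y r :: "real^'n"
  assumes Q: "transpose Q = Q" "has_signature Q 2 n"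
    and x: "bform Q x x > 0" and y: "bform Q y y > 0" and xy: "bform Q x y = 0"
    and xr: "bform Q x r = 0" and yr: "bform Q y r = 0" and r: "bform Q r r = 0"
  shows "r = 0"
proof (rule ccontr)
  assume "r \<noteq> 0"
  note comm = bform_commute[OF Q(1)]
  note lin = bform_linear[where 'a = real, folded scalar_mult_eq_scaleR]
  note zero = xy xr yr r comm[of y x, unfolded xy] comm[of r x, unfolded xr] comm[of r y, unfolded yr]
  obtain N :: "(real^'n) set" where N: "subspace N" "dim N = n" "\<forall>y\<in>N. y \<noteq> 0 \<longrightarrow> bform Q y y < 0"
    and n: "2 + n = CARD('n)"
    using Q(2) unfolding has_signature_def by blast
  have "y \<notin> span {r}"
  proof
    assume "y \<in> span {r}"
    then obtain c where c: "y = c *s r" by (auto simp: span_singleton scalar_mult_eq_scaleR)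
    show False using y r unfolding c by (simp add: bform_linear)
  qed
  moreover have "x \<notin> span {y, r}"
  proof
    assume "x \<in> span {y, r}"
    then obtain c where "x - c *s y \<in> span {r}" by (auto simp: span_breakdown_eq scalar_mult_eq_scaleR)
    then obtain d where "x - c *s y = d *s r" by (auto simp: span_singleton scalar_mult_eq_scaleR)
    then have "x = c *s y + d *s r" by (simp add: algebra_simps)
    then have "bform Q x x = bform Q (c *s y + d *s r) x" by simp
    then show False using x by (simp add: bform_linear zero)
  qed
  ultimately have "independent {x, y, r}" and "card {x, y, r} = 3"
    using \<open>r \<noteq> 0\<close> span_base[of y "{y, r}"] span_base[of r "{y, r}"] span_base[of r "{r}"]
    by (auto simp: independent_insert card_insert_if)
  then have S: "dim (span {x, y, r}) = 3"
    by (simp add: dim_eq_card_independent)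
  have "dim {u + v |u v. u \<in> span {x, y, r} \<and> v \<in> N} + dim (span {x, y, r} \<inter> N) = 3 + n"
    using dim_sums_Int[OF subspace_span N(1), of "{x, y, r}"] S N(2) by simp
  moreover have "dim {u + v |u v. u \<in> span {x, y, r} \<and> v \<in> N} \<le> 2 + n"
    using dim_subset_UNIV[of "{u + v |u v. u \<in> span {x, y, r} \<and> v \<in> N}"] n by simp
  ultimately have "dim (span {x, y, r} \<inter> N) \<noteq> 0" by linarith
  then obtain u where u: "u \<in> span {x, y, r}" "u \<in> N" "u \<noteq> 0"
    by (metis Int_iff dim_eq_0 singletonI subsetI)
  then obtain \<alpha> where "u - \<alpha> *s x \<in> span {y, r}" by (auto simp: span_breakdown_eq scalar_mult_eq_scaleR)
  then obtain \<beta> where "u - \<alpha> *s x - \<beta> *s y \<in> span {r}" by (auto simp: span_breakdown_eq scalar_mult_eq_scaleR)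
  then obtain \<gamma> where "u - \<alpha> *s x - \<beta> *s y = \<gamma> *s r" by (auto simp: span_singleton scalar_mult_eq_scaleR)
  then have "u = \<alpha> *s x + \<beta> *s y + \<gamma> *s r" by (simp add: algebra_simps)
  then have "bform Q u u = \<alpha> * \<alpha> * bform Q x x + \<beta> * \<beta> * bform Q y y"
    by (simp add: bform_linear zero)
  then have "bform Q u u \<ge> 0" using x y by simp
  then show False using N(3) u by force
qed

text \<open>The real and imaginary parts of \<open>w\<close> span a positive definite plane, the maximal dimension in
  signature \<open>(2, n)\<close>.\<close>

lemma period_not_orthogonal:
  fixes Q :: "int^'n^'n" and w a :: "complex^'n"
  assumes Q: "transpose Q = Q" "has_signature Q 2 n"
    and w: "bform Q w w = 0" "Re (bform Q w (cnj_vec w)) > 0"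
    and a: "a \<in> lat" "bform Q a a = 0" "a \<noteq> 0"
  shows "bform Q w a \<noteq> 0"
proof
  assume wa: "bform Q w a = 0"
  define x y r where "x = (\<chi> i. Re (w $ i))" and "y = (\<chi> i. Im (w $ i))" and "r = (\<chi> i. Re (a $ i))"
  have w_eq: "w = of_real_vec x + \<i> *s of_real_vec y" and cnj_eq: "cnj_vec w = of_real_vec x - \<i> *s of_real_vec y"
    by (simp_all add: vec_eq_iff of_real_vec_def x_def y_def cnj_vec_def complex_eq_iff)
  have "Im (a $ i) = 0" for i
    using a(1) unfolding lat_def by (metis Ints_cases complex_Im_of_int mem_Collect_eq)
  then have a_eq: "a = of_real_vec r"
    by (simp add: vec_eq_iff of_real_vec_def r_def complex_eq_iff)
  note comm = bform_commute[OF Q(1), of y x]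
  have "bform Q x x = bform Q y y" "bform Q x y = 0"
    using w(1) comm unfolding w_eq
    by (simp_all add: bform_linear bform_of_real_vec complex_eq_iff)
  moreover have "bform Q x x + bform Q y y > 0"
    using w(2) comm unfolding cnj_eq unfolding w_eq
    by (simp add: bform_linear bform_of_real_vec)
  moreover have "bform Q x r = 0" "bform Q y r = 0"
    using wa unfolding w_eq a_eq
    by (simp_all add: bform_linear bform_of_real_vec complex_eq_iff)
  moreover have "bform Q r r = 0"
    using a(2) unfolding a_eq by (simp add: bform_of_real_vec)
  ultimately have "r = 0"
    by (intro signature_no_null_vector[OF Q, of x y]) auto
  then show False
    using a(3) a_eq by (simp add: of_real_vec_def vec_eq_iff)
qed

lemma period_point:
  assumes "D \<in> period_domains Q" "p \<in> D"
  obtains w where "p = line w" "bform Q w w = 0" "Re (bform Q w (cnj_vec w)) > 0"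
proof -
  have "D \<subseteq> topspace (subtopology proj_topology
     {line w | w. bform Q w w = 0 \<and> Re (bform Q w (cnj_vec w)) > 0})"
    using assms(1) connected_components_of_subset unfolding period_domains_def by blast
  then have "D \<subseteq> {line w | w. bform Q w w = 0 \<and> Re (bform Q w (cnj_vec w)) > 0}"
    by simp
  then show ?thesis using assms(2) that by blast
qed

lemma line_iff: "x \<in> line w \<longleftrightarrow> (\<exists>c. x = c *s w)"
  by (auto simp: line_def vec.span_singleton)

lemma period_vector:
  assumes Q: "transpose Q = Q" "has_signature Q 2 n"
    and D: "D \<in> period_domains Q" "line z \<in> D" and "z \<noteq> 0"
  shows "bform Q z z = 0" and "a \<in> lat \<Longrightarrow> bform Q a a = 0 \<Longrightarrow> a \<noteq> 0 \<Longrightarrow> bform Q z a \<noteq> 0"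
proof -
  obtain w where w: "line z = line w" "bform Q w w = 0" "Re (bform Q w (cnj_vec w)) > 0"
    using period_point[OF D] by blast
  have "z \<in> line w" unfolding w(1)[symmetric] line_iff by (metis vec.scale_one)
  then obtain c where c: "z = c *s w" using line_iff by blast
  then have "c \<noteq> 0" using \<open>z \<noteq> 0\<close> by auto
  show "bform Q z z = 0" unfolding c by (simp add: bform_linear w)
  show "bform Q z a \<noteq> 0" if "a \<in> lat" "bform Q a a = 0" "a \<noteq> 0"
    using period_not_orthogonal[OF Q w(2,3) that] \<open>c \<noteq> 0\<close> unfolding c by (simp add: bform_linear)
qed

section \<open>The vector space of Jacobi forms\<close>

lemma full_lattice_scaled:
  fixes N :: nat
  assumes M: "full_lattice M W" and N: "N > 0"
  shows "full_lattice {x. of_nat N *s x \<in> M} W" "M \<subseteq> {x. of_nat N *s x \<in> M}"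
proof -
  obtain B where W: "rat_span M = W" and B: "finite B" "vec.independent B"
    and M_eq: "M = range (\<lambda>c :: _ \<Rightarrow> int. \<Sum>b\<in>B. of_int (c b) *s b)"
    using M unfolding full_lattice_def by blast
  have mult: "of_nat k *s x \<in> M" if x: "x \<in> M" for k :: nat and x
  proof -
    obtain c :: "_ \<Rightarrow> int" where "x = (\<Sum>b\<in>B. of_int (c b) *s b)" using x M_eq by blast
    then have "of_nat k *s x = (\<Sum>b\<in>B. of_int (int k * c b) *s b)"
      by (simp add: vec.scale_sum_right)
    then show ?thesis unfolding M_eq by (intro image_eqI[of _ _ "\<lambda>b. int k * c b"]) auto
  qed
  show sub: "M \<subseteq> {x. of_nat N *s x \<in> M}" using mult by blast
  have "rat_span {x. of_nat N *s x \<in> M} = W"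
  proof -
    have "x \<in> rat_span M" if c: "c > 0" "of_nat N *s (of_nat c *s x) \<in> M" for x c
    proof -
      have "of_nat (N * c) *s x \<in> M" using c by simp
      then show ?thesis using c(1) N unfolding rat_span_def by (metis (mono_tags, lifting) mem_Collect_eq nat_0_less_mult_iff)
    qed
    then have "rat_span {x. of_nat N *s x \<in> M} \<subseteq> rat_span M"
      unfolding rat_span_def[of "{x. of_nat N *s x \<in> M}"] by blast
    moreover have "rat_span M \<subseteq> rat_span {x. of_nat N *s x \<in> M}"
      using sub unfolding rat_span_def by blast
    ultimately show ?thesis using W by blast
  qed
  moreover have "\<exists>B'. finite B' \<and> vec.independent B' \<and>
      {x. of_nat N *s x \<in> M} = range (\<lambda>c :: _ \<Rightarrow> int. \<Sum>b\<in>B'. of_int (c b) *s b)"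
  proof (intro exI conjI)
    let ?s = "\<lambda>b :: complex^'a. (1 / of_nat N) *s b"
    have N0: "complex_of_nat N \<noteq> 0" using N by simp
    have lin: "clinear ?s" by (rule clinearI) (simp_all add: vec.scale_right_distrib ac_simps)
    have inj: "inj_on ?s X" for X using N0 by (auto simp: inj_on_def)
    show "finite (?s ` B)" using B by simp
    show "vec.independent (?s ` B)"
      using vec.linear_independent_injective_image[OF lin B(2) inj] .
    have sum: "(\<Sum>b\<in>?s ` B. of_int (c b) *s b) = ?s (\<Sum>b\<in>B. of_int (c (?s b)) *s b)" for c :: "_ \<Rightarrow> int"
      by (subst sum.reindex[OF inj]) (simp add: clinear_simps[OF lin] vec.scale_sum_right mult.commute)
    show "{x. of_nat N *s x \<in> M} = range (\<lambda>c :: _ \<Rightarrow> int. \<Sum>b\<in>?s ` B. of_int (c b) *s b)"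
    proof (intro equalityI subsetI)
      fix x assume "x \<in> {x. of_nat N *s x \<in> M}"
      then obtain c :: "_ \<Rightarrow> int" where c: "of_nat N *s x = (\<Sum>b\<in>B. of_int (c b) *s b)"
        using M_eq by auto
      have "x = ?s (of_nat N *s x)" using N0 by simp
      also have "\<dots> = (\<Sum>b\<in>?s ` B. of_int ((\<lambda>b. c (of_nat N *s b)) b) *s b)"
        unfolding sum c using N0 by simp
      finally show "x \<in> range (\<lambda>c :: _ \<Rightarrow> int. \<Sum>b\<in>?s ` B. of_int (c b) *s b)"
        by (rule image_eqI[of _ _ "\<lambda>b. c (of_nat N *s b)", OF _ UNIV_I])
    next
      fix x assume "x \<in> range (\<lambda>c :: _ \<Rightarrow> int. \<Sum>b\<in>?s ` B. of_int (c b) *s b)"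
      then obtain c :: "_ \<Rightarrow> int" where "x = ?s (\<Sum>b\<in>B. of_int (c (?s b)) *s b)"
        using sum by auto
      then have "of_nat N *s x = (\<Sum>b\<in>B. of_int ((\<lambda>b. c (?s b)) b) *s b)" using N0 by simp
      then have "of_nat N *s x \<in> M"
        unfolding M_eq by (rule image_eqI[of _ _ "\<lambda>b. c (?s b)", OF _ UNIV_I])
      then show "x \<in> {x. of_nat N *s x \<in> M}" by simp
    qed
  qed
  ultimately show "full_lattice {x. of_nat N *s x \<in> M} W"
    unfolding full_lattice_def by blast
qed

text \<open>After clearing denominators, a multiple of \<open>M'\<close> lies in \<open>M\<close>. This allows the Fourier expansions
  of two functions to be written over the same index set, and so to be added.\<close>

lemma full_lattice_union:
  assumes M: "full_lattice M W" and M': "full_lattice M' W"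
  obtains M'' where "full_lattice M'' W" "M \<subseteq> M''" "M' \<subseteq> M''"
proof -
  obtain B where W: "rat_span M' = W" and B: "finite B"
    and M'_eq: "M' = range (\<lambda>c :: _ \<Rightarrow> int. \<Sum>b\<in>B. of_int (c b) *s b)"
    using M' unfolding full_lattice_def by blast
  obtain C where MW: "rat_span M = W" and C: "finite C"
    and M_eq: "M = range (\<lambda>c :: _ \<Rightarrow> int. \<Sum>b\<in>C. of_int (c b) *s b)"
    using M unfolding full_lattice_def by blast
  have closed: "of_int k *s x + y \<in> M" if xy: "x \<in> M" "y \<in> M" for x y and k :: int
  proof -
    obtain c d :: "_ \<Rightarrow> int" where "x = (\<Sum>b\<in>C. of_int (c b) *s b)" "y = (\<Sum>b\<in>C. of_int (d b) *s b)"
      using xy M_eq by blast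
    then have "of_int k *s x + y = (\<Sum>b\<in>C. of_int (k * c b + d b) *s b)"
      by (simp add: vec.scale_sum_right sum.distrib vec.scale_left_distrib)
    then show ?thesis unfolding M_eq by (intro image_eqI[of _ _ "\<lambda>b. k * c b + d b"]) auto
  qed
  have zero: "0 \<in> M" unfolding M_eq by (rule image_eqI[of _ _ "\<lambda>_. 0"]) simp_all
  have "\<exists>k::nat. k > 0 \<and> of_nat k *s b \<in> M" if b: "b \<in> B" for b
  proof -
    have "b = (\<Sum>x\<in>B. of_int (if x = b then 1 else 0) *s x)"
      using b B by (simp add: if_distrib[of of_int] if_distrib[of "\<lambda>c. c *s _"] cong: if_cong)
    then have "b \<in> M'"
      unfolding M'_eq by (rule image_eqI[of _ _ "\<lambda>x. if x = b then 1 else 0", OF _ UNIV_I])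
    then have "b \<in> rat_span M'"
      unfolding rat_span_def by (auto intro!: exI[of _ "1::nat"])
    then have "b \<in> rat_span M"
      using MW W by simp
    then show ?thesis unfolding rat_span_def by blast
  qed
  then obtain k :: "_ \<Rightarrow> nat" where k: "\<And>b. b \<in> B \<Longrightarrow> k b > 0 \<and> of_nat (k b) *s b \<in> M" by metis
  define N where "N = prod k B"
  have N: "N > 0" using k B by (auto simp: N_def intro!: prod_pos)
  have NB: "of_nat N *s b \<in> M" if "b \<in> B" for b
  proof -
    define q where "q = prod k (B - {b})"
    have q: "N = q * k b"
      using prod.remove[OF B that, of k] by (simp add: N_def q_def)
    have "of_int (int q) *s (of_nat (k b) *s b) + 0 \<in> M"
      by (rule closed[OF _ zero]) (use k[OF that] in blast)
    then show ?thesis unfolding q by simp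
  qed
  have "M' \<subseteq> {x. of_nat N *s x \<in> M}"
  proof
    fix x assume "x \<in> M'"
    then obtain c :: "_ \<Rightarrow> int" where c: "x = (\<Sum>b\<in>B. of_int (c b) *s b)" using M'_eq by blast
    have "(\<Sum>b\<in>F. of_int (c b) *s (of_nat N *s b)) \<in> M" if "finite F" "F \<subseteq> B" for F
      using that
    proof (induction F)
      case (insert b F)
      then have "of_int (c b) *s (of_nat N *s b) + (\<Sum>b\<in>F. of_int (c b) *s (of_nat N *s b)) \<in> M"
        by (intro closed NB) auto
      then show ?case by (simp only: sum.insert[OF insert.hyps])
    qed (simp add: zero)
    then have "(\<Sum>b\<in>B. of_int (c b) *s (of_nat N *s b)) \<in> M" using B by blast
    moreover have "of_nat N *s x = (\<Sum>b\<in>B. of_int (c b) *s (of_nat N *s b))"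
      by (simp add: c vec.scale_sum_right mult.commute)
    ultimately show "x \<in> {x. of_nat N *s x \<in> M}" by simp
  qed
  then show ?thesis using that full_lattice_scaled[OF M N] by blast
qed

lemma section_scale_vector_space: "vector_space section_scale"
  by unfold_locales (auto simp: section_scale_def tscale_def fun_eq_iff algebra_simps)

lemma holomorphic_in_add: "holomorphic_in g S \<Longrightarrow> holomorphic_in h S \<Longrightarrow> holomorphic_in (\<lambda>z. g z + h z) S"
  unfolding holomorphic_in_def
proof
  fix z
  assume "\<forall>z\<in>S. \<exists>h'. (\<forall>c x. h' (c *s x) = c * h' x) \<and> (g has_derivative h') (at z within S)"
    "\<forall>z\<in>S. \<exists>h'. (\<forall>c x. h' (c *s x) = c * h' x) \<and> (h has_derivative h') (at z within S)" "z \<in> S"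
  then obtain g' h' where "\<forall>c x. g' (c *s x) = c * g' x" "(g has_derivative g') (at z within S)"
    "\<forall>c x. h' (c *s x) = c * h' x" "(h has_derivative h') (at z within S)" by blast
  then show "\<exists>h'. (\<forall>c x. h' (c *s x) = c * h' x) \<and> ((\<lambda>z. g z + h z) has_derivative h') (at z within S)"
    by (intro exI[of _ "\<lambda>x. g' x + h' x"]) (auto simp: algebra_simps intro: has_derivative_add)
qed

lemma holomorphic_in_scale: "holomorphic_in h S \<Longrightarrow> holomorphic_in (\<lambda>z. k * h z) S"
  unfolding holomorphic_in_def
proof
  fix z
  assume "\<forall>z\<in>S. \<exists>h'. (\<forall>c x. h' (c *s x) = c * h' x) \<and> (h has_derivative h') (at z within S)" "z \<in> S"
  then obtain h' where "\<forall>c x. h' (c *s x) = c * h' x" "(h has_derivative h') (at z within S)" by blast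
  then show "\<exists>h'. (\<forall>c x. h' (c *s x) = c * h' x) \<and> ((\<lambda>z. k * h z) has_derivative h') (at z within S)"
    by (intro exI[of _ "\<lambda>x. k * h' x"]) (auto intro: has_derivative_mult_right)
qed

lemma holomorphic_in_zero: "holomorphic_in (\<lambda>z. 0) S"
  unfolding holomorphic_in_def by (intro ballI exI[of _ "\<lambda>_. 0"]) simp

lemma holomorphic_in_sum:
  "(\<And>i. i \<in> A \<Longrightarrow> holomorphic_in (h i) S) \<Longrightarrow> holomorphic_in (\<lambda>z. \<Sum>i\<in>A. h i z) S"
  by (induction A rule: infinite_finite_induct)
    (simp_all add: holomorphic_in_zero holomorphic_in_add)

lemma holomorphic_in_cong:
  assumes eq: "\<And>z. z \<in> S \<Longrightarrow> g z = h z" and h: "holomorphic_in h S"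
  shows "holomorphic_in g S"
  unfolding holomorphic_in_def
proof
  fix z assume z: "z \<in> S"
  then obtain h' where "\<forall>c x. h' (c *s x) = c * h' x" "(h has_derivative h') (at z within S)"
    using h unfolding holomorphic_in_def by blast
  moreover from this have "(g has_derivative h') (at z within S)"
    using has_derivative_transform[where g = g and f = h, OF z eq] by blast
  ultimately show "\<exists>h'. (\<forall>c x. h' (c *s x) = c * h' x) \<and> (g has_derivative h') (at z within S)"
    by blast
qed

lemma section_values_iff:
  "section_values Q D \<Gamma> J lam \<phi> \<longleftrightarrow>
     (\<forall>f P. is_frame Q D \<Gamma> J f \<and> P \<in> V_J D J \<longrightarrow> \<phi> f P \<in> schur Q (VI Q (fr_e f) (fr_e' f)) lam) \<and>
     (\<forall>f P. \<not> (is_frame Q D \<Gamma> J f \<and> P \<in> V_J D J) \<longrightarrow> \<phi> f P = 0)"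
  unfolding section_values_def by auto

lemma transport_tlinear: "tlinear (transport Q k m g f1 f2 w)"
  unfolding transport_def by (intro tlinear_scale tensor_map_tlinear)

lemma jacobi_forms_combination:
  fixes \<phi> \<psi> :: "'n::finite jsection"
  assumes \<phi>: "\<phi> \<in> jacobi_forms Q D \<Gamma> J lam k m" and \<psi>: "\<psi> \<in> jacobi_forms Q D \<Gamma> J lam k m"
  shows "section_scale c \<phi> + \<psi> \<in> jacobi_forms Q D \<Gamma> J lam k m"
proof -
  let ?\<rho> = "section_scale c \<phi> + \<psi>"
  have app: "?\<rho> f P = tscale c (\<phi> f P) + \<psi> f P" for f P
    by (simp add: section_scale_def fun_eq_iff)
  have pb: "pullback Q J ?\<rho> f Z = tscale c (pullback Q J \<phi> f Z) + pullback Q J \<psi> f Z" for f Z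
    unfolding pullback_def by (rule app)
  have pointwise: "(tscale c T + S) i = c * T i + S i" for T S :: "'n tensor" and i
    by (simp add: tscale_def)
  have "section_values Q D \<Gamma> J lam ?\<rho>"
    unfolding section_values_iff
  proof (intro conjI allI impI)
    fix f P
    show "?\<rho> f P \<in> schur Q (VI Q (fr_e f) (fr_e' f)) lam" if "is_frame Q D \<Gamma> J f \<and> P \<in> V_J D J"
      unfolding app using \<phi> \<psi> that
      by (intro tens.subspace_add[OF schur_subspace] tens.subspace_scale[OF schur_subspace])
        (auto simp: jacobi_forms_def section_values_iff)
    show "?\<rho> f P = 0" if "\<not> (is_frame Q D \<Gamma> J f \<and> P \<in> V_J D J)"
    proof -
      have "\<phi> f P = 0" "\<psi> f P = 0"
        using \<phi> \<psi> that unfolding jacobi_forms_def section_values_iff by blast+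
      then show ?thesis unfolding app by (simp add: tscale_def fun_eq_iff)
    qed
  qed
  moreover have "holomorphic_section Q D \<Gamma> J ?\<rho>"
    using \<phi> \<psi> unfolding jacobi_forms_def holomorphic_section_def pb pointwise
    by (intro allI impI holomorphic_in_add holomorphic_in_scale) blast+
  moreover have "invariant_section Q D \<Gamma> J k m ?\<rho>"
    unfolding invariant_section_def
  proof (intro allI impI)
    fix f1 f2 g Z i
    assume *: "is_frame Q D \<Gamma> J f1 \<and> is_frame Q D \<Gamma> J f2 \<and> g \<in> Gamma_J_Q Q J \<inter> \<Gamma> \<and>
        Z \<in> tube Q D (fr_e f1) (fr_e' f1)"
    let ?w = "\<lambda>t. chart Q (fr_e f1) (fr_e' f1) (Z + (\<i> * of_real t) *s fr_v f1)"
    let ?P = "(*v) g ` proj_J J (line (chart Q (fr_e f1) (fr_e' f1) Z))"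
    have "((\<lambda>t. transport Q k m g f1 f2 (?w t) (pullback Q J \<phi> f1 Z) i) \<longlongrightarrow> \<phi> f2 ?P i) at_top"
      "((\<lambda>t. transport Q k m g f1 f2 (?w t) (pullback Q J \<psi> f1 Z) i) \<longlongrightarrow> \<psi> f2 ?P i) at_top"
      using \<phi> \<psi> * unfolding jacobi_forms_def invariant_section_def by blast+
    then show "((\<lambda>t. transport Q k m g f1 f2 (?w t) (pullback Q J ?\<rho> f1 Z) i) \<longlongrightarrow> ?\<rho> f2 ?P i) at_top"
      unfolding pb app tlinear_simps(1,2)[OF transport_tlinear] pointwise
      by (intro tendsto_add tendsto_mult_left)
  qed
  moreover have "holomorphic_at_cusp Q D J lam m ?\<rho> f" if f: "is_frame Q D \<Gamma> J f" for f
  proof -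
    let ?W = "latQ \<inter> VI Q (fr_e f) (fr_e' f) \<inter> perp Q J" and ?S = "schur Q (VI Q (fr_e f) (fr_e' f)) lam"
    let ?ok = "\<lambda>l. Re (bform Q (of_nat m *s fr_l f + l) (of_nat m *s fr_l f + l)) \<ge> 0"
    obtain M a where M: "full_lattice M ?W" "\<forall>l\<in>M. a l \<in> ?S" "\<forall>l\<in>M. a l \<noteq> 0 \<longrightarrow> ?ok l"
      and a: "\<forall>Z\<in>tube Q D (fr_e f) (fr_e' f). \<forall>i.
           ((\<lambda>l. a l i * exp (2 * pi * \<i> * bform Q l Z)) has_sum pullback Q J \<phi> f Z i) M"
      using \<phi> f unfolding jacobi_forms_def holomorphic_at_cusp_def by blast
    obtain M' a' where M': "full_lattice M' ?W" "\<forall>l\<in>M'. a' l \<in> ?S" "\<forall>l\<in>M'. a' l \<noteq> 0 \<longrightarrow> ?ok l"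
      and a': "\<forall>Z\<in>tube Q D (fr_e f) (fr_e' f). \<forall>i.
           ((\<lambda>l. a' l i * exp (2 * pi * \<i> * bform Q l Z)) has_sum pullback Q J \<psi> f Z i) M'"
      using \<psi> f unfolding jacobi_forms_def holomorphic_at_cusp_def by blast
    obtain M'' where M'': "full_lattice M'' ?W" "M \<subseteq> M''" "M' \<subseteq> M''"
      using full_lattice_union[OF M(1) M'(1)] .
    define A where "A l = (if l \<in> M then a l else 0)" for l
    define A' where "A' l = (if l \<in> M' then a' l else 0)" for l
    define C where "C l = tscale c (A l) + A' l" for l
    have "((\<lambda>l. C l i * exp (2 * pi * \<i> * bform Q l Z)) has_sum pullback Q J ?\<rho> f Z i) M''"
      if Z: "Z \<in> tube Q D (fr_e f) (fr_e' f)" for Z i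
    proof -
      have "((\<lambda>l. A l i * exp (2 * pi * \<i> * bform Q l Z)) has_sum pullback Q J \<phi> f Z i) M''"
        by (rule has_sum_cong_neutral[THEN iffD1, OF _ _ _ a[rule_format, OF Z]]) (use M'' in \<open>auto simp: A_def\<close>)
      moreover have "((\<lambda>l. A' l i * exp (2 * pi * \<i> * bform Q l Z)) has_sum pullback Q J \<psi> f Z i) M''"
        by (rule has_sum_cong_neutral[THEN iffD1, OF _ _ _ a'[rule_format, OF Z]]) (use M'' in \<open>auto simp: A'_def\<close>)
      ultimately show ?thesis
        unfolding pb C_def pointwise distrib_right mult.assoc by (intro has_sum_add has_sum_cmult_right)
    qed
    moreover have "C l \<in> ?S" for l
      using M(2) M'(2) unfolding C_def A_def A'_def
      by (auto intro!: tens.subspace_add[OF schur_subspace] tens.subspace_scale[OF schur_subspace]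
          tens.subspace_0[OF schur_subspace])
    moreover have "C l \<noteq> 0 \<longrightarrow> ?ok l" for l
    proof (cases "A l = 0 \<and> A' l = 0")
      case False
      then show ?thesis using M(3) M'(3) by (auto simp: A_def A'_def split: if_splits)
    qed (simp add: C_def tscale_def fun_eq_iff)
    ultimately show ?thesis
      unfolding holomorphic_at_cusp_def using M''(1) by blast
  qed
  ultimately show ?thesis unfolding jacobi_forms_def by blast
qed

section \<open>Scalar coefficients of vector-valued Jacobi forms\<close>

lemma sum_tensor_apply: "(\<Sum>h\<in>A. (f h :: 'n tensor)) i = (\<Sum>h\<in>A. f h i)"
  by (induction A rule: infinite_finite_induct) simp_all

lemma tensor_coordinates:
  fixes T :: "'n::finite tensor"
  assumes T: "\<And>i. length i \<noteq> d \<Longrightarrow> T i = 0"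
  shows "T = (\<Sum>h | length h = d. tscale (T h) (\<lambda>i. if i = h then 1 else 0))"
proof
  fix i
  have "(\<Sum>h | length h = d. tscale (T h) (\<lambda>i. if i = h then 1 else 0)) i
      = (\<Sum>h | length h = d. if h = i then T h else 0)"
    unfolding sum_tensor_apply tscale_def by (intro sum.cong) auto
  also have "\<dots> = T i"
    unfolding sum.delta[OF finite_lists_of_length] using T[of i] by simp
  finally show "T i = (\<Sum>h | length h = d. tscale (T h) (\<lambda>i. if i = h then 1 else 0)) i" by simp
qed

lemma tfunctional_coordinates:
  fixes T :: "'n::finite tensor"
  assumes F: "tfunctional F" and T: "\<And>i. length i \<noteq> d \<Longrightarrow> T i = 0"
  shows "F T = (\<Sum>h | length h = d. T h * F (\<lambda>i. if i = h then 1 else 0))"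
proof -
  have "F T = F (\<Sum>h | length h = d. tscale (T h) (\<lambda>i. if i = h then 1 else 0))"
    by (rule arg_cong[OF tensor_coordinates[OF T]])
  then show ?thesis
    by (simp only: tfunctional_simps(2,5)[OF F])
qed

definition multiplier ::
  "int^'n^'n \<Rightarrow> int \<Rightarrow> nat \<Rightarrow> complex^'n^'n \<Rightarrow> 'n frame \<Rightarrow> 'n frame \<Rightarrow> complex^'n \<Rightarrow> complex" where
  "multiplier Q k m g f1 f2 w = automorphy Q g f1 f2 w powi k *
     (omega_J Q f1 w / omega_J Q f2 (g *v w)) ^ m"

lemma transport_eq:
  "transport Q k m g f1 f2 w T = tscale (multiplier Q k m g f1 f2 w) (tensor_map (transition Q g f1 f2 w) T)"
  unfolding transport_def multiplier_def automorphy_def transition_def ..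

text \<open>Scalar sections have their values in the tensors of degree \<open>0\<close>, the multiples of
  \<open>elem_tensor []\<close>.\<close>

definition scalar_section ::
  "int^'n^'n \<Rightarrow> (complex^'n) set set \<Rightarrow> (complex^'n^'n) set \<Rightarrow> (complex^'n) set \<Rightarrow>
    ('n frame \<Rightarrow> 'n tensor \<Rightarrow> complex) \<Rightarrow> 'n jsection \<Rightarrow> 'n jsection" where
  "scalar_section Q D \<Gamma> J \<xi> \<phi> = (\<lambda>f P. if is_frame Q D \<Gamma> J f \<and> P \<in> V_J D J
     then tscale (\<xi> f (\<phi> f P)) (elem_tensor []) else 0)"

lemma schur_trivial: "tscale c (elem_tensor []) \<in> schur Q W (replicate n 0)"
proof -
  have "column_subgroup (replicate n 0) = {id}" "row_subgroup (replicate n 0) = {id}"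
    unfolding column_subgroup_def row_subgroup_def by (auto simp: sum_list_replicate)
  then have young: "young_symmetrizer (replicate n 0) T = T" for T :: "'a tensor"
    by (simp add: young_symmetrizer_def perm_action_def fun_eq_iff)
  have "elem_tensor [] \<in> tensors W 0"
    by (rule elem_in_tensors) simp_all
  then have "tscale c (elem_tensor []) \<in> traceless Q W (sum_list (replicate n 0))"
    unfolding traceless_def by (simp add: sum_list_replicate tens.subspace_scale[OF tensors_closed(1)])
  moreover have "tscale c (elem_tensor []) = young_symmetrizer (replicate n 0) (tscale c (elem_tensor [])) + (0 :: 'a tensor)"
    by (simp only: young add.right_neutral)
  ultimately show ?thesis
    unfolding schur_def using tens.subspace_0[OF tensors_closed(2)] by blast
qed

lemma tube_in_V_J: "Z \<in> tube Q D e e' \<Longrightarrow> proj_J J (line (chart Q e e' Z)) \<in> V_J D J"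
  by (simp add: tube_def V_J_def)

text \<open>
  If the functionals intertwine the transport in weight \<open>k\<close> with the multipliers of weight \<open>k'\<close>, then
  they turn Jacobi forms into scalar Jacobi forms of weight \<open>k'\<close>: all defining conditions are
  preserved by finite linear combinations of the coordinates.
\<close>

lemma scalar_section_jacobi:
  fixes Q :: "int^'n^'n" and \<phi> :: "'n jsection"
  assumes \<phi>: "\<phi> \<in> jacobi_forms Q D \<Gamma> J lam k m"
    and \<xi>: "\<And>f. tfunctional (\<xi> f)"
    and law: "\<And>f1 f2 g Z t. is_frame Q D \<Gamma> J f1 \<Longrightarrow> is_frame Q D \<Gamma> J f2 \<Longrightarrow> g \<in> Gamma_J_Q Q J \<inter> \<Gamma> \<Longrightarrow>
      Z \<in> tube Q D (fr_e f1) (fr_e' f1) \<Longrightarrow>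
      \<xi> f2 (transport Q k m g f1 f2 (chart Q (fr_e f1) (fr_e' f1) (Z + (\<i> * of_real t) *s fr_v f1)) (pullback Q J \<phi> f1 Z))
      = multiplier Q k' m g f1 f2 (chart Q (fr_e f1) (fr_e' f1) (Z + (\<i> * of_real t) *s fr_v f1)) *
        \<xi> f1 (pullback Q J \<phi> f1 Z)"
  shows "scalar_section Q D \<Gamma> J \<xi> \<phi> \<in> jacobi_forms Q D \<Gamma> J (replicate n 0) k' m"
proof -
  let ?\<psi> = "scalar_section Q D \<Gamma> J \<xi> \<phi>" and ?d = "sum_list lam"
  define coeff where "coeff f h = \<xi> f (\<lambda>i. if i = h then 1 else 0)" for f h
  have vals: "\<And>f P. is_frame Q D \<Gamma> J f \<Longrightarrow> P \<in> V_J D J \<Longrightarrow> \<phi> f P \<in> schur Q (VI Q (fr_e f) (fr_e' f)) lam"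
    "\<And>f P. \<not> (is_frame Q D \<Gamma> J f \<and> P \<in> V_J D J) \<Longrightarrow> \<phi> f P = 0"
    using \<phi> unfolding jacobi_forms_def section_values_iff by blast+
  have in_tensors: "\<phi> f P \<in> tensors UNIV ?d" for f P
  proof (cases "is_frame Q D \<Gamma> J f \<and> P \<in> V_J D J")
    case True
    then have "\<phi> f P \<in> tensors (VI Q (fr_e f) (fr_e' f)) ?d"
      using vals(1) schur_subset_tensors by blast
    moreover have "tensors (VI Q (fr_e f) (fr_e' f)) ?d \<subseteq> tensors UNIV ?d"
      unfolding tensors_def by (intro tens.span_mono) auto
    ultimately show ?thesis by blast
  next
    case False
    then show ?thesis
      using vals(2) tens.subspace_0[OF tensors_closed(1)] by metis
  qed
  have expand: "\<xi> f T = (\<Sum>h | length h = ?d. T h * coeff f h)" if "T \<in> tensors UNIV ?d" for f T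
    unfolding coeff_def using tfunctional_coordinates[OF \<xi>] tensors_support[OF that] by blast
  have \<psi>: "?\<psi> f P = tscale (\<xi> f (\<phi> f P)) (elem_tensor [])" if "is_frame Q D \<Gamma> J f" for f P
  proof (cases "P \<in> V_J D J")
    case False
    then have "\<phi> f P = 0" using vals(2) by blast
    then have "\<xi> f (\<phi> f P) = 0" by (simp only: tfunctional_simps(4)[OF \<xi>])
    then show ?thesis using False by (simp add: scalar_section_def)
  qed (use that in \<open>simp add: scalar_section_def\<close>)
  have pb: "pullback Q J ?\<psi> f Z = tscale (\<xi> f (pullback Q J \<phi> f Z)) (elem_tensor [])"
    if "is_frame Q D \<Gamma> J f" for f Z
    unfolding pullback_def by (rule \<psi>[OF that])
  have pb_tensors: "pullback Q J \<phi> f Z \<in> tensors UNIV ?d" for f Z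
    unfolding pullback_def by (rule in_tensors)
  have "section_values Q D \<Gamma> J (replicate n 0) ?\<psi>"
    unfolding section_values_iff by (simp add: scalar_section_def schur_trivial)
  moreover have "holomorphic_section Q D \<Gamma> J ?\<psi>"
    unfolding holomorphic_section_def
  proof (intro allI impI)
    fix f and i :: "'n list" assume f: "is_frame Q D \<Gamma> J f"
    have "holomorphic_in (\<lambda>Z. elem_tensor [] i * (\<Sum>h | length h = ?d. coeff f h * pullback Q J \<phi> f Z h))
        (tube Q D (fr_e f) (fr_e' f))"
      using \<phi> f unfolding jacobi_forms_def holomorphic_section_def
      by (intro holomorphic_in_scale holomorphic_in_sum) blast
    then show "holomorphic_in (\<lambda>Z. pullback Q J ?\<psi> f Z i) (tube Q D (fr_e f) (fr_e' f))"
      by (rule holomorphic_in_cong[rotated])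
        (simp add: pb[OF f] tscale_def expand[OF pb_tensors] mult.commute)
  qed
  moreover have "invariant_section Q D \<Gamma> J k' m ?\<psi>"
    unfolding invariant_section_def
  proof (intro allI impI)
    fix f1 f2 g Z and i :: "'n list"
    assume *: "is_frame Q D \<Gamma> J f1 \<and> is_frame Q D \<Gamma> J f2 \<and> g \<in> Gamma_J_Q Q J \<inter> \<Gamma> \<and>
        Z \<in> tube Q D (fr_e f1) (fr_e' f1)"
    let ?w = "\<lambda>t. chart Q (fr_e f1) (fr_e' f1) (Z + (\<i> * of_real t) *s fr_v f1)"
    let ?P = "(*v) g ` proj_J J (line (chart Q (fr_e f1) (fr_e' f1) Z))"
    have "((\<lambda>t. transport Q k m g f1 f2 (?w t) (pullback Q J \<phi> f1 Z) h) \<longlongrightarrow> \<phi> f2 ?P h) at_top" for h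
      using \<phi> * unfolding jacobi_forms_def invariant_section_def by blast
    then have "((\<lambda>t. \<Sum>h | length h = ?d. transport Q k m g f1 f2 (?w t) (pullback Q J \<phi> f1 Z) h * coeff f2 h)
        \<longlongrightarrow> (\<Sum>h | length h = ?d. \<phi> f2 ?P h * coeff f2 h)) at_top"
      by (intro tendsto_sum tendsto_mult_right)
    moreover have "transport Q k m g f1 f2 w (pullback Q J \<phi> f1 Z) \<in> tensors UNIV ?d" for w
      unfolding transport_eq
      by (intro tens.subspace_scale[OF tensors_closed(1)] tensor_map_tensors[OF transition_clinear _ pb_tensors]) simp
    ultimately have "((\<lambda>t. \<xi> f2 (transport Q k m g f1 f2 (?w t) (pullback Q J \<phi> f1 Z))) \<longlongrightarrow> \<xi> f2 (\<phi> f2 ?P)) at_top"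
      by (simp add: expand[symmetric] in_tensors)
    then have lim: "((\<lambda>t. multiplier Q k' m g f1 f2 (?w t) * \<xi> f1 (pullback Q J \<phi> f1 Z)) \<longlongrightarrow> \<xi> f2 (\<phi> f2 ?P)) at_top"
      using law * by simp
    have "transport Q k' m g f1 f2 w (tscale c (elem_tensor [])) = tscale (multiplier Q k' m g f1 f2 w * c) (elem_tensor [])"
      for w c
      unfolding transport_eq tlinear_simps(2)[OF tensor_map_tlinear] tensor_map_elem[OF transition_clinear]
      by (simp add: tscale_def fun_eq_iff)
    then show "((\<lambda>t. transport Q k' m g f1 f2 (?w t) (pullback Q J ?\<psi> f1 Z) i) \<longlongrightarrow> ?\<psi> f2 ?P i) at_top"
      using * tendsto_mult_right[OF lim, of "elem_tensor [] i"] by (simp add: pb \<psi> tscale_def)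
  qed
  moreover have "holomorphic_at_cusp Q D J (replicate n 0) m ?\<psi> f" if f: "is_frame Q D \<Gamma> J f" for f
  proof -
    let ?W = "latQ \<inter> VI Q (fr_e f) (fr_e' f) \<inter> perp Q J" and ?S = "schur Q (VI Q (fr_e f) (fr_e' f)) lam"
    let ?ok = "\<lambda>l. Re (bform Q (of_nat m *s fr_l f + l) (of_nat m *s fr_l f + l)) \<ge> 0"
    obtain M a where M: "full_lattice M ?W" "\<forall>l\<in>M. a l \<in> ?S" "\<forall>l\<in>M. a l \<noteq> 0 \<longrightarrow> ?ok l"
      and a: "\<forall>Z\<in>tube Q D (fr_e f) (fr_e' f). \<forall>i.
           ((\<lambda>l. a l i * exp (2 * pi * \<i> * bform Q l Z)) has_sum pullback Q J \<phi> f Z i) M"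
      using \<phi> f unfolding jacobi_forms_def holomorphic_at_cusp_def by blast
    define c where "c l = tscale (\<Sum>h | length h = ?d. a l h * coeff f h) (elem_tensor [] :: 'n tensor)" for l
    have sum: "((\<lambda>l. c l i * exp (2 * pi * \<i> * bform Q l Z)) has_sum pullback Q J ?\<psi> f Z i) M"
      if Z: "Z \<in> tube Q D (fr_e f) (fr_e' f)" for Z and i :: "'n list"
    proof -
      have single: "((\<lambda>l. a l h * exp (2 * pi * \<i> * bform Q l Z) * (coeff f h * elem_tensor [] i))
          has_sum (pullback Q J \<phi> f Z h * (coeff f h * elem_tensor [] i))) M" for h
        using a Z by (intro has_sum_cmult_left) blast
      have "((\<lambda>l. \<Sum>h\<in>H. a l h * exp (2 * pi * \<i> * bform Q l Z) * (coeff f h * elem_tensor [] i))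
          has_sum (\<Sum>h\<in>H. pullback Q J \<phi> f Z h * (coeff f h * elem_tensor [] i))) M" if "finite H" for H
        using that
      proof (induction H)
        case (insert h H)
        show ?case
          unfolding sum.insert[OF insert.hyps] by (rule has_sum_add[OF single insert.IH])
      qed simp
      from this[OF finite_lists_of_length] show ?thesis
        by (simp add: pb[OF f] c_def tscale_def expand[OF pb_tensors] sum_distrib_right sum_distrib_left ac_simps)
    qed
    have "c l = 0" if "a l = 0" for l
      unfolding c_def that by (simp add: tscale_def fun_eq_iff)
    then have "\<forall>l\<in>M. c l \<noteq> 0 \<longrightarrow> ?ok l" using M(3) by blast
    moreover have "\<forall>l\<in>M. c l \<in> schur Q (VI Q (fr_e f) (fr_e' f)) (replicate n 0)"
      unfolding c_def by (simp add: schur_trivial)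
    ultimately show ?thesis
      unfolding holomorphic_at_cusp_def using M(1) sum by blast
  qed
  ultimately show ?thesis unfolding jacobi_forms_def by blast
qed

section \<open>Projections and coordinates of quotients\<close>

lemma (in vector_space) exists_projection:
  assumes "subspace S"
  obtains q where "\<And>x y. q (x + y) = q x + q y" "\<And>c x. q (scale c x) = scale c (q x)"
    "\<And>x. q x \<in> S" "\<And>x. x \<in> S \<Longrightarrow> q x = x"
proof -
  interpret pair: vector_space_pair scale scale ..
  have "Vector_Spaces.linear scale scale (\<lambda>x. x)" by unfold_locales auto
  from pair.linear_exists_left_inverse_on[OF this assms inj_on_id2]
  obtain q where q: "q ` UNIV \<subseteq> S" "Vector_Spaces.linear scale scale q" "\<forall>x\<in>S. q x = x" by blast
  interpret q: Vector_Spaces.linear scale scale q by (rule q(2))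
  show ?thesis
    by (rule that[of q]) (use q(1,3) q.add q.scale in auto)
qed

text \<open>Coordinates with respect to a basis of \<open>X\<close> that extends a basis of \<open>Y\<close>, extended linearly to
  all tensors.\<close>

lemma quotient_coordinates:
  fixes X Y :: "'n::finite tensor set"
  assumes X: "tens.subspace X" and Y: "tens.subspace Y" and YX: "Y \<subseteq> X"
    and support: "\<And>T i. T \<in> X \<Longrightarrow> length i \<noteq> d \<Longrightarrow> T i = 0"
  obtains \<eta> :: "nat \<Rightarrow> 'n tensor \<Rightarrow> complex" where "\<And>i. tfunctional (\<eta> i)" "\<And>i T. T \<in> Y \<Longrightarrow> \<eta> i T = 0"
    "\<And>T. T \<in> X \<Longrightarrow> (\<And>i. i < tens.dim X - tens.dim Y \<Longrightarrow> \<eta> i T = 0) \<Longrightarrow> T \<in> Y"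
proof -
  obtain BY where BY: "BY \<subseteq> Y" "tens.independent BY" "Y \<subseteq> tens.span BY"
    by (rule tens.maximal_independent_subset_extend[of "{}" Y]) (auto simp: tens.independent_empty)
  obtain BX where BX: "BY \<subseteq> BX" "BX \<subseteq> X" "tens.independent BX" "X \<subseteq> tens.span BX"
    by (rule tens.maximal_independent_subset_extend[of BY X]) (use BY YX in auto)
  let ?U = "(\<lambda>h i. if i = h then 1 else 0 :: complex) ` {h :: 'n list. length h = d}"
  have "T \<in> tens.span ?U" if "T \<in> X" for T
  proof -
    have "T = (\<Sum>h | length h = d. tscale (T h) (\<lambda>i. if i = h then 1 else 0))"
      by (rule tensor_coordinates[OF support[OF that]])
    also have "\<dots> \<in> tens.span ?U"
      by (intro tens.span_sum tens.span_scale tens.span_base) blast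
    finally show ?thesis .
  qed
  then have finX: "finite BX"
    using tens.independent_span_bound[of ?U BX] BX(2,3) finite_lists_of_length by blast
  have "tens.dim X = card BX" "tens.dim Y = card BY"
    using tens.dim_unique[OF BX(2,4,3) refl] tens.dim_unique[OF BY(1,3,2) refl] by auto
  then have dim: "tens.dim X - tens.dim Y = card (BX - BY)"
    using BX(1) finX by (simp add: card_Diff_subset finite_subset)
  obtain b where b: "bij_betw b {..<card (BX - BY)} (BX - BY)"
    using finX ex_bij_betw_nat_finite[of "BX - BY"] by (auto simp: atLeast0LessThan)
  define E where "E = tens.extend_basis BX"
  note E = tens.extend_basis_superset[OF BX(3), folded E_def] tens.independent_extend_basis[OF BX(3), folded E_def]
    tens.span_extend_basis[OF BX(3), folded E_def]
  define \<eta> where "\<eta> i T = (if i < card (BX - BY) then tens.representation E T (b i) else 0)" for i T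
  show ?thesis
  proof (rule that[of \<eta>])
    show "tfunctional (\<eta> i)" for i
      by (rule tfunctionalI) (simp_all add: \<eta>_def tens.representation_add[OF E(2)]
          tens.representation_scale[OF E(2)] E(3))
    have repr: "tens.representation E T = tens.representation BX T" if "T \<in> tens.span BX" for T
      using tens.representation_extend[OF E(2) that E(1)] .
    show "\<eta> i T = 0" if "T \<in> Y" for i T
    proof (cases "i < card (BX - BY)")
      case True
      then have "b i \<in> BX - BY" using b bij_betwE by blast
      moreover have "tens.representation E T = tens.representation BY T"
        using tens.representation_extend[OF E(2)] BY(3) BX(1) E(1) that by blast
      ultimately show ?thesis
        using tens.representation_ne_zero[of BY T "b i"] True by (auto simp: \<eta>_def)
    qed (simp add: \<eta>_def)
    fix T assume T: "T \<in> X" and zero: "\<And>i. i < tens.dim X - tens.dim Y \<Longrightarrow> \<eta> i T = 0"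
    have coord: "tens.representation BX T x = 0" if "x \<in> BX - BY" for x
    proof -
      have "x \<in> b ` {..<card (BX - BY)}"
        using that bij_betw_imp_surj_on[OF b] by simp
      then obtain i where "i < card (BX - BY)" "x = b i" by blast
      then show ?thesis using zero[of i] repr[of T] BX(4) T by (auto simp: dim \<eta>_def)
    qed
    have "T = (\<Sum>x\<in>BX. tscale (tens.representation BX T x) x)"
      using tens.sum_representation_eq[OF BX(3) _ finX order_refl] BX(4) T by auto
    also have "\<dots> = (\<Sum>x\<in>BY. tscale (tens.representation BX T x) x)"
      using finX BX(1) coord by (intro sum.mono_neutral_right) auto
    also have "\<dots> \<in> Y"
      using BY(1) by (intro tens.subspace_sum[OF Y] tens.subspace_scale[OF Y]) blast
    finally show "T \<in> Y" .
  qed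
qed

section \<open>Frames at the cusps and the parabolic group\<close>

locale jacobi_setting = filtered_fiber Q a b J P
  for Q :: "int^'n^'n" and a b :: "complex^'n" and J :: "(complex^'n) set" and P :: "'n frame" +
  fixes D :: "(complex^'n) set set" and \<Gamma> :: "(complex^'n^'n) set" and n :: nat
  assumes signature: "has_signature Q 2 n"
    and D: "D \<in> period_domains Q"
    and J: "primitive_isotropic Q 2 J" and ab: "a \<in> J" "b \<in> J"
begin

lemma symmetric: "transpose Q = Q"
  using lattice unfolding is_lattice_def by blast

lemma J_subset: "J \<subseteq> lat" "J \<subseteq> plane"
  using J span_J vec.span_superset unfolding primitive_isotropic_def plane_def by blast+

lemma perp_J: "perp Q J = perp Q plane"
proof
  show "perp Q J \<subseteq> perp Q plane"
    using ab unfolding subset_iff perp_plane_iff by (simp add: perp_def)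
  show "perp Q plane \<subseteq> perp Q J"
    using J_subset unfolding perp_def by blast
qed

lemma rat_span_J: "rat_span J \<subseteq> plane"
proof
  fix x assume "x \<in> rat_span J"
  then obtain c :: nat where c: "c > 0" "of_nat c *s x \<in> J" unfolding rat_span_def by blast
  then have "of_nat c *s x \<in> plane"
    using J_subset by blast
  then have "(1 / of_nat c) *s (of_nat c *s x) \<in> plane"
    by (rule plane_closed(3))
  then show "x \<in> plane" using c(1) by simp
qed

lemma J_subset_rat_span: "J \<subseteq> rat_span J"
  unfolding rat_span_def by (auto intro!: exI[of _ "1::nat"])

context
  fixes f :: "'n frame"
  assumes f: "is_frame Q D \<Gamma> J f"
begin

lemma frame_properties:
  "fr_e f \<in> J" "fr_e' f \<in> latQ" "bform Q (fr_e' f) (fr_e' f) = 0" "bform Q (fr_e f) (fr_e' f) = 1"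
  using f unfolding is_frame_def by (auto split: frame.splits)

lemma frame_translation: obtains g where "g \<in> U_J_Q Q J" "fr_v f = g *v fr_e' f - fr_e' f"
proof -
  have "{g *v fr_e' f - fr_e' f | g. g \<in> U_J_Q Q J \<inter> \<Gamma>} = int_multiples (fr_v f)"
    using f unfolding is_frame_def by (auto split: frame.splits)
  moreover have "fr_v f \<in> int_multiples (fr_v f)"
    unfolding int_multiples_def by (rule image_eqI[of _ _ 1]) auto
  ultimately show ?thesis using that by blast
qed

lemma e_in_plane: "fr_e f \<in> plane"
  using frame_properties J_subset by blast

definition cusp_frame :: "'n frame" where
  "cusp_frame = (SOME A. adapted Q a b A \<and> fr_e A = fr_e f \<and> fr_e' A = fr_e' f)"

lemma cusp_frame: "adapted Q a b cusp_frame" "fr_e cusp_frame = fr_e f" "fr_e' cusp_frame = fr_e' f"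
proof -
  have "\<exists>A. adapted Q a b A \<and> fr_e A = fr_e f \<and> fr_e' A = fr_e' f"
    using adapted_frame_exists[OF e_in_plane frame_properties(4,3)] by metis
  then have "adapted Q a b cusp_frame \<and> fr_e cusp_frame = fr_e f \<and> fr_e' cusp_frame = fr_e' f"
    unfolding cusp_frame_def by (rule someI_ex)
  then show "adapted Q a b cusp_frame" "fr_e cusp_frame = fr_e f" "fr_e' cusp_frame = fr_e' f"
    by auto
qed

text \<open>A rational adapted frame yields rational vectors spanning \<open>J\<^sup>\<bottom>\<close>, so conditions on the
  rational vectors of \<open>J\<^sup>\<bottom>\<close> extend to all its vectors.\<close>

lemma perp_plane_rational: "perp Q plane \<subseteq> vec.span (latQ \<inter> perp Q J)"
proof
  fix x assume x: "x \<in> perp Q plane"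
  have Q: "fr_e f \<in> latQ" "fr_e' f \<in> latQ" "a \<in> latQ" "b \<in> latQ"
    using frame_properties ab J_subset(1) lat_subset_latQ by auto
  obtain A where A: "adapted Q a b A" "fr_e A = fr_e f" "fr_e' A = fr_e' f" "fr_l A \<in> latQ"
    using adapted_frame_exists[OF e_in_plane frame_properties(4,3)] Q by metis
  have v: "fr_v A \<in> latQ"
    using A unfolding adapted_def wedge_def by (metis Q(2-4) bform_Rats latQ_diff latQ_scale)
  note AQ = v A(4) Q(1,2)[folded A(2,3)]
  have axis: "core Q A (axis i 1) \<in> latQ \<inter> perp Q J" for i
    using AQ core_perp_plane[OF A(1)] unfolding perp_J core_def[of Q A "axis i 1"]
    by (auto intro!: latQ_diff latQ_scale latQ_axis bform_Rats simp: core_def)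
  have "core Q A x = (\<Sum>i\<in>UNIV. x $ i *s core Q A (axis i 1))"
    by (subst (1) basis_expansion[of x, symmetric]) (simp only: clinear_simps[OF core_clinear])
  then have "core Q A x \<in> vec.span (latQ \<inter> perp Q J)"
    using axis by (auto intro!: vec.span_sum vec.span_scale intro: vec.span_base)
  moreover have "fr_e A \<in> latQ \<inter> perp Q J" "fr_v A \<in> latQ \<inter> perp Q J"
    using AQ adapted_in_plane[OF A(1)] plane_isotropic unfolding perp_J by auto
  moreover have "x = bform Q x (fr_e' A) *s fr_e A + bform Q x (fr_l A) *s fr_v A + core Q A x"
    using x unfolding perp_plane_adapted[OF A(1)] core_def by simp
  ultimately show "x \<in> vec.span (latQ \<inter> perp Q J)"
    by (metis vec.span_add vec.span_base vec.span_scale)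
qed

lemma Gamma_plane_unimodular:
  assumes g: "g \<in> Gamma_J_Q Q J"
  shows "plane_unimodular Q a b g"
proof -
  have isometry: "bform Q (g *v x) (g *v y) = bform Q x y" for x y
    using g unfolding Gamma_J_Q_def isometries_def by blast
  have wedge: "g *v wedge Q a b x = wedge Q a b (g *v x)" for x
  proof -
    have "\<forall>x\<in>rat_span J. \<forall>y\<in>rat_span J. \<forall>i j.
        (g *v x) $ i * (g *v y) $ j - (g *v x) $ j * (g *v y) $ i = x $ i * y $ j - x $ j * y $ i"
      using g unfolding Gamma_J_Q_def by blast
    moreover have "a \<in> rat_span J" "b \<in> rat_span J"
      using ab J_subset_rat_span by blast+
    ultimately have "(g *v a) $ i * (g *v b) $ j - (g *v a) $ j * (g *v b) $ i = a $ i * b $ j - a $ j * b $ i" for i j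
      by simp
    moreover have "wedge Q c d y $ j = (\<Sum>i\<in>UNIV. (c $ i * d $ j - c $ j * d $ i) * bform Q y (axis i 1))"
      for c d y :: "complex^'n" and j
    proof -
      have "wedge Q c d y $ j = (\<Sum>i\<in>UNIV. c $ i * bform Q y (axis i 1)) * d $ j
          - (\<Sum>i\<in>UNIV. d $ i * bform Q y (axis i 1)) * c $ j"
        by (simp only: wedge_def bform_expand[of Q y c] bform_expand[of Q y d]
            vector_minus_component vector_smult_component)
      also have "\<dots> = (\<Sum>i\<in>UNIV. (c $ i * d $ j - c $ j * d $ i) * bform Q y (axis i 1))"
        unfolding sum_distrib_right sum_subtractf[symmetric]
        by (intro sum.cong refl) (simp add: algebra_simps)
      finally show ?thesis .
    qed
    ultimately have "wedge Q (g *v a) (g *v b) (g *v x) = wedge Q a b (g *v x)"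
      by (simp add: vec_eq_iff)
    then show ?thesis
      by (simp add: wedge_def isometry matrix_vector_mult_diff_distrib vec.scale)
  qed
  have "vec.span (latQ \<inter> perp Q J) \<subseteq> {x. g *v x - x \<in> plane}"
  proof (rule vec.span_minimal)
    show "latQ \<inter> perp Q J \<subseteq> {x. g *v x - x \<in> plane}"
      using g rat_span_J unfolding Gamma_J_Q_def by blast
    show "vec.subspace {x. g *v x - x \<in> plane}"
    proof (rule vec.subspaceI)
      fix x y c
      assume *: "x \<in> {x. g *v x - x \<in> plane}"
      have "g *v (c *s x) - c *s x = c *s (g *v x - x)"
        by (simp add: vec.scale vec.scale_right_diff_distrib)
      also have "\<dots> \<in> plane"
        using * by (intro plane_closed(3)) simp
      finally show "c *s x \<in> {x. g *v x - x \<in> plane}" by simp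
      assume "y \<in> {x. g *v x - x \<in> plane}"
      then have "(g *v x - x) + (g *v y - y) \<in> plane"
        using * by (intro plane_closed(1)) auto
      also have "(g *v x - x) + (g *v y - y) = g *v (x + y) - (x + y)"
        by (simp add: matrix_vector_right_distrib)
      finally show "x + y \<in> {x. g *v x - x \<in> plane}" by simp
    qed (simp add: plane_closed)
  qed
  then have "g *v x - x \<in> plane" if "x \<in> perp Q plane" for x
    using that perp_plane_rational by blast
  then show ?thesis
    using isometry wedge unfolding plane_unimodular_def plane_def by blast
qed

text \<open>An element of \<open>U(J)\<close> fixes \<open>J\<^sup>\<bottom>\<close>, so it moves \<open>e'\<close> by a vector orthogonal to \<open>J\<^sup>\<bottom>\<close>, that is, by
  a vector of \<open>J\<close>.\<close>

lemma frame_v: "fr_v f \<in> plane" "bform Q (fr_v f) (fr_e' f) = 0"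
proof -
  obtain g where g: "g \<in> U_J_Q Q J" and v: "fr_v f = g *v fr_e' f - fr_e' f"
    by (rule frame_translation)
  have isometry: "bform Q (g *v x) (g *v y) = bform Q x y" for x y
    using g unfolding U_J_Q_def Gamma_J_Q_def isometries_def by blast
  have "vec.span (latQ \<inter> perp Q J) \<subseteq> {x. g *v x = x}"
  proof (rule vec.span_minimal)
    show "latQ \<inter> perp Q J \<subseteq> {x. g *v x = x}"
      using g unfolding U_J_Q_def by blast
    show "vec.subspace {x. g *v x = x}"
      by (rule vec.subspaceI) (auto simp: matrix_vector_right_distrib vec.scale)
  qed
  then have fixed: "g *v y = y" if "y \<in> perp Q plane" for y
    using that perp_plane_rational by blast
  have "bform Q (fr_v f) y = 0" if "y \<in> perp Q plane" for y
    using isometry[of "fr_e' f" y] fixed[OF that] by (simp add: v bform_linear)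
  then show plane: "fr_v f \<in> plane"
    by (rule perp_double_plane[OF cusp_frame(1)])
  have "g *v fr_e' f = fr_e' f + fr_v f" by (simp add: v)
  then have "bform Q (fr_e' f + fr_v f) (fr_e' f + fr_v f) = 0"
    using isometry[of "fr_e' f" "fr_e' f"] frame_properties by simp
  then show "bform Q (fr_v f) (fr_e' f) = 0"
    using bform_plane[OF plane plane] frame_properties commute[of "fr_e' f" "fr_v f"]
    by (simp add: bform_linear)
qed

text \<open>On the way to the boundary, the vector \<open>w\<close> changes by elements of \<open>J\<close> only, so its products
  with vectors of \<open>J\<close> remain constant.\<close>

lemma chart_properties:
  assumes Z: "Z \<in> tube Q D (fr_e f) (fr_e' f)"
  defines "w \<equiv> \<lambda>t. chart Q (fr_e f) (fr_e' f) (Z + t *s fr_v f)"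
  shows "bform Q (w t) (fr_e f) = 1" "bform Q (w t) (w t) = 0" "w t - w 0 \<in> plane"
    "u \<in> lat \<Longrightarrow> bform Q u u = 0 \<Longrightarrow> u \<noteq> 0 \<Longrightarrow> bform Q (w 0) u \<noteq> 0"
proof -
  have ZVI: "bform Q Z (fr_e f) = 0" "bform Q Z (fr_e' f) = 0"
    using Z unfolding tube_def VI_def perp_def by auto
  note v = frame_v(2) bform_plane[OF frame_v(1) frame_v(1)] bform_plane[OF frame_v(1) e_in_plane]
    bform_plane[OF e_in_plane e_in_plane] bform_plane[OF e_in_plane frame_v(1)]
  note e = frame_properties(3,4) commute[of "fr_e' f" "fr_e f"] commute[of "fr_e' f" Z]
    commute[of "fr_e f" Z] commute[of "fr_e' f" "fr_v f"] commute[of "fr_v f" Z]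
  show we: "bform Q (w t) (fr_e f) = 1" for t
    by (simp add: w_def chart_def bform_linear v e ZVI)
  show "bform Q (w t) (w t) = 0"
    by (simp add: w_def chart_def bform_linear v e ZVI field_simps)
  have "w t - w 0 = t *s fr_v f - ((bform Q (Z + t *s fr_v f) (Z + t *s fr_v f) - bform Q Z Z) / 2) *s fr_e f"
    by (simp add: w_def chart_def vec_eq_iff field_simps)
  then show "w t - w 0 \<in> plane"
    using frame_v(1) e_in_plane by (simp only:) (intro plane_closed)
  have "line (w 0) \<in> D" using Z by (simp add: w_def tube_def)
  moreover have "w 0 \<noteq> 0" using we[of 0] by (auto simp: bform_linear)
  ultimately show "bform Q (w 0) u \<noteq> 0" if "u \<in> lat" "bform Q u u = 0" "u \<noteq> 0"
    using period_vector(2)[OF symmetric signature D] that by blast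
qed

end

text \<open>The product is constant along the path to the boundary, and at its starting point \<open>g\<^sup>-\<^sup>1 e\<^sub>2\<close> is a
  rational isotropic vector, to which a period vector is not orthogonal.\<close>

lemma automorphy_denominator:
  assumes f1: "is_frame Q D \<Gamma> J f1" and f2: "is_frame Q D \<Gamma> J f2" and g: "g \<in> Gamma_J_Q Q J"
    and Z: "Z \<in> tube Q D (fr_e f1) (fr_e' f1)"
  shows "bform Q (g *v chart Q (fr_e f1) (fr_e' f1) (Z + t *s fr_v f1)) (fr_e f2) \<noteq> 0"
proof -
  let ?w = "\<lambda>t. chart Q (fr_e f1) (fr_e' f1) (Z + t *s fr_v f1)"
  have e2: "fr_e f2 \<noteq> 0" "fr_e f2 \<in> plane"
    using frame_properties(4)[OF f2] e_in_plane[OF f2] by (auto simp: bform_linear)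
  have "fr_e f2 \<in> (*v) g ` rat_span J"
    using g frame_properties(1)[OF f2] J_subset_rat_span unfolding Gamma_J_Q_def by blast
  then obtain u where u: "fr_e f2 = g *v u" "u \<in> rat_span J" by blast
  then obtain c :: nat where c: "c > 0" "of_nat c *s u \<in> J" unfolding rat_span_def by blast
  have "of_nat c *s u \<noteq> 0" using c(1) u(1) e2 by auto
  moreover have "of_nat c *s u \<in> lat" "of_nat c *s u \<in> plane" using c J_subset by blast+
  ultimately have "bform Q (?w 0) (of_nat c *s u) \<noteq> 0"
    using chart_properties(4)[OF f1 Z] bform_plane by blast
  then have "bform Q (?w 0) u \<noteq> 0" by (auto simp: bform_linear)
  moreover have "bform Q (?w t - ?w 0) u = 0"
    using chart_properties(3)[OF f1 Z, of t] u(2) rat_span_J bform_plane by blast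
  ultimately have "bform Q (?w t) u \<noteq> 0" by (simp add: bform_linear)
  moreover have "bform Q (g *v ?w t) (g *v u) = bform Q (?w t) u"
    using Gamma_plane_unimodular[OF f1 g] unfolding plane_unimodular_def by blast
  ultimately show ?thesis unfolding u(1) by simp
qed

section \<open>The comparison of Jacobi forms with scalar Jacobi forms\<close>

definition to_fiber :: "'n frame \<Rightarrow> 'n tensor \<Rightarrow> 'n tensor" where
  "to_fiber f = tensor_map (comparison Q (cusp_frame f) P)"

lemma to_fiber_tlinear: "tlinear (to_fiber f)"
  unfolding to_fiber_def by (rule tensor_map_tlinear)

lemma VI_nondegenerate:
  assumes A: "adapted Q a b A" and x: "x \<in> VI Q (fr_e A) (fr_e' A)" "x \<in> perp Q (VI Q (fr_e A) (fr_e' A))"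
  shows "x = 0"
proof (rule nondegenerate)
  fix y
  have "bform Q x (proj_VI Q (fr_e A) (fr_e' A) y) = 0"
    using x(2) proj_VI_in[OF A] unfolding perp_def by blast
  then show "bform Q x y = 0"
    using x(1) unfolding VI_adapted[OF A] by (simp add: proj_VI_def bform_linear)
qed

lemma VI_subset_perp_point: "VI Q (fr_e P) (fr_e' P) \<subseteq> perp Q point"
  unfolding subset_iff perp_point_iff VI_adapted[OF P] by blast

context
  fixes lam :: "nat list"
begin

abbreviation level :: "int \<Rightarrow> 'n tensor set" where
  "level r \<equiv> schur_filtration Q J lam point r"

lemma level_iff: "T \<in> level r \<longleftrightarrow> T \<in> schur Q (perp Q point) lam \<and> T \<in> fiber_filtration (sum_list lam) r"
  by (simp add: schur_filtration_def)

lemma level_subspace: "tens.subspace (level r)"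
  unfolding schur_filtration_def by (intro tens.subspace_inter schur_subspace filtration_subspace)

lemma to_fiber_schur:
  assumes f: "is_frame Q D \<Gamma> J f" and T: "T \<in> schur Q (VI Q (fr_e f) (fr_e' f)) lam"
  shows "to_fiber f T \<in> schur Q (perp Q point) lam"
  unfolding to_fiber_def
proof (rule tensor_map_schur[OF comparison_clinear _ _ _ T])
  note A = cusp_frame[OF f]
  show "comparison Q (cusp_frame f) P ` VI Q (fr_e f) (fr_e' f) \<subseteq> perp Q point"
    using comparison_in_VI[OF A(1) P] VI_subset_perp_point by blast
  show "bform Q (comparison Q (cusp_frame f) P x) (comparison Q (cusp_frame f) P y) = bform Q x y"
    if "x \<in> VI Q (fr_e f) (fr_e' f)" "y \<in> VI Q (fr_e f) (fr_e' f)" for x y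
    using comparison_isometry[OF A(1) P] that A(2,3) by simp
  show "x = 0" if "x \<in> VI Q (fr_e f) (fr_e' f)" "x \<in> perp Q (VI Q (fr_e f) (fr_e' f))" for x
    using VI_nondegenerate[OF A(1)] that A(2,3) by simp
qed

text \<open>The comparison is injective because the opposite comparison annihilates the radical.\<close>

lemma to_fiber_radical:
  assumes f: "is_frame Q D \<Gamma> J f" and T: "T \<in> schur Q (VI Q (fr_e f) (fr_e' f)) lam"
    and radical: "to_fiber f T \<in> fiber_radical (sum_list lam)"
  shows "T = 0"
proof -
  note A = cusp_frame[OF f]
  have T': "T \<in> tensors (VI Q (fr_e f) (fr_e' f)) (sum_list lam)"
    using T schur_subset_tensors by blast
  have inverse: "comparison Q P (cusp_frame f) (comparison Q (cusp_frame f) P x) = x"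
    if "x \<in> VI Q (fr_e f) (fr_e' f)" for x
    using that comparison_inverse[OF A(1) P, of x] A(2,3)
    unfolding VI_adapted[OF A(1), unfolded A(2,3)] by (simp add: proj_VI_def)
  have clin: "clinear (\<lambda>x. comparison Q P (cusp_frame f) (comparison Q (cusp_frame f) P x))"
    by (rule clinearI) (simp_all only: clinear_simps[OF comparison_clinear])
  have id: "clinear (\<lambda>x. x :: complex^'n)" by (rule clinearI) simp_all
  have "tensor_map (comparison Q P (cusp_frame f)) (to_fiber f T) = tensor_map (\<lambda>x. x) T"
    unfolding to_fiber_def tensor_map_compose[OF comparison_clinear comparison_clinear T']
    by (rule tensor_map_cong[OF clin id inverse T'])
  also have "\<dots> = T" by (rule tensor_map_id[OF T'])
  finally have retraction: "tensor_map (comparison Q P (cusp_frame f)) (to_fiber f T) = T" .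
  have "tensor_map (comparison Q P (cusp_frame f)) S \<in> {0}"
    if "S \<in> fiber_radical (sum_list lam)" for S
  proof (rule tlinear_span_image[OF tensor_map_tlinear _ tens.subspace_single_0 that[unfolded rad_tensors_def]])
    fix S assume "S \<in> {elem_tensor xs | xs. length xs = sum_list lam \<and> set xs \<subseteq> perp Q point \<and>
        set xs \<inter> perp Q (perp Q point) \<noteq> {}}"
    then obtain xs x where S: "S = elem_tensor xs" "x \<in> set xs" "x \<in> point"
      using perp_perp_point_iff by blast
    then have "comparison Q P (cusp_frame f) x = 0"
      using comparison_frame(3)[OF P A(1)] unfolding point_iff
      by (auto simp: clinear_simps[OF comparison_clinear])
    then have "0 \<in> set (map (comparison Q P (cusp_frame f)) xs)"
      using S(2) by (metis image_eqI set_map)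
    then have "elem_tensor (map (comparison Q P (cusp_frame f)) xs) = 0"
      by (rule elem_tensor_zero)
    then show "tensor_map (comparison Q P (cusp_frame f)) S \<in> {0}"
      unfolding S(1) tensor_map_elem[OF comparison_clinear] by blast
  qed
  from this[OF radical] show ?thesis unfolding retraction by simp
qed

text \<open>
  Through the comparisons with the fiber, the transition becomes the block triangular map above, so it
  acts on the graded quotient of level \<open>r\<close> by the \<open>r\<close>-th power of the factor of automorphy.
\<close>

lemma to_fiber_transition:
  fixes t :: complex
  assumes f1: "is_frame Q D \<Gamma> J f1" and f2: "is_frame Q D \<Gamma> J f2" and g: "g \<in> Gamma_J_Q Q J"
    and Z: "Z \<in> tube Q D (fr_e f1) (fr_e' f1)"
    and T: "T \<in> schur Q (VI Q (fr_e f1) (fr_e' f1)) lam" and level: "to_fiber f1 T \<in> level r"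
  defines "w \<equiv> chart Q (fr_e f1) (fr_e' f1) (Z + t *s fr_v f1)"
  shows "to_fiber f2 (tensor_map (transition Q g f1 f2 w) T)
      - tscale (automorphy Q g f1 f2 w powi r) (to_fiber f1 T) \<in> level (r + 1)"
proof -
  let ?A = "cusp_frame f1" and ?B = "cusp_frame f2" and ?d = "sum_list lam"
  note A = cusp_frame[OF f1] and B = cusp_frame[OF f2]
  have we: "bform Q w (fr_e ?A) \<noteq> 0" "bform Q (g *v w) (fr_e ?B) \<noteq> 0"
    using chart_properties(1)[OF f1 Z] automorphy_denominator[OF f1 f2 g Z]
    by (simp_all add: w_def A B)
  note facts = Gamma_plane_unimodular[OF f1 g] A(1) B(1) chart_properties(2)[OF f1 Z, of t, folded w_def] we
  have same: "transition Q g f1 f2 w = transition Q g ?A ?B w" "automorphy Q g f1 f2 w = automorphy Q g ?A ?B w"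
    by (simp_all add: fun_eq_iff transition_def automorphy_def A B)
  let ?j = "automorphy Q g ?A ?B w" and ?H = "conjugate g ?A ?B w P"
  have clin: "clinear ?H"
    by (rule clinearI) (simp_all add: conjugate_def[OF facts P] clinear_simps[OF comparison_clinear]
        clinear_simps[OF transition_clinear])
  have T': "T \<in> tensors (VI Q (fr_e ?A) (fr_e' ?A)) ?d"
    using T schur_subset_tensors unfolding A(2,3) by blast
  have "to_fiber f2 (tensor_map (transition Q g ?A ?B w) T) = tensor_map ?H (to_fiber f1 T)"
  proof -
    have c1: "clinear (\<lambda>x. comparison Q ?B P (transition Q g ?A ?B w x))"
      by (rule clinearI) (simp_all only: clinear_simps[OF comparison_clinear] clinear_simps[OF transition_clinear])
    have c2: "clinear (\<lambda>x. ?H (comparison Q ?A P x))"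
      by (rule clinearI) (simp_all only: clinear_simps[OF comparison_clinear] clinear_simps[OF clin])
    have "comparison Q ?B P (transition Q g ?A ?B w x) = ?H (comparison Q ?A P x)"
      if "x \<in> VI Q (fr_e ?A) (fr_e' ?A)" for x
      using that comparison_inverse[OF A(1) P, of x] unfolding VI_adapted[OF A(1)]
      by (simp add: conjugate_def[OF facts P] proj_VI_def)
    from tensor_map_cong[OF c1 c2 this T'] show ?thesis
      unfolding to_fiber_def tensor_map_compose[OF comparison_clinear transition_clinear T']
        tensor_map_compose[OF clin comparison_clinear T'] .
  qed
  moreover have "tensor_map ?H (to_fiber f1 T) - tscale (?j powi r) (to_fiber f1 T) \<in> fiber_filtration ?d (r + 1)"
  proof (rule filtration_shift[OF clin automorphy_nonzero[OF facts(1-3) _ we]])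
    show "bform Q w w = 0" by (rule facts(4))
    show "to_fiber f1 T \<in> fiber_filtration ?d r" using level level_iff by blast
    show "?H x - ?j *s x \<in> point" if "x \<in> EF 1" for x
      using that conjugate_line[OF facts P] unfolding E_filtration_one point_iff by blast
    show "?H x - x \<in> EF 1" if "x \<in> EF 0" for x
      using that conjugate_middle[OF facts P, of x] unfolding E_filtration_one E_filtration_zero by metis
    show "?H x - (1 / ?j) *s x \<in> EF 0" if "x \<in> perp Q point" for x
      using that conjugate_top[OF facts P, of x] unfolding E_filtration_zero perp_point_iff by blast
  qed
  moreover have "to_fiber f2 (tensor_map (transition Q g ?A ?B w) T) \<in> schur Q (perp Q point) lam"
  proof (rule to_fiber_schur[OF f2], rule tensor_map_schur[OF transition_clinear _ _ _ T])
    show "transition Q g ?A ?B w ` VI Q (fr_e f1) (fr_e' f1) \<subseteq> VI Q (fr_e f2) (fr_e' f2)"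
      using transition_in_VI[OF facts] B(2,3) by auto
    show "bform Q (transition Q g ?A ?B w x) (transition Q g ?A ?B w y) = bform Q x y"
      if "x \<in> VI Q (fr_e f1) (fr_e' f1)" "y \<in> VI Q (fr_e f1) (fr_e' f1)" for x y
      using transition_isometry[OF facts] that A(2,3) by simp
    show "x = 0" if "x \<in> VI Q (fr_e f1) (fr_e' f1)" "x \<in> perp Q (VI Q (fr_e f1) (fr_e' f1))" for x
      using VI_nondegenerate[OF A(1)] that A(2,3) by simp
  qed
  moreover have "tscale (?j powi r) (to_fiber f1 T) \<in> schur Q (perp Q point) lam"
    using level level_iff tens.subspace_scale[OF schur_subspace] by blast
  ultimately show ?thesis
    unfolding level_iff same by (auto intro: tens.subspace_diff[OF schur_subspace])
qed

end

end

context jacobi_setting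
begin

context
  fixes lam :: "nat list" and k :: int and m :: nat
  assumes lam: "is_partition n lam" "n > 0"
begin

abbreviation forms :: "'n jsection set" where
  "forms \<equiv> jacobi_forms Q D \<Gamma> J lam k m"

definition forms_of_level :: "int \<Rightarrow> 'n jsection set" where
  "forms_of_level r = {\<phi> \<in> forms. \<forall>f p. is_frame Q D \<Gamma> J f \<and> p \<in> V_J D J \<longrightarrow> to_fiber f (\<phi> f p) \<in> level lam r}"

lemma form_values:
  "\<phi> \<in> forms \<Longrightarrow> is_frame Q D \<Gamma> J f \<Longrightarrow> p \<in> V_J D J \<Longrightarrow> \<phi> f p \<in> schur Q (VI Q (fr_e f) (fr_e' f)) lam"
  "\<phi> \<in> forms \<Longrightarrow> \<not> (is_frame Q D \<Gamma> J f \<and> p \<in> V_J D J) \<Longrightarrow> \<phi> f p = 0"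
  unfolding jacobi_forms_def section_values_iff by blast+

lemma zero_form:
  assumes "\<phi> \<in> forms" shows "0 \<in> forms"
proof -
  have "section_scale (-1) \<phi> + \<phi> = 0"
    by (simp add: section_scale_def tscale_def fun_eq_iff)
  then show ?thesis using jacobi_forms_combination[OF assms assms] by metis
qed

lemma forms_of_lowest_level: "forms_of_level (- int (lam ! 0)) = forms"
  unfolding forms_of_level_def level_iff
  using form_values(1) to_fiber_schur schur_lowest_level[OF lam] by blast

lemma forms_of_highest_level:
  assumes "\<phi> \<in> forms_of_level (int (lam ! 0) + 1)"
  shows "\<phi> = 0"
proof -
  have \<phi>: "\<phi> \<in> forms" using assms unfolding forms_of_level_def by blast
  have "\<phi> f p = 0" for f p
  proof (cases "is_frame Q D \<Gamma> J f \<and> p \<in> V_J D J")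
    case True
    then have "to_fiber f (\<phi> f p) \<in> level lam (int (lam ! 0) + 1)"
      using assms unfolding forms_of_level_def by blast
    then have "to_fiber f (\<phi> f p) \<in> fiber_radical (sum_list lam)"
      unfolding level_iff using schur_highest_level[OF lam] by blast
    then show ?thesis
      using True form_values(1)[OF \<phi>] to_fiber_radical by blast
  next
    case False
    then show ?thesis using form_values(2)[OF \<phi>] by blast
  qed
  then show ?thesis by (simp add: fun_eq_iff)
qed

lemma forms_of_level_combination:
  assumes \<phi>: "\<phi> \<in> forms_of_level r" and \<psi>: "\<psi> \<in> forms_of_level r"
  shows "section_scale c \<phi> + \<psi> \<in> forms_of_level r"
proof -
  have "to_fiber f ((section_scale c \<phi> + \<psi>) f p) \<in> level lam r"
    if "is_frame Q D \<Gamma> J f \<and> p \<in> V_J D J" for f p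
  proof -
    have "(section_scale c \<phi> + \<psi>) f p = tscale c (\<phi> f p) + \<psi> f p"
      by (simp add: section_scale_def fun_eq_iff)
    then have "to_fiber f ((section_scale c \<phi> + \<psi>) f p) = tscale c (to_fiber f (\<phi> f p)) + to_fiber f (\<psi> f p)"
      by (simp only: tlinear_simps(1,2)[OF to_fiber_tlinear])
    also have "\<dots> \<in> level lam r"
      using \<phi> \<psi> that unfolding forms_of_level_def
      by (intro tens.subspace_add[OF level_subspace] tens.subspace_scale[OF level_subspace]) blast+
    finally show ?thesis .
  qed
  then show ?thesis
    using \<phi> \<psi> jacobi_forms_combination unfolding forms_of_level_def by blast
qed

text \<open>The functional sees only the class in the graded quotient, on which the transport acts by the
  multiplier of weight \<open>k + r\<close>.\<close>

lemma scalar_section_of_level: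
  assumes \<phi>: "\<phi> \<in> forms_of_level r" and \<eta>: "tfunctional \<eta>" "\<And>T. T \<in> level lam (r + 1) \<Longrightarrow> \<eta> T = 0"
  shows "scalar_section Q D \<Gamma> J (\<lambda>f T. \<eta> (to_fiber f T)) \<phi> \<in> jacobi_forms Q D \<Gamma> J (replicate n 0) (k + r) m"
proof (rule scalar_section_jacobi)
  show "\<phi> \<in> forms" using \<phi> unfolding forms_of_level_def by blast
  then have schur: "pullback Q J \<phi> f Z \<in> schur Q (VI Q (fr_e f) (fr_e' f)) lam"
    if "is_frame Q D \<Gamma> J f" "Z \<in> tube Q D (fr_e f) (fr_e' f)" for f Z
    unfolding pullback_def using form_values(1) that tube_in_V_J by blast
  show "tfunctional (\<lambda>T. \<eta> (to_fiber f T))" for f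
    by (rule tfunctionalI) (simp_all add: tfunctional_simps[OF \<eta>(1)] tlinear_simps[OF to_fiber_tlinear])
  fix f1 f2 g Z and t :: real
  assume f: "is_frame Q D \<Gamma> J f1" "is_frame Q D \<Gamma> J f2" and g: "g \<in> Gamma_J_Q Q J \<inter> \<Gamma>"
    and Z: "Z \<in> tube Q D (fr_e f1) (fr_e' f1)"
  let ?T = "pullback Q J \<phi> f1 Z"
  define w where "w = chart Q (fr_e f1) (fr_e' f1) (Z + (\<i> * of_real t) *s fr_v f1)"
  let ?j = "automorphy Q g f1 f2 w"
  have g': "g \<in> Gamma_J_Q Q J" using g by blast
  have level: "to_fiber f1 ?T \<in> level lam r"
    using \<phi> f(1) tube_in_V_J[OF Z] unfolding forms_of_level_def pullback_def by blast
  have "\<eta> (to_fiber f2 (tensor_map (transition Q g f1 f2 w) ?T) - tscale (?j powi r) (to_fiber f1 ?T)) = 0"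
    unfolding w_def
    by (rule \<eta>(2)[OF to_fiber_transition[OF f g' Z schur[OF f(1) Z] level]])
  then have eq: "\<eta> (to_fiber f2 (tensor_map (transition Q g f1 f2 w) ?T)) = ?j powi r * \<eta> (to_fiber f1 ?T)"
    by (simp add: tfunctional_simps[OF \<eta>(1)])
  have "?j \<noteq> 0"
    using chart_properties(1)[OF f(1) Z] automorphy_denominator[OF f g' Z]
    by (simp add: automorphy_def w_def)
  then have "multiplier Q k m g f1 f2 w * ?j powi r = multiplier Q (k + r) m g f1 f2 w"
    by (simp add: multiplier_def power_int_add)
  then show "\<eta> (to_fiber f2 (transport Q k m g f1 f2 w ?T)) = multiplier Q (k + r) m g f1 f2 w * \<eta> (to_fiber f1 ?T)"
    by (simp add: transport_eq tlinear_simps(2)[OF to_fiber_tlinear] tfunctional_simps(2)[OF \<eta>(1)] eq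
        mult.assoc[symmetric])
qed

text \<open>
  The coordinates of the graded quotient are functionals on all tensors, so they define linear maps
  on all sections, which may be composed with any projection onto the forms of level \<open>r\<close>.
\<close>

lemma graded_coordinates:
  assumes "r \<ge> - int (lam ! 0)"
  obtains \<theta> :: "nat \<Rightarrow> 'n jsection \<Rightarrow> 'n jsection"
  where "\<And>i \<phi> \<psi>. \<theta> i (\<phi> + \<psi>) = \<theta> i \<phi> + \<theta> i \<psi>"
    and "\<And>i c \<phi>. \<theta> i (section_scale c \<phi>) = section_scale c (\<theta> i \<phi>)"
    and "\<And>i \<phi>. \<phi> \<in> forms_of_level r \<Longrightarrow> \<theta> i \<phi> \<in> jacobi_forms Q D \<Gamma> J (replicate n 0) (k + r) m"
    and "\<And>\<phi>. \<phi> \<in> forms_of_level r \<Longrightarrow> (\<And>i. i < gr_rank Q J lam point r \<Longrightarrow> \<theta> i \<phi> = 0) \<Longrightarrow>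
      \<phi> \<in> forms_of_level (r + 1)"
proof -
  let ?d = "sum_list lam"
  have "lam ! 0 \<le> ?d"
    using lam member_le_sum_list[of "lam ! 0" lam] by (simp add: is_partition_def)
  then have sub: "level lam (r + 1) \<subseteq> level lam r"
    using assms filtration_decreasing[of ?d r] unfolding schur_filtration_def by auto
  have support: "T i = 0" if "T \<in> level lam r" "length i \<noteq> ?d" for T and i :: "'n list"
    using that tensors_support schur_subset_tensors unfolding level_iff by blast
  have "\<exists>\<eta> :: nat \<Rightarrow> 'n tensor \<Rightarrow> complex. (\<forall>i. tfunctional (\<eta> i)) \<and> (\<forall>i. \<forall>T\<in>level lam (r + 1). \<eta> i T = 0) \<and>
      (\<forall>T\<in>level lam r. (\<forall>i<gr_rank Q J lam point r. \<eta> i T = 0) \<longrightarrow> T \<in> level lam (r + 1))"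
    unfolding gr_rank_def
    by (rule quotient_coordinates[where X = "level lam r" and Y = "level lam (r + 1)" and d = ?d,
          OF level_subspace level_subspace sub], erule (1) support) blast
  then obtain \<eta> :: "nat \<Rightarrow> 'n tensor \<Rightarrow> complex"
    where \<eta>: "\<And>i. tfunctional (\<eta> i)" "\<And>i T. T \<in> level lam (r + 1) \<Longrightarrow> \<eta> i T = 0"
    and kernel: "\<And>T. T \<in> level lam r \<Longrightarrow> (\<And>i. i < gr_rank Q J lam point r \<Longrightarrow> \<eta> i T = 0) \<Longrightarrow>
      T \<in> level lam (r + 1)"
    by blast
  define \<theta> where "\<theta> i = scalar_section Q D \<Gamma> J (\<lambda>f T. \<eta> i (to_fiber f T))" for i
  show ?thesis
  proof (rule that[of \<theta>])
    show "\<theta> i (\<phi> + \<psi>) = \<theta> i \<phi> + \<theta> i \<psi>" for i \<phi> \<psi>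
    proof (intro ext)
      fix f p x
      have "(\<phi> + \<psi>) f p = \<phi> f p + \<psi> f p" by (simp add: fun_eq_iff)
      then have "\<eta> i (to_fiber f ((\<phi> + \<psi>) f p)) = \<eta> i (to_fiber f (\<phi> f p)) + \<eta> i (to_fiber f (\<psi> f p))"
        by (simp only: tlinear_simps(1)[OF to_fiber_tlinear] tfunctional_simps(1)[OF \<eta>(1)])
      then show "\<theta> i (\<phi> + \<psi>) f p x = (\<theta> i \<phi> + \<theta> i \<psi>) f p x"
        unfolding \<theta>_def scalar_section_def by (simp add: tscale_def algebra_simps)
    qed
    show "\<theta> i (section_scale c \<phi>) = section_scale c (\<theta> i \<phi>)" for i c \<phi>
    proof (intro ext)
      fix f p x
      have "section_scale c \<phi> f p = tscale c (\<phi> f p)" by (simp add: section_scale_def)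
      then have "\<eta> i (to_fiber f (section_scale c \<phi> f p)) = c * \<eta> i (to_fiber f (\<phi> f p))"
        by (simp only: tlinear_simps(2)[OF to_fiber_tlinear] tfunctional_simps(2)[OF \<eta>(1)])
      then show "\<theta> i (section_scale c \<phi>) f p x = section_scale c (\<theta> i \<phi>) f p x"
        unfolding \<theta>_def scalar_section_def section_scale_def[of c "\<lambda>f P. if _ f P then _ f P else _"]
        by (simp add: tscale_def)
    qed
    show "\<theta> i \<phi> \<in> jacobi_forms Q D \<Gamma> J (replicate n 0) (k + r) m" if "\<phi> \<in> forms_of_level r" for i \<phi>
      unfolding \<theta>_def by (rule scalar_section_of_level[OF that \<eta>])
    fix \<phi> assume \<phi>: "\<phi> \<in> forms_of_level r" and zero: "\<And>i. i < gr_rank Q J lam point r \<Longrightarrow> \<theta> i \<phi> = 0"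
    have "to_fiber f (\<phi> f p) \<in> level lam (r + 1)" if fp: "is_frame Q D \<Gamma> J f \<and> p \<in> V_J D J" for f p
    proof (rule kernel)
      show "to_fiber f (\<phi> f p) \<in> level lam r"
        using \<phi> fp unfolding forms_of_level_def by blast
      fix i assume "i < gr_rank Q J lam point r"
      then have "\<theta> i \<phi> f p [] = 0"
        using zero by simp
      then show "\<eta> i (to_fiber f (\<phi> f p)) = 0"
        using fp by (simp add: \<theta>_def scalar_section_def tscale_def elem_tensor_Nil)
    qed
    then show "\<phi> \<in> forms_of_level (r + 1)"
      using \<phi> unfolding forms_of_level_def by blast
  qed
qed

text \<open>
  Project the Jacobi forms onto each level and take the graded components there. A form in the
  common kernel moves up the filtration one level at a time, until it vanishes.
\<close>

theorem graded_embedding: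
  "\<exists>\<Psi> :: 'n jsection \<Rightarrow> int \<Rightarrow> nat \<Rightarrow> 'n jsection.
    (\<forall>\<phi>\<in>forms. \<Psi> \<phi> \<in> direct_sum (- int (lam ! 0)) (int (lam ! 0)) (gr_rank Q J lam point)
         (\<lambda>r. jacobi_forms Q D \<Gamma> J (replicate n 0) (k + r) m)) \<and>
    (\<forall>\<phi>\<in>forms. \<forall>\<psi>\<in>forms. \<Psi> (\<phi> + \<psi>) = \<Psi> \<phi> + \<Psi> \<psi>) \<and>
    (\<forall>c. \<forall>\<phi>\<in>forms. \<Psi> (section_scale c \<phi>) = (\<lambda>r i. section_scale c (\<Psi> \<phi> r i))) \<and>
    inj_on \<Psi> forms"
proof (cases "forms = {}")
  case False
  let ?l = "int (lam ! 0)" and ?S = "\<lambda>r. jacobi_forms Q D \<Gamma> J (replicate n 0) (k + r) m"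
  let ?\<alpha> = "gr_rank Q J lam point"
  interpret sections: vector_space section_scale
    by (rule section_scale_vector_space)
  have zero: "0 \<in> forms" using False zero_form by blast
  have zero_level: "0 \<in> forms_of_level r" for r
  proof -
    have "to_fiber f 0 \<in> level lam r" for f
      unfolding tlinear_simps(4)[OF to_fiber_tlinear] by (rule tens.subspace_0[OF level_subspace])
    then show ?thesis using zero unfolding forms_of_level_def by simp
  qed
  have subspace: "sections.subspace (forms_of_level r)" for r
    using zero_level forms_of_level_combination[of _ r _ 1] forms_of_level_combination[OF _ zero_level]
    by (simp add: sections.subspace_def)
  have "\<exists>q. (\<forall>\<phi> \<psi>. q (\<phi> + \<psi>) = q \<phi> + q \<psi>) \<and> (\<forall>c \<phi>. q (section_scale c \<phi>) = section_scale c (q \<phi>)) \<and>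
      (\<forall>\<phi>. q \<phi> \<in> forms_of_level r) \<and> (\<forall>\<phi>\<in>forms_of_level r. q \<phi> = \<phi>)" for r
    by (rule sections.exists_projection[OF subspace[of r]]) blast
  then obtain q where q_add: "\<And>r \<phi> \<psi>. q r (\<phi> + \<psi>) = q r \<phi> + q r \<psi>"
    and q_scale: "\<And>r c \<phi>. q r (section_scale c \<phi>) = section_scale c (q r \<phi>)"
    and q_level: "\<And>r \<phi>. q r \<phi> \<in> forms_of_level r" and q_id: "\<And>r \<phi>. \<phi> \<in> forms_of_level r \<Longrightarrow> q r \<phi> = \<phi>"
    by metis
  have "\<exists>\<theta>. (\<forall>i \<phi> \<psi>. \<theta> i (\<phi> + \<psi>) = \<theta> i \<phi> + \<theta> i \<psi>) \<and>
      (\<forall>i c \<phi>. \<theta> i (section_scale c \<phi>) = section_scale c (\<theta> i \<phi>)) \<and>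
      (\<forall>i. \<forall>\<phi>\<in>forms_of_level r. \<theta> i \<phi> \<in> ?S r) \<and>
      (\<forall>\<phi>\<in>forms_of_level r. (\<forall>i<?\<alpha> r. \<theta> i \<phi> = 0) \<longrightarrow> \<phi> \<in> forms_of_level (r + 1))"
    if "r \<ge> - ?l" for r
    by (rule graded_coordinates[OF that]) blast
  then obtain \<theta> where \<theta>: "\<And>r. r \<ge> - ?l \<Longrightarrow> (\<forall>i \<phi> \<psi>. \<theta> r i (\<phi> + \<psi>) = \<theta> r i \<phi> + \<theta> r i \<psi>) \<and>
      (\<forall>i c \<phi>. \<theta> r i (section_scale c \<phi>) = section_scale c (\<theta> r i \<phi>)) \<and>
      (\<forall>i. \<forall>\<phi>\<in>forms_of_level r. \<theta> r i \<phi> \<in> ?S r) \<and>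
      (\<forall>\<phi>\<in>forms_of_level r. (\<forall>i<?\<alpha> r. \<theta> r i \<phi> = 0) \<longrightarrow> \<phi> \<in> forms_of_level (r + 1))"
    by metis
  define \<Psi> where "\<Psi> \<phi> r i = (if - ?l \<le> r \<and> r \<le> ?l \<and> i < ?\<alpha> r then \<theta> r i (q r \<phi>) else 0)" for \<phi> r i
  have add: "\<Psi> (\<phi> + \<psi>) = \<Psi> \<phi> + \<Psi> \<psi>" for \<phi> \<psi>
  proof (intro ext)
    fix r i f p x
    show "\<Psi> (\<phi> + \<psi>) r i f p x = (\<Psi> \<phi> + \<Psi> \<psi>) r i f p x"
      using \<theta>[of r] by (simp add: \<Psi>_def q_add)
  qed
  have scale: "\<Psi> (section_scale c \<phi>) = (\<lambda>r i. section_scale c (\<Psi> \<phi> r i))" for c \<phi>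
  proof (intro ext)
    fix r i f p x
    have "section_scale c 0 = (0 :: 'n jsection)" by simp
    then show "\<Psi> (section_scale c \<phi>) r i f p x = section_scale c (\<Psi> \<phi> r i) f p x"
      using \<theta>[of r] unfolding \<Psi>_def q_scale by simp
  qed
  have kernel: "\<phi> = 0" if \<phi>: "\<phi> \<in> forms" and zero: "\<Psi> \<phi> = 0" for \<phi>
  proof -
    have "\<phi> \<in> forms_of_level (- ?l + int j)" if "j \<le> 2 * lam ! 0 + 1" for j
      using that
    proof (induction j)
      case 0
      then show ?case using \<phi> forms_of_lowest_level by simp
    next
      case (Suc j)
      let ?r = "- ?l + int j"
      have r: "- ?l \<le> ?r" "?r \<le> ?l" using Suc.prems by auto
      have \<phi>r: "\<phi> \<in> forms_of_level ?r" using Suc by simp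
      have "\<theta> ?r i \<phi> = 0" if "i < ?\<alpha> ?r" for i
      proof -
        have "\<Psi> \<phi> ?r i = 0" using zero by simp
        then show ?thesis using r that q_id[OF \<phi>r] by (simp add: \<Psi>_def)
      qed
      then have "\<phi> \<in> forms_of_level (?r + 1)" using \<theta>[OF r(1)] \<phi>r by blast
      then show ?case by (simp add: algebra_simps)
    qed
    from this[of "2 * lam ! 0 + 1"] have "\<phi> \<in> forms_of_level (?l + 1)" by simp
    then show ?thesis by (rule forms_of_highest_level)
  qed
  have "inj_on \<Psi> forms"
  proof (rule inj_onI)
    fix \<phi> \<psi> assume forms: "\<phi> \<in> forms" "\<psi> \<in> forms" and eq: "\<Psi> \<phi> = \<Psi> \<psi>"
    let ?\<delta> = "section_scale (-1) \<psi> + \<phi>"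
    have "\<Psi> ?\<delta> = 0"
      unfolding add scale eq by (simp add: fun_eq_iff section_scale_def tscale_def)
    moreover have "?\<delta> \<in> forms"
      by (intro jacobi_forms_combination forms)
    ultimately have "?\<delta> = 0" by (intro kernel)
    then show "\<phi> = \<psi>"
      by (simp add: fun_eq_iff section_scale_def tscale_def)
  qed
  moreover have "\<Psi> \<phi> \<in> direct_sum (- ?l) ?l ?\<alpha> ?S" for \<phi>
    using \<theta> q_level unfolding direct_sum_def \<Psi>_def by auto
  ultimately show ?thesis using add scale by blast
qed auto

end

end

theorem proposition8p15:
  fixes Q :: "int^'n^'n" and n m :: nat and k :: int and lam :: "nat list"
    and D :: "(complex^'n) set set" and \<Gamma> :: "(complex^'n^'n) set" and J p :: "(complex^'n) set"
  assumes "is_lattice Q" and "has_signature Q 2 n" and "n \<ge> 3"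
    and "D \<in> period_domains Q"
    and "subgroup \<Gamma> (O_plus Q D)" and "finite (rcosets\<^bsub>O_plus Q D\<^esub> \<Gamma>)"
    and "primitive_isotropic Q 2 J"
    and "is_partition n lam" and "col_len lam 0 + col_len lam 1 \<le> n" and "lam \<noteq> replicate n 1"
    and "m > 0"
    and "p \<in> D"
  shows "\<exists>\<Psi> :: 'n jsection \<Rightarrow> int \<Rightarrow> nat \<Rightarrow> 'n jsection.
    (\<forall>\<phi>\<in>jacobi_forms Q D \<Gamma> J lam k m. \<Psi> \<phi> \<in>
       direct_sum (- int (lam ! 0)) (int (lam ! 0)) (gr_rank Q J lam p)
         (\<lambda>r. jacobi_forms Q D \<Gamma> J (replicate n 0) (k + r) m)) \<and>
    (\<forall>\<phi>\<in>jacobi_forms Q D \<Gamma> J lam k m. \<forall>\<psi>\<in>jacobi_forms Q D \<Gamma> J lam k m.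
       \<Psi> (\<phi> + \<psi>) = \<Psi> \<phi> + \<Psi> \<psi>) \<and>
    (\<forall>c. \<forall>\<phi>\<in>jacobi_forms Q D \<Gamma> J lam k m.
       \<Psi> (section_scale c \<phi>) = (\<lambda>r i. section_scale c (\<Psi> \<phi> r i))) \<and>
    inj_on \<Psi> (jacobi_forms Q D \<Gamma> J lam k m)"
proof -
  note Q = \<open>is_lattice Q\<close>[unfolded is_lattice_def, THEN conjunct1] \<open>has_signature Q 2 n\<close>
  have J: "J \<subseteq> lat" "vec.dim J = 2" "\<And>x y. x \<in> J \<Longrightarrow> y \<in> J \<Longrightarrow> bform Q x y = 0"
    using assms(7) unfolding primitive_isotropic_def by blast+
  obtain B where B: "B \<subseteq> J" "vec.independent B" "J \<subseteq> vec.span B" "card B = 2"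
    using vec.basis_exists[of J] J(2) by metis
  then obtain a b where ab: "B = {a, b}" "a \<noteq> b" by (meson card_2_iff)
  have span_J: "vec.span J = vec.span {a, b}"
    using B(1,3) vec.span_minimal[OF B(3) vec.subspace_span] vec.span_mono[OF B(1)] unfolding ab(1) by blast
  interpret isotropic_plane Q a b
    using assms(1) B ab J(3) by unfold_locales auto
  obtain w where w: "p = line w" "bform Q w w = 0" "Re (bform Q w (cnj_vec w)) > 0"
    by (rule period_point[OF assms(4,12)])
  have "a \<noteq> 0"
    using independent(1) vec.dependent_zero by blast
  then have wa: "bform Q w a \<noteq> 0"
    using period_not_orthogonal[OF Q w(2,3)] B(1) J(1) isotropic(1) unfolding ab(1) by blast
  have e: "(1 / bform Q w a) *s a \<in> plane" "bform Q ((1 / bform Q w a) *s a) w = 1"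
    using wa plane_closed(3)[OF generators_in_plane(1)] by (simp_all add: bform_linear commute[of a w])
  obtain A where A: "adapted Q a b A" "fr_e' A = w"
    using adapted_frame_exists[OF e w(2)] by metis
  interpret jacobi_setting Q a b J A D \<Gamma> n
    using span_J A(1) assms(2,4,7) B(1) unfolding ab(1) by unfold_locales auto
  have "point = p"
    by (simp add: point_def A(2) w(1))
  then show ?thesis
    using graded_embedding[OF assms(8), of k m] assms(3) by simp
qed

end
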